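(* Let $(\Gamma,\mathrm d)$ be an $N$-dimensional bicovariant first order differential calculus on a Hopf algebra $A$, and let $\mathcal C_\Gamma$ be its quantum Cartan algebra, with even generators $X_i,f_{jk}$ and odd generators $\xi_i,\delta$ ($i,j,k=1,\dots,N$). The maps $\triangle:\mathcal C_\Gamma\to\mathcal C_\Gamma\otimes\mathcal C_\Gamma$ and $\varepsilon:\mathcal C_\Gamma\to\mathbb C$ defined on generators by $$\triangle(X_i)=1\otimes X_i+X_j\otimes f_{ji},\quad \triangle(f_{ij})=f_{ik}\otimes f_{kj},\quad \triangle(\xi_i)=1\otimes\xi_i+\xi_j\otimes f_{ji},\quad \triangle(\delta)=1\otimes\delta+\delta\otimes1,$$ $$\varepsilon(X_i)=\varepsilon(\xi_i)=\varepsilon(\delta)=0,\qquad \varepsilon(f_{ij})=\delta_{ij}$$ (with $\delta_{ij}$ the Kronecker symbol), and extended as homomorphisms of $\mathbb Z_2$-graded algebras, define a ($\mathbb Z_2$-graded) bialgebra structure on $\mathcal C_\Gamma$.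
   Context: Summation over repeated indices is understood; indices run in $\{1,\dots,N\}$; $\delta_{ij}$ is the Kronecker symbol, while $\delta$ without indices is an algebra generator. Calculus. $A$ is a unital complex Hopf algebra with invertible antipode, $H$ its dual Hopf algebra. $(\Gamma,\mathrm d)$ is a bicovariant first order differential calculus in the sense of Woronowicz: $\Gamma$ is an $A$-bimodule, $\mathrm d:A\to\Gamma$ is linear and satisfies the Leibniz rule, every element of $\Gamma$ is a sum $x_k\,\mathrm dy_k$, and there are a left coaction $\Delta_\Gamma:\Gamma\to A\otimes\Gamma$ and a right coaction ${}_\Gamma\Delta:\Gamma\to\Gamma\otimes A$ with $\Delta_\Gamma(x\,\mathrm dy)=\Delta(x)(\mathrm{id}\otimes\mathrm d)\Delta(y)$ and ${}_\Gamma\Delta(x\,\mathrm dy)=\Delta(x)(\mathrm d\otimes\mathrm{id})\Delta(y)$. Its dimension $N$ (the dimension of the space ${}_{inv}\Gamma$ of left-invariant elements, $\Delta_\Gamma(\omega)=1\otimes\omega$) is finite. Fix a basis $\omega_1,\dots,\omega_N$ of ${}_{inv}\Gamma$; it is a free $A$-module basis of $\Gamma$. For $f\in H$, $x\in A$ put $f\triangleright x=x_{(1)}f(x_{(2)})$. There are $f_{ij}\in H$ and $J_{ij}\in A$ with $\omega_ix=(f_{ij}\triangleright x)\omega_j$ for $x\in A$ and ${}_\Gamma\Delta(\omega_i)=\omega_j\otimes J_{ji}$. The quantum tangent space is $\mathcal T=\{X\in A':X(1)=0,\ X|_{R_\Gamma}=0\}\subset H$, where $R_\Gamma\subset\ker\varepsilon$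 is the right ideal characterizing the calculus; $\{X_i\}$ is the basis of $\mathcal T$ dual to $\{\omega_i\}$ under the pairing $\{X,x\,\mathrm dy\}=\varepsilon(x)X(y)$, so $\mathrm dx=(X_i\triangleright x)\omega_i$. Set $\sigma^{kl}_{ij}=f_{il}(J_{kj})$ (components of the Woronowicz braiding $\sigma(\omega_i\otimes\omega_j)=\sigma_{ij}^{kl}\omega_k\otimes\omega_l$) and $C_{ij}^k=X_j(J_{ik})$. Let $\sigma^t$ be the transposed map on $\mathcal T\otimes\mathcal T$, $\sigma^t(X_i\otimes X_j)=\sigma^{ij}_{kl}X_k\otimes X_l$, and let $t^{ij}_{kl}\in\mathbb C$, with $t^{ij}_{ij}=0$ (no sum), be such that $\ker(\mathrm{id}-\sigma^t)$ is spanned by the elements $X_i\otimes X_j+t^{ij}_{kl}X_k\otimes X_l$. Quantum Cartan algebra. $\mathcal C_\Gamma$ is the unital $\mathbb Z_2$-graded algebra over $\mathbb C$ generated by even elements $X_i,f_{jk}$ and odd elements $\xi_i,\delta$ with relations among the even generators $$X_iX_j-\sigma^{ij}_{kl}X_kX_l=C^k_{ij}X_k,\qquad \sigma^{ij}_{nm}f_{ip}f_{jq}=f_{ni}f_{mj}\sigma^{pq}_{ij},$$ $$C^i_{mn}f_{mj}f_{nk}+f_{ij}X_k=\sigma^{jk}_{pq}X_pf_{iq}+C^l_{jk}f_{il},\qquad X_kf_{nl}=\sigma^{kl}_{ij}f_{ni}X_j$$ (all of which hold in $H$), and $$\xi_i\xi_j+t^{ij}_{kl}\xi_k\xi_l=0,\quad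 \xi_i\delta+\delta\xi_i=X_i,\quad \delta\delta=0,\quad \xi_if_{kj}-\sigma^{ij}_{nm}f_{kn}\xi_m=0,$$ $$\xi_iX_j-\sigma^{ij}_{kl}X_k\xi_l=C^k_{ij}\xi_k,\quad f_{ij}\delta-\delta f_{ij}=0,\quad X_i\delta-\delta X_i=0.$$ The product on $\mathcal C_\Gamma\otimes\mathcal C_\Gamma$ is the graded one, $(a_1\otimes a_2)(b_1\otimes b_2)=(-1)^{|a_2||b_1|}a_1b_1\otimes a_2b_2$. *)

theory Defs
  imports
    Complex_Main
    "HOL-Library.Poly_Mapping"
    "HOL-Library.Function_Algebras"
    "HOL-Library.Z2"
begin

section \<open>Complex vector spaces and unital complex algebras\<close>

class complex_vector = ab_group_add +
  fixes scaleC :: "complex \<Rightarrow> 'a \<Rightarrow> 'a"  (infixr "*\<^sub>C" 75)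
  assumes scaleC_right_distrib: "a *\<^sub>C (x + y) = a *\<^sub>C x + a *\<^sub>C y"
    and scaleC_left_distrib: "(a + b) *\<^sub>C x = a *\<^sub>C x + b *\<^sub>C x"
    and scaleC_scaleC: "a *\<^sub>C (b *\<^sub>C x) = (a * b) *\<^sub>C x"
    and scaleC_one: "1 *\<^sub>C x = x"

global_interpretation complex_vector: vector_space "scaleC :: complex \<Rightarrow> 'a \<Rightarrow> 'a::complex_vector"
  by unfold_locales
    (simp_all add: scaleC_right_distrib scaleC_left_distrib scaleC_scaleC scaleC_one)

abbreviation clinear :: "('a::complex_vector \<Rightarrow> 'b::complex_vector) \<Rightarrow> bool"
  where "clinear \<equiv> Vector_Spaces.linear scaleC scaleC"

definition cbilinear :: "('a::complex_vector \<Rightarrow> 'b::complex_vector \<Rightarrow> 'c::complex_vector) \<Rightarrow> bool"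
  where "cbilinear B \<longleftrightarrow> (\<forall>y. clinear (\<lambda>x. B x y)) \<and> (\<forall>x. clinear (B x))"

definition clinear_on :: "'a::complex_vector set \<Rightarrow> ('a \<Rightarrow> 'b::complex_vector) \<Rightarrow> bool"
  where "clinear_on V \<phi> \<longleftrightarrow>
    (\<forall>u\<in>V. \<forall>v\<in>V. \<phi> (u + v) = \<phi> u + \<phi> v) \<and> (\<forall>c. \<forall>u\<in>V. \<phi> (c *\<^sub>C u) = c *\<^sub>C \<phi> u)"

definition basis_family :: "nat \<Rightarrow> (nat \<Rightarrow> 'a::complex_vector) \<Rightarrow> 'a set \<Rightarrow> bool"
  where "basis_family N b V \<longleftrightarrow>
    inj_on b {1..N} \<and> \<not> complex_vector.dependent (b ` {1..N}) \<and> complex_vector.span (b ` {1..N}) = V"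

text \<open>Unlike \<^class>\<open>ring_1\<close>, this class does not require \<open>0 \<noteq> 1\<close>, so that an algebra given by
  generators and relations is not assumed to be nonzero.\<close>

class complex_algebra = complex_vector + ring + monoid_mult +
  assumes mult_scaleC_left: "(a *\<^sub>C x) * y = a *\<^sub>C (x * y)"
    and mult_scaleC_right: "x * (a *\<^sub>C y) = a *\<^sub>C (x * y)"

instantiation complex :: complex_algebra
begin

definition scaleC_complex :: "complex \<Rightarrow> complex \<Rightarrow> complex"
  where "scaleC_complex a x = a * x"

instance
  by standard (simp_all add: scaleC_complex_def algebra_simps)

end

instantiation "fun" :: (type, complex_vector) complex_vector
begin

definition scaleC_fun :: "complex \<Rightarrow> ('a \<Rightarrow> 'b) \<Rightarrow> 'a \<Rightarrow> 'b"
  where "scaleC_fun a f = (\<lambda>x. a *\<^sub>C f x)"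

instance
  by standard (simp_all add: scaleC_fun_def fun_eq_iff scaleC_right_distrib scaleC_left_distrib
      scaleC_scaleC scaleC_one)

end

instantiation poly_mapping :: (type, complex_vector) complex_vector
begin

lift_definition scaleC_poly_mapping :: "complex \<Rightarrow> ('a \<Rightarrow>\<^sub>0 'b) \<Rightarrow> ('a \<Rightarrow>\<^sub>0 'b)"
  is "\<lambda>a p k. a *\<^sub>C p k"
  by (rule finite_subset[rotated]) auto

instance
  by standard (transfer; simp add: fun_eq_iff scaleC_right_distrib scaleC_left_distrib
      scaleC_scaleC scaleC_one)+

end


section \<open>Tensor product of complex vector spaces\<close>

definition bilinearity_relations :: "(('a::complex_vector \<times> 'b::complex_vector) \<Rightarrow>\<^sub>0 complex) set"
  where "bilinearity_relations =
    {Poly_Mapping.single (x + x', y) 1 - Poly_Mapping.single (x, y) 1 - Poly_Mapping.single (x', y) 1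
      | x x' y. True} \<union>
    {Poly_Mapping.single (x, y + y') 1 - Poly_Mapping.single (x, y) 1 - Poly_Mapping.single (x, y') 1
      | x y y'. True} \<union>
    {Poly_Mapping.single (c *\<^sub>C x, y) 1 - c *\<^sub>C Poly_Mapping.single (x, y) 1 | c x y. True} \<union>
    {Poly_Mapping.single (x, c *\<^sub>C y) 1 - c *\<^sub>C Poly_Mapping.single (x, y) 1 | c x y. True}"

definition tensor_eq ::
  "(('a::complex_vector \<times> 'b::complex_vector) \<Rightarrow>\<^sub>0 complex) \<Rightarrow> (('a \<times> 'b) \<Rightarrow>\<^sub>0 complex) \<Rightarrow> bool"
  where "tensor_eq p q \<longleftrightarrow> p - q \<in> complex_vector.span bilinearity_relations"

lemma equivp_tensor_eq:
  "equivp (tensor_eq :: (('a::complex_vector \<times> 'b::complex_vector) \<Rightarrow>\<^sub>0 complex) \<Rightarrow> _)"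
proof (rule equivpI)
  show "reflp (tensor_eq :: (('a \<times> 'b) \<Rightarrow>\<^sub>0 complex) \<Rightarrow> _)"
    by (rule reflpI) (simp add: tensor_eq_def complex_vector.span_zero)
  show "symp (tensor_eq :: (('a \<times> 'b) \<Rightarrow>\<^sub>0 complex) \<Rightarrow> _)"
    by (rule sympI) (metis tensor_eq_def complex_vector.span_neg minus_diff_eq)
  show "transp (tensor_eq :: (('a \<times> 'b) \<Rightarrow>\<^sub>0 complex) \<Rightarrow> _)"
  proof (rule transpI)
    fix p q r :: "('a \<times> 'b) \<Rightarrow>\<^sub>0 complex"
    assume "tensor_eq p q" "tensor_eq q r"
    then have "(p - q) + (q - r) \<in> complex_vector.span bilinearity_relations"
      unfolding tensor_eq_def by (rule complex_vector.span_add)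
    then show "tensor_eq p r" by (simp add: tensor_eq_def)
  qed
qed

quotient_type (overloaded) ('a, 'b) tensor =
  "('a::complex_vector \<times> 'b::complex_vector) \<Rightarrow>\<^sub>0 complex" / tensor_eq
  by (rule equivp_tensor_eq)

instantiation tensor :: (complex_vector, complex_vector) complex_vector
begin

lift_definition zero_tensor :: "('a, 'b) tensor" is 0 .

lift_definition plus_tensor :: "('a, 'b) tensor \<Rightarrow> ('a, 'b) tensor \<Rightarrow> ('a, 'b) tensor" is "(+)"
  unfolding tensor_eq_def by (metis add_diff_add complex_vector.span_add)

lift_definition minus_tensor :: "('a, 'b) tensor \<Rightarrow> ('a, 'b) tensor \<Rightarrow> ('a, 'b) tensor" is "(-)"
  unfolding tensor_eq_def
proof -
  fix p p' q q' :: "('a \<times> 'b) \<Rightarrow>\<^sub>0 complex"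
  assume "p - p' \<in> complex_vector.span bilinearity_relations"
    "q - q' \<in> complex_vector.span bilinearity_relations"
  then have "(p - p') - (q - q') \<in> complex_vector.span bilinearity_relations"
    by (rule complex_vector.span_diff)
  then show "p - q - (p' - q') \<in> complex_vector.span bilinearity_relations"
    by (simp add: algebra_simps)
qed

lift_definition uminus_tensor :: "('a, 'b) tensor \<Rightarrow> ('a, 'b) tensor" is uminus
  unfolding tensor_eq_def by (metis complex_vector.span_neg minus_diff_minus)

lift_definition scaleC_tensor :: "complex \<Rightarrow> ('a, 'b) tensor \<Rightarrow> ('a, 'b) tensor" is scaleC
  unfolding tensor_eq_def
  by (metis complex_vector.scale_right_diff_distrib complex_vector.span_scale)

instance
  by standard
    (transfer; simp add: algebra_simps tensor_eq_def complex_vector.span_zero scaleC_right_distrib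
      scaleC_left_distrib scaleC_scaleC scaleC_one)+

end

lift_definition tensor_pure :: "'a::complex_vector \<Rightarrow> 'b::complex_vector \<Rightarrow> ('a, 'b) tensor"
    (infixr "\<otimes>" 75)
  is "\<lambda>x y. Poly_Mapping.single (x, y) 1" .

text \<open>The linear map induced by a bilinear map; \<open>tensor_lift_pure\<close> and \<open>clinear_tensor_lift\<close>
  below show independence of the representative.\<close>

definition tensor_lift ::
  "('a::complex_vector \<Rightarrow> 'b::complex_vector \<Rightarrow> 'c::complex_vector) \<Rightarrow> ('a, 'b) tensor \<Rightarrow> 'c"
  where "tensor_lift B t =
    (let p = rep_tensor t in \<Sum>(x, y)\<in>Poly_Mapping.keys p. Poly_Mapping.lookup p (x, y) *\<^sub>C B x y)"

definition tensor_map ::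
  "('a::complex_vector \<Rightarrow> 'c::complex_vector) \<Rightarrow> ('b::complex_vector \<Rightarrow> 'd::complex_vector) \<Rightarrow>
    ('a, 'b) tensor \<Rightarrow> ('c, 'd) tensor"
  where "tensor_map f g = tensor_lift (\<lambda>x y. f x \<otimes> g y)"

definition tensor_assoc ::
  "(('a::complex_vector, 'b::complex_vector) tensor, 'c::complex_vector) tensor \<Rightarrow>
    ('a, ('b, 'c) tensor) tensor"
  where "tensor_assoc = tensor_lift (\<lambda>s z. tensor_lift (\<lambda>x y. x \<otimes> (y \<otimes> z)) s)"

text \<open>Factorwise product \<open>(a \<otimes> b)(c \<otimes> d) = f a c \<otimes> g b d\<close> for bilinear \<open>f\<close> and \<open>g\<close>.\<close>

definition tensor_act ::
  "('a::complex_vector \<Rightarrow> 'c::complex_vector \<Rightarrow> 'e::complex_vector) \<Rightarrow>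
    ('b::complex_vector \<Rightarrow> 'd::complex_vector \<Rightarrow> 'h::complex_vector) \<Rightarrow>
    ('a, 'b) tensor \<Rightarrow> ('c, 'd) tensor \<Rightarrow> ('e, 'h) tensor"
  where "tensor_act f g s t =
    tensor_lift (\<lambda>a b. tensor_lift (\<lambda>c d. f a c \<otimes> g b d) t) s"

definition tensor_subspace ::
  "'a::complex_vector set \<Rightarrow> 'b::complex_vector set \<Rightarrow> ('a, 'b) tensor set"
  where "tensor_subspace V W = complex_vector.span {x \<otimes> y | x y. x \<in> V \<and> y \<in> W}"

definition free_extension :: "('k \<Rightarrow> 'c::complex_vector) \<Rightarrow> ('k \<Rightarrow>\<^sub>0 complex) \<Rightarrow> 'c"
  where "free_extension b p = (\<Sum>k\<in>Poly_Mapping.keys p. Poly_Mapping.lookup p k *\<^sub>C b k)"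

lemma free_extension_superset:
  assumes "finite K" "Poly_Mapping.keys p \<subseteq> K"
  shows "free_extension b p = (\<Sum>k\<in>K. Poly_Mapping.lookup p k *\<^sub>C b k)"
  unfolding free_extension_def
  by (rule sum.mono_neutral_left) (use assms in \<open>auto simp: in_keys_iff\<close>)

lemma free_extension_add: "free_extension b (p + q) = free_extension b p + free_extension b q"
proof -
  let ?K = "Poly_Mapping.keys p \<union> Poly_Mapping.keys q"
  have "Poly_Mapping.keys (p + q) \<subseteq> ?K" by (rule Poly_Mapping.keys_add)
  then show ?thesis
    by (simp add: free_extension_superset[of ?K] lookup_add scaleC_left_distrib sum.distrib)
qed

lemma free_extension_scaleC: "free_extension b (c *\<^sub>C p) = c *\<^sub>C free_extension b p"
proof -
  have l: "Poly_Mapping.lookup (c *\<^sub>C p) k = c * Poly_Mapping.lookup p k" for k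
    by transfer (simp add: scaleC_complex_def)
  have "Poly_Mapping.keys (c *\<^sub>C p) \<subseteq> Poly_Mapping.keys p"
    by (auto simp: in_keys_iff l)
  then show ?thesis
    by (simp add: free_extension_superset[of "Poly_Mapping.keys p"] l scaleC_scaleC
        complex_vector.scale_sum_right)
qed

lemma free_extension_single: "free_extension b (Poly_Mapping.single k c) = c *\<^sub>C b k"
  by (simp add: free_extension_superset[of "{k}"])

lemma clinear_free_extension: "clinear (free_extension b)"
  by unfold_locales (simp_all add: free_extension_add free_extension_scaleC
      complex_vector.scale_right_distrib complex_vector.scale_left_distrib)

lemma tensor_lift_abs:
  assumes "cbilinear B"
  shows "tensor_lift B (abs_tensor p) = free_extension (\<lambda>(x, y). B x y) p"
proof -
  let ?E = "free_extension (\<lambda>(x, y). B x y)"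
  interpret E: Vector_Spaces.linear scaleC scaleC ?E by (rule clinear_free_extension)
  have B: "B (x + x') y = B x y + B x' y" "B x (y + y') = B x y + B x y'"
    "B (c *\<^sub>C x) y = c *\<^sub>C B x y" "B x (c *\<^sub>C y) = c *\<^sub>C B x y" for x x' y y' c
    using assms unfolding cbilinear_def Vector_Spaces.linear_iff by blast+
  have E0: "?E r = 0" if "r \<in> bilinearity_relations" for r
    using that by (auto simp: bilinearity_relations_def E.diff E.scale free_extension_single
        scaleC_one B)
  have "?E r = 0" if "r \<in> complex_vector.span bilinearity_relations" for r
    using that by (induction rule: complex_vector.span_induct_alt)
      (simp_all add: E.add E.scale E.zero E0)
  moreover have "tensor_eq p (rep_tensor (abs_tensor p))"
    by (metis Quotient_tensor Quotient_rel_rep Quotient_abs_rep Quotient_rep_abs equivp_symp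
        equivp_tensor_eq tensor.abs_eq_iff)
  ultimately have "?E (p - rep_tensor (abs_tensor p)) = 0"
    by (auto simp: tensor_eq_def)
  then have "?E (rep_tensor (abs_tensor p)) = ?E p"
    by (simp add: E.diff)
  then show ?thesis
    by (simp add: tensor_lift_def Let_def free_extension_def case_prod_unfold)
qed

lemma tensor_lift_pure: "cbilinear B \<Longrightarrow> tensor_lift B (x \<otimes> y) = B x y"
  by (simp add: tensor_pure.abs_eq tensor_lift_abs free_extension_single scaleC_one)

lemma clinear_tensor_lift:
  assumes "cbilinear B"
  shows "clinear (tensor_lift B)"
proof (unfold Vector_Spaces.linear_iff, intro conjI allI)
  show "vector_space (scaleC :: complex \<Rightarrow> ('a, 'b) tensor \<Rightarrow> _)"
    "vector_space (scaleC :: complex \<Rightarrow> 'c \<Rightarrow> _)"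
    by (rule complex_vector.vector_space_axioms)+
  show "tensor_lift B (s + t) = tensor_lift B s + tensor_lift B t" for s t
    by (induct s, induct t) (simp add: plus_tensor.abs_eq tensor_lift_abs assms free_extension_add)
  show "tensor_lift B (c *\<^sub>C t) = c *\<^sub>C tensor_lift B t" for c t
    by (induct t) (simp add: scaleC_tensor.abs_eq tensor_lift_abs assms free_extension_scaleC)
qed


section \<open>Hopf algebras\<close>

locale coalgebra =
  fixes \<Delta> :: "'a::complex_vector \<Rightarrow> ('a, 'a) tensor"
    and \<epsilon> :: "'a \<Rightarrow> complex"
  assumes linear_\<Delta>: "clinear \<Delta>"
    and linear_\<epsilon>: "clinear \<epsilon>"
    and coassoc: "tensor_assoc (tensor_map \<Delta> id (\<Delta> x)) = tensor_map id \<Delta> (\<Delta> x)"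
    and counit_left: "tensor_lift (\<lambda>a b. \<epsilon> a *\<^sub>C b) (\<Delta> x) = x"
    and counit_right: "tensor_lift (\<lambda>a b. \<epsilon> b *\<^sub>C a) (\<Delta> x) = x"

locale hopf_algebra = coalgebra \<Delta> \<epsilon>
  for \<Delta> :: "'a::complex_algebra \<Rightarrow> ('a, 'a) tensor"
    and \<epsilon> :: "'a \<Rightarrow> complex" +
  fixes S :: "'a \<Rightarrow> 'a"
  assumes \<Delta>_mult: "\<Delta> (x * y) = tensor_act (*) (*) (\<Delta> x) (\<Delta> y)"
    and \<Delta>_one: "\<Delta> 1 = 1 \<otimes> 1"
    and \<epsilon>_mult: "\<epsilon> (x * y) = \<epsilon> x * \<epsilon> y"
    and \<epsilon>_one: "\<epsilon> 1 = 1"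
    and linear_S: "clinear S"
    and antipode_left: "tensor_lift (\<lambda>a b. S a * b) (\<Delta> x) = \<epsilon> x *\<^sub>C 1"
    and antipode_right: "tensor_lift (\<lambda>a b. a * S b) (\<Delta> x) = \<epsilon> x *\<^sub>C 1"

text \<open>Underlying space of the dual Hopf algebra (Sweedler's finite dual): the functionals vanishing
  on a two-sided ideal of finite codimension.\<close>

definition finite_dual :: "('a::complex_algebra \<Rightarrow> complex) set"
  where "finite_dual = {f. clinear f \<and>
    (\<exists>I. complex_vector.subspace I \<and> (\<forall>a. \<forall>x\<in>I. a * x \<in> I \<and> x * a \<in> I) \<and>
      (\<exists>B. finite B \<and> complex_vector.span (I \<union> B) = UNIV) \<and> (\<forall>x\<in>I. f x = 0))}"

text \<open>\<open>f \<triangleright> x = x\<^sub>(\<^sub>1\<^sub>) f(x\<^sub>(\<^sub>2\<^sub>))\<close>\<close>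

definition dual_action ::
  "('a::complex_algebra \<Rightarrow> ('a, 'a) tensor) \<Rightarrow> ('a \<Rightarrow> complex) \<Rightarrow> 'a \<Rightarrow> 'a"
  where "dual_action \<Delta> f x = tensor_lift (\<lambda>a b. f b *\<^sub>C a) (\<Delta> x)"


section \<open>Bicovariant first order differential calculi\<close>

locale bimodule =
  fixes lact :: "'a::complex_algebra \<Rightarrow> 'g::complex_vector \<Rightarrow> 'g"
    and ract :: "'g \<Rightarrow> 'a \<Rightarrow> 'g"
  assumes bilinear_lact: "cbilinear lact"
    and bilinear_ract: "cbilinear ract"
    and lact_one: "lact 1 \<gamma> = \<gamma>"
    and ract_one: "ract \<gamma> 1 = \<gamma>"
    and lact_mult: "lact (x * y) \<gamma> = lact x (lact y \<gamma>)"
    and ract_mult: "ract \<gamma> (x * y) = ract (ract \<gamma> x) y"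
    and lact_ract: "lact x (ract \<gamma> y) = ract (lact x \<gamma>) y"

locale bicovariant_calculus = hopf_algebra \<Delta> \<epsilon> S + bimodule lact ract
  for \<Delta> :: "'a::complex_algebra \<Rightarrow> ('a, 'a) tensor"
    and \<epsilon> :: "'a \<Rightarrow> complex"
    and S :: "'a \<Rightarrow> 'a"
    and lact :: "'a \<Rightarrow> 'g::complex_vector \<Rightarrow> 'g"
    and ract :: "'g \<Rightarrow> 'a \<Rightarrow> 'g" +
  fixes d :: "'a \<Rightarrow> 'g"
    and \<Delta>L :: "'g \<Rightarrow> ('a, 'g) tensor"
    and \<Delta>R :: "'g \<Rightarrow> ('g, 'a) tensor"
  assumes linear_d: "clinear d"
    and leibniz: "d (x * y) = ract (d x) y + lact x (d y)"
    and sum_x_dy: "\<exists>n x y. \<gamma> = (\<Sum>k<n::nat. lact (x k) (d (y k)))"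
    and linear_\<Delta>L: "clinear \<Delta>L"
    and coaction_\<Delta>L: "tensor_assoc (tensor_map \<Delta> id (\<Delta>L \<gamma>)) = tensor_map id \<Delta>L (\<Delta>L \<gamma>)"
    and counit_\<Delta>L: "tensor_lift (\<lambda>a \<rho>. \<epsilon> a *\<^sub>C \<rho>) (\<Delta>L \<gamma>) = \<gamma>"
    and \<Delta>L_x_dy: "\<Delta>L (lact x (d y)) = tensor_act (*) lact (\<Delta> x) (tensor_map id d (\<Delta> y))"
    and linear_\<Delta>R: "clinear \<Delta>R"
    and coaction_\<Delta>R: "tensor_assoc (tensor_map \<Delta>R id (\<Delta>R \<gamma>)) = tensor_map id \<Delta> (\<Delta>R \<gamma>)"
    and counit_\<Delta>R: "tensor_lift (\<lambda>\<rho> a. \<epsilon> a *\<^sub>C \<rho>) (\<Delta>R \<gamma>) = \<gamma>"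
    and \<Delta>R_x_dy: "\<Delta>R (lact x (d y)) = tensor_act lact (*) (\<Delta> x) (tensor_map d id (\<Delta> y))"

definition left_invariant ::
  "('g::complex_vector \<Rightarrow> ('a::complex_algebra, 'g) tensor) \<Rightarrow> 'g set"
  where "left_invariant \<Delta>L = {\<omega>. \<Delta>L \<omega> = 1 \<otimes> \<omega>}"

text \<open>Woronowicz's right ideal: the \<open>x \<in> ker \<epsilon>\<close> with \<open>S(x\<^sub>(\<^sub>1\<^sub>)) d x\<^sub>(\<^sub>2\<^sub>) = 0\<close>.\<close>

definition calculus_ideal ::
  "('a::complex_algebra \<Rightarrow> ('a, 'a) tensor) \<Rightarrow> ('a \<Rightarrow> complex) \<Rightarrow> ('a \<Rightarrow> 'a) \<Rightarrow>
    ('a \<Rightarrow> 'g::complex_vector \<Rightarrow> 'g) \<Rightarrow> ('a \<Rightarrow> 'g) \<Rightarrow> 'a set"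
  where "calculus_ideal \<Delta> \<epsilon> S lact d =
    {x. \<epsilon> x = 0 \<and> tensor_lift (\<lambda>a b. lact (S a) (d b)) (\<Delta> x) = 0}"

definition quantum_tangent_space ::
  "('a::complex_algebra \<Rightarrow> ('a, 'a) tensor) \<Rightarrow> ('a \<Rightarrow> complex) \<Rightarrow> ('a \<Rightarrow> 'a) \<Rightarrow>
    ('a \<Rightarrow> 'g::complex_vector \<Rightarrow> 'g) \<Rightarrow> ('a \<Rightarrow> 'g) \<Rightarrow> ('a \<Rightarrow> complex) set"
  where "quantum_tangent_space \<Delta> \<epsilon> S lact d =
    {X. clinear X \<and> X 1 = 0 \<and> (\<forall>x\<in>calculus_ideal \<Delta> \<epsilon> S lact d. X x = 0)}"

text \<open>The functional \<open>x dy \<mapsto> \<epsilon>(x) X(y)\<close> on \<open>\<Gamma>\<close>; it exists for \<open>X\<close> in the quantum tangent space and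
  is unique because the elements \<open>x dy\<close> span \<open>\<Gamma>\<close>.\<close>

definition tangent_pairing ::
  "('a::complex_algebra \<Rightarrow> complex) \<Rightarrow> ('a \<Rightarrow> 'g::complex_vector \<Rightarrow> 'g) \<Rightarrow> ('a \<Rightarrow> 'g) \<Rightarrow>
    ('a \<Rightarrow> complex) \<Rightarrow> 'g \<Rightarrow> complex"
  where "tangent_pairing \<epsilon> lact d X =
    (THE L. clinear L \<and> (\<forall>x y. L (lact x (d y)) = \<epsilon> x * X y))"

text \<open>\<open>braiding f J k l i j\<close> is \<open>\<sigma>\<^sup>k\<^sup>l\<^sub>i\<^sub>j\<close> (upper indices first) and \<open>structure_const X J i j k\<close> is
  \<open>C\<^sub>i\<^sub>j\<^sup>k\<close>.\<close>

definition braiding ::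
  "(nat \<Rightarrow> nat \<Rightarrow> 'a \<Rightarrow> complex) \<Rightarrow> (nat \<Rightarrow> nat \<Rightarrow> 'a) \<Rightarrow> nat \<Rightarrow> nat \<Rightarrow> nat \<Rightarrow> nat \<Rightarrow> complex"
  where "braiding f J k l i j = f i l (J k j)"

definition structure_const ::
  "(nat \<Rightarrow> 'a \<Rightarrow> complex) \<Rightarrow> (nat \<Rightarrow> nat \<Rightarrow> 'a) \<Rightarrow> nat \<Rightarrow> nat \<Rightarrow> nat \<Rightarrow> complex"
  where "structure_const X J i j k = X j (J i k)"


section \<open>Graded algebras and graded bialgebras\<close>

definition graded_algebra :: "(bit \<Rightarrow> 'c::complex_algebra set) \<Rightarrow> bool"
  where "graded_algebra G \<longleftrightarrow>
    (\<forall>p. complex_vector.subspace (G p)) \<and>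
    (\<forall>x. \<exists>!(y, z). y \<in> G 0 \<and> z \<in> G 1 \<and> x = y + z) \<and>
    1 \<in> G 0 \<and> (\<forall>p q. \<forall>x\<in>G p. \<forall>y\<in>G q. x * y \<in> G (p + q))"

definition component :: "(bit \<Rightarrow> 'c::complex_algebra set) \<Rightarrow> bit \<Rightarrow> 'c \<Rightarrow> 'c"
  where "component G p x = (THE y. y \<in> G p \<and> x - y \<in> G (p + 1))"

text \<open>\<open>(a\<^sub>1 \<otimes> a\<^sub>2)(b\<^sub>1 \<otimes> b\<^sub>2) = (-1)\<^sup>p\<^sup>q a\<^sub>1b\<^sub>1 \<otimes> a\<^sub>2b\<^sub>2\<close> for \<open>|a\<^sub>2| = p\<close>, \<open>|b\<^sub>1| = q\<close>, extended to
  inhomogeneous elements.\<close>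

definition graded_tensor_mult ::
  "(bit \<Rightarrow> 'c::complex_algebra set) \<Rightarrow> ('c, 'c) tensor \<Rightarrow> ('c, 'c) tensor \<Rightarrow> ('c, 'c) tensor"
  where "graded_tensor_mult G s t =
    (\<Sum>p\<in>{0, 1}. \<Sum>q\<in>{0, 1}. (if p * q = 1 then -1 else 1) *\<^sub>C
      tensor_act (\<lambda>a\<^sub>1 b\<^sub>1. a\<^sub>1 * component G q b\<^sub>1) (\<lambda>a\<^sub>2 b\<^sub>2. component G p a\<^sub>2 * b\<^sub>2) s t)"

definition tensor_grading ::
  "(bit \<Rightarrow> 'c::complex_algebra set) \<Rightarrow> bit \<Rightarrow> ('c, 'c) tensor set"
  where "tensor_grading G r = complex_vector.span {x \<otimes> y | x y p q. x \<in> G p \<and> y \<in> G q \<and> p + q = r}"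

definition trivial_grading :: "bit \<Rightarrow> complex set"
  where "trivial_grading p = (if p = 0 then UNIV else {0})"

text \<open>The target algebra is given by its grading, product and unit, since \<open>C \<otimes> C\<close> carries the
  product \<^const>\<open>graded_tensor_mult\<close>.\<close>

definition graded_hom ::
  "(bit \<Rightarrow> 'c::complex_algebra set) \<Rightarrow> (bit \<Rightarrow> 'd::complex_vector set) \<Rightarrow> ('d \<Rightarrow> 'd \<Rightarrow> 'd) \<Rightarrow> 'd \<Rightarrow>
    ('c \<Rightarrow> 'd) \<Rightarrow> bool"
  where "graded_hom G G' mult one \<phi> \<longleftrightarrow>
    clinear \<phi> \<and> \<phi> 1 = one \<and> (\<forall>x y. \<phi> (x * y) = mult (\<phi> x) (\<phi> y)) \<and> (\<forall>p. \<phi> ` G p \<subseteq> G' p)"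

abbreviation graded_comult_hom ::
  "(bit \<Rightarrow> 'c::complex_algebra set) \<Rightarrow> ('c \<Rightarrow> ('c, 'c) tensor) \<Rightarrow> bool"
  where "graded_comult_hom G \<equiv> graded_hom G (tensor_grading G) (graded_tensor_mult G) (1 \<otimes> 1)"

abbreviation graded_counit_hom ::
  "(bit \<Rightarrow> 'c::complex_algebra set) \<Rightarrow> ('c \<Rightarrow> complex) \<Rightarrow> bool"
  where "graded_counit_hom G \<equiv> graded_hom G trivial_grading (*) 1"

definition graded_bialgebra ::
  "(bit \<Rightarrow> 'c::complex_algebra set) \<Rightarrow> ('c \<Rightarrow> ('c, 'c) tensor) \<Rightarrow> ('c \<Rightarrow> complex) \<Rightarrow> bool"
  where "graded_bialgebra G \<Delta> \<epsilon> \<longleftrightarrow>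
    graded_algebra G \<and> coalgebra \<Delta> \<epsilon> \<and> graded_comult_hom G \<Delta> \<and> graded_counit_hom G \<epsilon>"


section \<open>Algebras given by generators and relations\<close>

datatype 'g fword = FWord (letters: "'g list")

instantiation fword :: (type) monoid_add
begin

definition zero_fword :: "'a fword"
  where "0 = FWord []"

definition plus_fword :: "'a fword \<Rightarrow> 'a fword \<Rightarrow> 'a fword"
  where "u + v = FWord (letters u @ letters v)"

instance
  by standard (simp_all add: zero_fword_def plus_fword_def)

end

text \<open>The free algebra is the monoid algebra of the free monoid, with the convolution product of
  \<^theory>\<open>HOL-Library.Poly_Mapping\<close>.\<close>

type_synonym 'g free_algebra = "'g fword \<Rightarrow>\<^sub>0 complex"

definition letter :: "'g \<Rightarrow> 'g free_algebra"
  where "letter g = Poly_Mapping.single (FWord [g]) 1"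

definition free_on :: "'g set \<Rightarrow> 'g free_algebra set"
  where "free_on A = {p. \<forall>w\<in>Poly_Mapping.keys p. set (letters w) \<subseteq> A}"

definition generated_ideal :: "'g set \<Rightarrow> 'g free_algebra set \<Rightarrow> 'g free_algebra set"
  where "generated_ideal A R =
    complex_vector.span {p * r * q | p r q. p \<in> free_on A \<and> r \<in> R \<and> q \<in> free_on A}"

definition evaluate :: "('g \<Rightarrow> 'c::complex_algebra) \<Rightarrow> 'g free_algebra \<Rightarrow> 'c"
  where "evaluate \<iota> = free_extension (\<lambda>w. prod_list (map \<iota> (letters w)))"

text \<open>\<open>\<iota>\<close> exhibits \<open>'c\<close> as the algebra generated by \<open>A\<close> with relations \<open>R\<close>, that is, evaluation at
  \<open>\<iota>\<close> identifies \<open>'c\<close> with the quotient of the free algebra on \<open>A\<close> by the ideal generated by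
  \<open>R\<close>.\<close>

definition presented_by :: "'g set \<Rightarrow> 'g free_algebra set \<Rightarrow> ('g \<Rightarrow> 'c::complex_algebra) \<Rightarrow> bool"
  where "presented_by A R \<iota> \<longleftrightarrow>
    evaluate \<iota> ` free_on A = UNIV \<and>
    (\<forall>p\<in>free_on A. evaluate \<iota> p = 0 \<longleftrightarrow> p \<in> generated_ideal A R)"

definition presented_grading ::
  "'g set \<Rightarrow> ('g \<Rightarrow> bit) \<Rightarrow> ('g \<Rightarrow> 'c::complex_algebra) \<Rightarrow> bit \<Rightarrow> 'c set"
  where "presented_grading A deg \<iota> p = evaluate \<iota> `
    {q \<in> free_on A. \<forall>w\<in>Poly_Mapping.keys q. sum_list (map deg (letters w)) = p}"


section \<open>The quantum Cartan algebra\<close>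

datatype cartan_gen = GX nat | Gf nat nat | G\<xi> nat | G\<delta>

definition cartan_gens :: "nat \<Rightarrow> cartan_gen set"
  where "cartan_gens N =
    GX ` {1..N} \<union> {Gf i j | i j. i \<in> {1..N} \<and> j \<in> {1..N}} \<union> G\<xi> ` {1..N} \<union> {G\<delta>}"

fun cartan_parity :: "cartan_gen \<Rightarrow> bit" where
  "cartan_parity (GX i) = 0"
| "cartan_parity (Gf i j) = 0"
| "cartan_parity (G\<xi> i) = 1"
| "cartan_parity G\<delta> = 1"

text \<open>Each relation \<open>lhs = rhs\<close> is listed as \<open>lhs - rhs\<close>. Here \<open>\<sigma> i j k l\<close> is \<open>\<sigma>\<^sup>i\<^sup>j\<^sub>k\<^sub>l\<close>, \<open>C i j k\<close> is
  \<open>C\<^sub>i\<^sub>j\<^sup>k\<close> and \<open>t i j k l\<close> is \<open>t\<^sup>i\<^sup>j\<^sub>k\<^sub>l\<close>.\<close>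

definition cartan_relations ::
  "nat \<Rightarrow> (nat \<Rightarrow> nat \<Rightarrow> nat \<Rightarrow> nat \<Rightarrow> complex) \<Rightarrow> (nat \<Rightarrow> nat \<Rightarrow> nat \<Rightarrow> complex) \<Rightarrow>
    (nat \<Rightarrow> nat \<Rightarrow> nat \<Rightarrow> nat \<Rightarrow> complex) \<Rightarrow> cartan_gen free_algebra set"
  where "cartan_relations N \<sigma> C t =
    (let I = {1..N}; X = (\<lambda>i. letter (GX i)); f = (\<lambda>i j. letter (Gf i j));
         \<xi> = (\<lambda>i. letter (G\<xi> i)); \<delta> = letter G\<delta>
     in
      {X i * X j - (\<Sum>k\<in>I. \<Sum>l\<in>I. \<sigma> i j k l *\<^sub>C (X k * X l)) - (\<Sum>k\<in>I. C i j k *\<^sub>C X k)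
        | i j. i \<in> I \<and> j \<in> I} \<union>
      {(\<Sum>i\<in>I. \<Sum>j\<in>I. \<sigma> i j n m *\<^sub>C (f i p * f j q)) - (\<Sum>i\<in>I. \<Sum>j\<in>I. \<sigma> p q i j *\<^sub>C (f n i * f m j))
        | n m p q. n \<in> I \<and> m \<in> I \<and> p \<in> I \<and> q \<in> I} \<union>
      {(\<Sum>m\<in>I. \<Sum>n\<in>I. C m n i *\<^sub>C (f m j * f n k)) + f i j * X k
          - (\<Sum>p\<in>I. \<Sum>q\<in>I. \<sigma> j k p q *\<^sub>C (X p * f i q)) - (\<Sum>l\<in>I. C j k l *\<^sub>C f i l)
        | i j k. i \<in> I \<and> j \<in> I \<and> k \<in> I} \<union>
      {X k * f n l - (\<Sum>i\<in>I. \<Sum>j\<in>I. \<sigma> k l i j *\<^sub>C (f n i * X j))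
        | k n l. k \<in> I \<and> n \<in> I \<and> l \<in> I} \<union>
      {\<xi> i * \<xi> j + (\<Sum>k\<in>I. \<Sum>l\<in>I. t i j k l *\<^sub>C (\<xi> k * \<xi> l)) | i j. i \<in> I \<and> j \<in> I} \<union>
      {\<xi> i * \<delta> + \<delta> * \<xi> i - X i | i. i \<in> I} \<union>
      {\<delta> * \<delta>} \<union>
      {\<xi> i * f k j - (\<Sum>n\<in>I. \<Sum>m\<in>I. \<sigma> i j n m *\<^sub>C (f k n * \<xi> m))
        | i j k. i \<in> I \<and> j \<in> I \<and> k \<in> I} \<union>
      {\<xi> i * X j - (\<Sum>k\<in>I. \<Sum>l\<in>I. \<sigma> i j k l *\<^sub>C (X k * \<xi> l)) - (\<Sum>k\<in>I. C i j k *\<^sub>C \<xi> k)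
        | i j. i \<in> I \<and> j \<in> I} \<union>
      {f i j * \<delta> - \<delta> * f i j | i j. i \<in> I \<and> j \<in> I} \<union>
      {X i * \<delta> - \<delta> * X i | i. i \<in> I})"

definition quantum_cartan_algebra ::
  "nat \<Rightarrow> (nat \<Rightarrow> nat \<Rightarrow> nat \<Rightarrow> nat \<Rightarrow> complex) \<Rightarrow> (nat \<Rightarrow> nat \<Rightarrow> nat \<Rightarrow> complex) \<Rightarrow>
    (nat \<Rightarrow> nat \<Rightarrow> nat \<Rightarrow> nat \<Rightarrow> complex) \<Rightarrow> (cartan_gen \<Rightarrow> 'c::complex_algebra) \<Rightarrow> bool"
  where "quantum_cartan_algebra N \<sigma> C t \<iota> \<longleftrightarrow>
    presented_by (cartan_gens N) (cartan_relations N \<sigma> C t) \<iota>"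

definition cartan_grading :: "nat \<Rightarrow> (cartan_gen \<Rightarrow> 'c::complex_algebra) \<Rightarrow> bit \<Rightarrow> 'c set"
  where "cartan_grading N \<iota> = presented_grading (cartan_gens N) cartan_parity \<iota>"

definition cartan_comult_on_gens ::
  "nat \<Rightarrow> (cartan_gen \<Rightarrow> 'c::complex_algebra) \<Rightarrow> ('c \<Rightarrow> ('c, 'c) tensor) \<Rightarrow> bool"
  where "cartan_comult_on_gens N \<iota> D \<longleftrightarrow>
    (\<forall>i\<in>{1..N}. D (\<iota> (GX i)) = 1 \<otimes> \<iota> (GX i) + (\<Sum>j\<in>{1..N}. \<iota> (GX j) \<otimes> \<iota> (Gf j i))) \<and>
    (\<forall>i\<in>{1..N}. \<forall>j\<in>{1..N}. D (\<iota> (Gf i j)) = (\<Sum>k\<in>{1..N}. \<iota> (Gf i k) \<otimes> \<iota> (Gf k j))) \<and>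
    (\<forall>i\<in>{1..N}. D (\<iota> (G\<xi> i)) = 1 \<otimes> \<iota> (G\<xi> i) + (\<Sum>j\<in>{1..N}. \<iota> (G\<xi> j) \<otimes> \<iota> (Gf j i))) \<and>
    D (\<iota> G\<delta>) = 1 \<otimes> \<iota> G\<delta> + \<iota> G\<delta> \<otimes> 1"

definition cartan_counit_on_gens ::
  "nat \<Rightarrow> (cartan_gen \<Rightarrow> 'c::complex_algebra) \<Rightarrow> ('c \<Rightarrow> complex) \<Rightarrow> bool"
  where "cartan_counit_on_gens N \<iota> e \<longleftrightarrow>
    (\<forall>i\<in>{1..N}. e (\<iota> (GX i)) = 0 \<and> e (\<iota> (G\<xi> i)) = 0) \<and> e (\<iota> G\<delta>) = 0 \<and>
    (\<forall>i\<in>{1..N}. \<forall>j\<in>{1..N}. e (\<iota> (Gf i j)) = (if i = j then 1 else 0))"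

end

theory Submission
  imports Defs
begin

text \<open>A homomorphism out of \<open>\<C>\<^sub>\<Gamma>\<close> is the same as a family of images of the generators that satisfies
  the defining relations. That the images \<open>1 \<otimes> X\<^sub>i + X\<^sub>j \<otimes> f\<^sub>j\<^sub>i\<close> etc. satisfy them is a computation with
  the relations alone, except for \<open>\<xi>\<^sub>i\<xi>\<^sub>j + t\<^sup>i\<^sup>j\<^sub>k\<^sub>l \<xi>\<^sub>k\<xi>\<^sub>l = 0\<close>, which also uses the choice of \<open>t\<close>. There the
  mixed terms vanish because \<open>X\<^sub>i \<otimes> X\<^sub>j + t\<^sup>i\<^sup>j\<^sub>k\<^sub>l X\<^sub>k \<otimes> X\<^sub>l\<close> is fixed by \<open>\<sigma>\<^sup>t\<close>, and \<open>\<xi>\<^sub>a\<xi>\<^sub>b \<otimes> v\<^sub>a\<^sub>b\<close> with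
  \<open>v\<^sub>a\<^sub>b = f\<^sub>a\<^sub>i f\<^sub>b\<^sub>j + t\<^sup>i\<^sup>j\<^sub>k\<^sub>l f\<^sub>a\<^sub>k f\<^sub>b\<^sub>l\<close> vanishes because \<open>X\<^sub>a \<otimes> X\<^sub>b \<mapsto> \<xi>\<^sub>a\<xi>\<^sub>b\<close> factors through \<open>id - \<sigma>\<^sup>t\<close> while
  \<open>v\<close> is invariant under \<open>\<sigma>\<close>, as the \<open>f\<^sub>i\<^sub>j\<close> intertwine \<open>\<sigma>\<close>. Coassociativity and the counit laws
  are equalities of homomorphisms that agree on generators.\<close>

section \<open>Tensor products\<close>

text \<open>A homomorphism can only be defined into something already known to be an associative
  algebra, so the tensor square with its sign rule has to be established first, and the cube for
  coassociativity. Their products are not type class operations; hence product, unit and parity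
  involution \<open>\<tau>\<close> are explicit parameters. With \<open>\<tau>\<close> in place of
  homogeneous components, signs become linear maps and identities can be checked on arbitrary pure
  tensors. The presentation itself yields \<open>\<tau>\<close>: the relations are homogeneous, so
  attaching signs to the generators extends to an automorphism. In the relation for
  \<open>\<xi>\<^sub>i\<xi>\<^sub>j\<close> the sign rule gives the mixed terms the coefficients
  \<open>f\<^sub>a\<^sub>i\<xi>\<^sub>j - \<xi>\<^sub>if\<^sub>a\<^sub>j\<close>. Reordering the
  second product turns this into \<open>id - \<sigma>\<close> applied to products of
  \<open>f\<close> and \<open>\<xi>\<close>, which is why the eigenvalue 1 matters. The
  factorization of \<open>\<xi>\<^sub>a\<xi>\<^sub>b\<close> is not canonical: it comes from a
  chosen linear right inverse of \<open>id - \<sigma>\<^sup>t\<close> on its range.\<close>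

lemma clinear_iff:
  "clinear h \<longleftrightarrow> (\<forall>x y. h (x + y) = h x + h y) \<and> (\<forall>c x. h (c *\<^sub>C x) = c *\<^sub>C h x)"
  by (auto simp: Vector_Spaces.linear_iff complex_vector.vector_space_axioms)

lemma clinear_simps:
  assumes "clinear h"
  shows "h (x + y) = h x + h y" "h (c *\<^sub>C x) = c *\<^sub>C h x" "h 0 = 0" "h (x - y) = h x - h y"
    "h (- x) = - h x" "h (\<Sum>k\<in>K. u k) = (\<Sum>k\<in>K. h (u k))"
proof -
  interpret Vector_Spaces.linear scaleC scaleC h by fact
  show "h (x + y) = h x + h y" "h (c *\<^sub>C x) = c *\<^sub>C h x" "h 0 = 0" "h (x - y) = h x - h y"
    "h (- x) = - h x" "h (\<Sum>k\<in>K. u k) = (\<Sum>k\<in>K. h (u k))"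
    by (rule add scale zero diff neg sum)+
qed

lemma cbilinear_iff:
  "cbilinear B \<longleftrightarrow> (\<forall>x x' y. B (x + x') y = B x y + B x' y) \<and>
    (\<forall>x y y'. B x (y + y') = B x y + B x y') \<and>
    (\<forall>c x y. B (c *\<^sub>C x) y = c *\<^sub>C B x y) \<and> (\<forall>c x y. B x (c *\<^sub>C y) = c *\<^sub>C B x y)"
  by (auto simp: cbilinear_def clinear_iff)

lemma cbilinear_simps:
  assumes "cbilinear B"
  shows "B (x + x') y = B x y + B x' y" "B x (y + y') = B x y + B x y'"
    "B (c *\<^sub>C x) y = c *\<^sub>C B x y" "B x (c *\<^sub>C y) = c *\<^sub>C B x y"
    "B 0 y = 0" "B x 0 = 0" "B (x - x') y = B x y - B x' y" "B x (y - y') = B x y - B x y'"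
    "B (- x) y = - B x y" "B x (- y) = - B x y"
    "B (\<Sum>k\<in>K. u k) y = (\<Sum>k\<in>K. B (u k) y)" "B x (\<Sum>k\<in>K. v k) = (\<Sum>k\<in>K. B x (v k))"
proof -
  have l: "clinear (\<lambda>x. B x y)" for y using assms by (simp add: cbilinear_def)
  have r: "clinear (B x)" for x using assms by (simp add: cbilinear_def)
  show "B (x + x') y = B x y + B x' y" "B x (y + y') = B x y + B x y'"
    "B (c *\<^sub>C x) y = c *\<^sub>C B x y" "B x (c *\<^sub>C y) = c *\<^sub>C B x y"
    "B 0 y = 0" "B x 0 = 0" "B (x - x') y = B x y - B x' y" "B x (y - y') = B x y - B x y'"
    "B (- x) y = - B x y" "B x (- y) = - B x y"
    "B (\<Sum>k\<in>K. u k) y = (\<Sum>k\<in>K. B (u k) y)" "B x (\<Sum>k\<in>K. v k) = (\<Sum>k\<in>K. B x (v k))"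
    by (rule clinear_simps[OF l] clinear_simps[OF r])+
qed

lemma tensor_pure_cbilinear: "cbilinear (\<otimes>)"
  unfolding cbilinear_iff
proof (intro conjI allI)
  have in_span: "tensor_eq p q" if "p - q \<in> bilinearity_relations"
    for p q :: "('a \<times> 'b) \<Rightarrow>\<^sub>0 complex"
    unfolding tensor_eq_def by (rule complex_vector.span_base) (rule that)
  fix x x' :: 'a and y y' :: 'b and c
  \<comment> \<open>Reading \<open>diff_diff_eq\<close> backwards gives the difference the shape
    \<open>p - q - r\<close> of the generators in \<open>bilinearity_relations\<close>.\<close>
  show "(x + x') \<otimes> y = x \<otimes> y + x' \<otimes> y" "x \<otimes> (y + y') = x \<otimes> y + x \<otimes> y'"
    by (transfer, rule in_span, unfold bilinearity_relations_def diff_diff_eq[symmetric], blast)+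
  show "(c *\<^sub>C x) \<otimes> y = c *\<^sub>C (x \<otimes> y)" "x \<otimes> (c *\<^sub>C y) = c *\<^sub>C (x \<otimes> y)"
    by (transfer, rule in_span, unfold bilinearity_relations_def, blast)+
qed

lemmas tensor_pure_simps = cbilinear_simps[OF tensor_pure_cbilinear]

lemma poly_mapping_decompose:
  "p = (\<Sum>k\<in>Poly_Mapping.keys p. Poly_Mapping.lookup p k *\<^sub>C Poly_Mapping.single k (1::complex))"
proof -
  have s: "c *\<^sub>C Poly_Mapping.single k (1::complex) = Poly_Mapping.single k c" for c k
    by (rule poly_mapping_eqI) (simp add: scaleC_poly_mapping.rep_eq lookup_single when_def scaleC_complex_def)
  show ?thesis
    by (rule poly_mapping_eqI)
      (simp add: s lookup_sum lookup_single when_def in_keys_iff)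
qed

lemma poly_mapping_clinear_eqI:
  fixes g h :: "('k \<Rightarrow>\<^sub>0 complex) \<Rightarrow> 'v::complex_vector"
  assumes "clinear g" "clinear h"
    and "\<And>k. k \<in> Poly_Mapping.keys p \<Longrightarrow> g (Poly_Mapping.single k 1) = h (Poly_Mapping.single k 1)"
  shows "g p = h p"
  by (subst (1 2) poly_mapping_decompose)
    (simp add: clinear_simps[OF assms(1)] clinear_simps[OF assms(2)] assms(3))

lemma clinear_abs_tensor: "clinear abs_tensor"
  by (simp add: clinear_iff plus_tensor.abs_eq scaleC_tensor.abs_eq)

lemma clinear_compose: "clinear g \<Longrightarrow> clinear h \<Longrightarrow> clinear (\<lambda>x. g (h x))"
  by (simp add: clinear_iff)

lemma clinear_add: "clinear g \<Longrightarrow> clinear h \<Longrightarrow> clinear (\<lambda>x. g x + h x)"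
  by (simp add: clinear_iff scaleC_right_distrib)

lemma clinear_scaleC: "clinear g \<Longrightarrow> clinear (\<lambda>x. c *\<^sub>C g x)"
  by (simp add: clinear_iff scaleC_right_distrib scaleC_scaleC mult.commute)

lemma clinear_id: "clinear id" "clinear (\<lambda>x. x)"
  by (simp_all add: clinear_iff)

section \<open>Equality of linear maps on tensor products\<close>

lemma tensor_clinear_eqI:
  assumes "clinear g" "clinear h" "\<And>x y. g (x \<otimes> y) = h (x \<otimes> y)"
  shows "g s = h s"
proof (induct s)
  case (1 p)
  show ?case
    by (rule poly_mapping_clinear_eqI[where p = p])
      (auto intro: clinear_compose assms clinear_abs_tensor
        simp: assms(3)[unfolded tensor_pure.abs_eq])
qed

text \<open>Serves claims that are not equalities of linear maps, such as membership in a graded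
  piece: they are proved by induction over this span.\<close>

lemma tensor_in_span_pure: "s \<in> complex_vector.span (range (\<lambda>(a, b). a \<otimes> b))"
proof (induct s)
  case (1 p)
  have "abs_tensor p = (\<Sum>k\<in>Poly_Mapping.keys p.
      Poly_Mapping.lookup p k *\<^sub>C abs_tensor (Poly_Mapping.single k 1))"
    by (subst poly_mapping_decompose) (simp only: clinear_simps[OF clinear_abs_tensor])
  also have "\<dots> = (\<Sum>(a, b)\<in>Poly_Mapping.keys p. Poly_Mapping.lookup p (a, b) *\<^sub>C (a \<otimes> b))"
    by (simp add: tensor_pure.abs_eq case_prod_unfold)
  also have "\<dots> \<in> complex_vector.span (range (\<lambda>(a, b). a \<otimes> b))"
    by (intro complex_vector.span_sum)
      (clarify, intro complex_vector.span_scale complex_vector.span_base, force)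
  finally show ?case .
qed

lemma tensor_clinear_eqI3_left:
  fixes g h :: "(('a::complex_vector, 'b::complex_vector) tensor, 'c::complex_vector) tensor \<Rightarrow> 'd::complex_vector"
  assumes "clinear g" "clinear h" "\<And>x y z. g ((x \<otimes> y) \<otimes> z) = h ((x \<otimes> y) \<otimes> z)"
  shows "g s = h s"
proof (rule tensor_clinear_eqI[OF assms(1,2)])
  fix u :: "('a, 'b) tensor" and z :: 'c
  have l: "clinear (\<lambda>u :: ('a, 'b) tensor. u \<otimes> z)"
    by (simp add: clinear_iff tensor_pure_simps)
  show "g (u \<otimes> z) = h (u \<otimes> z)"
    by (rule tensor_clinear_eqI[where s = u]) (auto intro: clinear_compose l assms)
qed

lemma cbilinear_tensor_eqI:
  assumes "cbilinear B" "cbilinear B'"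
    and "\<And>a b c d. B (a \<otimes> b) (c \<otimes> d) = B' (a \<otimes> b) (c \<otimes> d)"
  shows "B s t = B' s t"
proof -
  have "B (a \<otimes> b) t = B' (a \<otimes> b) t" for a b
    by (rule tensor_clinear_eqI) (use assms in \<open>auto simp: cbilinear_def\<close>)
  then show ?thesis
    by (rule tensor_clinear_eqI[where g = "\<lambda>s. B s t" and h = "\<lambda>s. B' s t", rotated 2])
      (use assms in \<open>auto simp: cbilinear_def\<close>)
qed

text \<open>Linearity of the lift in the bilinear map itself. It is needed for nested lifts such as
  \<open>tensor_assoc\<close> and \<open>tensor_act\<close>, whose inner bilinear map depends
  linearly on an outer variable.\<close>

lemma tensor_lift_add_map:
  assumes "cbilinear B" "cbilinear B'"
  shows "tensor_lift (\<lambda>x y. B x y + B' x y) s = tensor_lift B s + tensor_lift B' s"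
proof -
  have b: "cbilinear (\<lambda>x y. B x y + B' x y)"
    by (auto simp: cbilinear_iff cbilinear_simps[OF assms(1)] cbilinear_simps[OF assms(2)]
        scaleC_right_distrib)
  show ?thesis
    by (rule tensor_clinear_eqI)
      (auto intro!: clinear_add clinear_tensor_lift assms b simp: tensor_lift_pure assms b)
qed

lemma tensor_lift_scaleC_map:
  assumes "cbilinear B"
  shows "tensor_lift (\<lambda>x y. c *\<^sub>C B x y) s = c *\<^sub>C tensor_lift B s"
proof -
  have b: "cbilinear (\<lambda>x y. c *\<^sub>C B x y)"
    by (auto simp: cbilinear_iff cbilinear_simps[OF assms]
        scaleC_right_distrib scaleC_scaleC mult.commute)
  show ?thesis
    by (rule tensor_clinear_eqI)
      (auto intro!: clinear_scaleC clinear_tensor_lift assms b simp: tensor_lift_pure assms b)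
qed

section \<open>Functoriality, associator and factorwise products\<close>

lemma cbilinear_pure_compose:
  assumes "clinear g" "clinear h"
  shows "cbilinear (\<lambda>x y. g x \<otimes> h y)"
  by (simp add: cbilinear_iff clinear_simps[OF assms(1)] clinear_simps[OF assms(2)] tensor_pure_simps)

lemma clinear_tensor_map: "clinear g \<Longrightarrow> clinear h \<Longrightarrow> clinear (tensor_map g h)"
  unfolding tensor_map_def by (intro clinear_tensor_lift cbilinear_pure_compose)

lemma tensor_map_pure:
  "clinear g \<Longrightarrow> clinear h \<Longrightarrow> tensor_map g h (x \<otimes> y) = g x \<otimes> h y"
  unfolding tensor_map_def by (simp add: tensor_lift_pure cbilinear_pure_compose)

lemma cbilinear_tensor_assoc_aux:
  "cbilinear (\<lambda>(s :: ('a::complex_vector, 'b::complex_vector) tensor) (z :: 'c::complex_vector).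
    tensor_lift (\<lambda>x y. x \<otimes> (y \<otimes> z)) s)"
proof -
  have b: "cbilinear (\<lambda>(x :: 'a) (y :: 'b). x \<otimes> (y \<otimes> z))" for z :: 'c
    by (simp add: cbilinear_iff tensor_pure_simps)
  show ?thesis
    unfolding cbilinear_iff
    by (intro conjI allI)
      (simp_all add: clinear_simps[OF clinear_tensor_lift[OF b]] tensor_pure_simps
        tensor_lift_add_map tensor_lift_scaleC_map b)
qed

lemma clinear_tensor_assoc: "clinear tensor_assoc"
  unfolding tensor_assoc_def by (rule clinear_tensor_lift[OF cbilinear_tensor_assoc_aux])

lemma tensor_assoc_pure: "tensor_assoc ((x \<otimes> y) \<otimes> z) = x \<otimes> (y \<otimes> z)"
proof -
  have b: "cbilinear (\<lambda>x y. x \<otimes> (y \<otimes> z))"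
    by (simp add: cbilinear_iff tensor_pure_simps)
  show ?thesis
    unfolding tensor_assoc_def by (simp add: tensor_lift_pure cbilinear_tensor_assoc_aux b)
qed

lemma cbilinear_tensor_act_aux:
  assumes "cbilinear f" "cbilinear g"
  shows "cbilinear (\<lambda>a b. tensor_lift (\<lambda>c d. f a c \<otimes> g b d) t)"
    and "cbilinear (\<lambda>c d. f a c \<otimes> g b d)"
proof -
  have b: "cbilinear (\<lambda>c d. f a c \<otimes> g b d)" for a b
    using assms by (intro cbilinear_pure_compose) (auto simp: cbilinear_def)
  then show "cbilinear (\<lambda>c d. f a c \<otimes> g b d)" .
  show "cbilinear (\<lambda>a b. tensor_lift (\<lambda>c d. f a c \<otimes> g b d) t)"
    unfolding cbilinear_iff
    by (intro conjI allI)
      (simp_all add: cbilinear_simps[OF assms(1)] cbilinear_simps[OF assms(2)] tensor_pure_simps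
        tensor_lift_add_map tensor_lift_scaleC_map b)
qed

lemma tensor_act_pure:
  assumes "cbilinear f" "cbilinear g"
  shows "tensor_act f g (a \<otimes> b) (c \<otimes> d) = f a c \<otimes> g b d"
  unfolding tensor_act_def
  by (subst tensor_lift_pure[OF cbilinear_tensor_act_aux(1)[OF assms]])
    (rule tensor_lift_pure[OF cbilinear_tensor_act_aux(2)[OF assms]])

lemma cbilinear_tensor_act:
  assumes "cbilinear f" "cbilinear g"
  shows "cbilinear (tensor_act f g)"
proof -
  note aux = cbilinear_tensor_act_aux[OF assms]
  have l: "clinear (\<lambda>s. tensor_act f g s t)" for t
    unfolding tensor_act_def by (rule clinear_tensor_lift[OF aux(1)])
  have "clinear (tensor_act f g s)" for s
    unfolding clinear_iff
  proof (intro conjI allI)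
    fix t t' c
    show "tensor_act f g s (t + t') = tensor_act f g s t + tensor_act f g s t'"
      unfolding tensor_act_def
      by (simp add: clinear_simps[OF clinear_tensor_lift[OF aux(2)]] tensor_lift_add_map aux(1))
    show "tensor_act f g s (c *\<^sub>C t) = c *\<^sub>C tensor_act f g s t"
      unfolding tensor_act_def
      by (simp add: clinear_simps[OF clinear_tensor_lift[OF aux(2)]] tensor_lift_scaleC_map aux(1))
  qed
  with l show ?thesis by (simp add: cbilinear_def)
qed

section \<open>Superalgebras and their tensor products\<close>

text \<open>The grading is encoded by the parity involution \<open>\<tau>\<close>, which is \<open>(-1)\<^sup>p\<close> on degree \<open>p\<close>.\<close>

locale superalgebra =
  fixes mult :: "'a::complex_vector \<Rightarrow> 'a \<Rightarrow> 'a"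
    and one :: 'a
    and \<tau> :: "'a \<Rightarrow> 'a"
  assumes cbilinear_mult: "cbilinear mult"
    and mult_assoc: "mult (mult x y) z = mult x (mult y z)"
    and mult_one_left: "mult one x = x"
    and mult_one_right: "mult x one = x"
    and linear_\<tau>: "clinear \<tau>"
    and \<tau>_\<tau>: "\<tau> (\<tau> x) = x"
    and \<tau>_mult: "\<tau> (mult x y) = mult (\<tau> x) (\<tau> y)"
begin

text \<open>Apply \<open>\<tau>\<close> to \<open>mult (\<tau> one) one = \<tau> one\<close>: one
  side becomes \<open>mult one (\<tau> one)\<close>, the other \<open>one\<close>.\<close>

lemma \<tau>_one: "\<tau> one = one"
  by (metis \<tau>_\<tau> \<tau>_mult mult_one_left mult_one_right)

end

text \<open>For an involution \<open>\<tau>\<close>, this and \<open>odd_part\<close> are the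
  projections onto the eigenspaces 1 and -1. Being total linear maps, they express sign rules
  without homogeneity conditions.\<close>

definition even_part :: "('a::complex_vector \<Rightarrow> 'a) \<Rightarrow> 'a \<Rightarrow> 'a"
  where "even_part \<tau> x = (1/2) *\<^sub>C (x + \<tau> x)"

definition odd_part :: "('a::complex_vector \<Rightarrow> 'a) \<Rightarrow> 'a \<Rightarrow> 'a"
  where "odd_part \<tau> x = (1/2) *\<^sub>C (x - \<tau> x)"

lemma half_double: "(1/2) *\<^sub>C (x + x) = (x :: 'a::complex_vector)"
proof -
  have "(1/2) *\<^sub>C (x + x) = (1/2 + 1/2 :: complex) *\<^sub>C x"
    by (simp only: scaleC_right_distrib scaleC_left_distrib)
  then show ?thesis by (simp add: scaleC_one)
qed

lemma even_part_eqI: "\<tau> x = x \<Longrightarrow> even_part \<tau> x = x"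
  by (simp add: even_part_def half_double)

lemma even_part_zeroI: "\<tau> x = - x \<Longrightarrow> even_part \<tau> x = 0"
  by (simp add: even_part_def)

lemma odd_part_eqI: "\<tau> x = - x \<Longrightarrow> odd_part \<tau> x = x"
  by (simp add: odd_part_def half_double)

lemma odd_part_zeroI: "\<tau> x = x \<Longrightarrow> odd_part \<tau> x = 0"
  by (simp add: odd_part_def)

lemma even_plus_odd: "even_part \<tau> x + odd_part \<tau> x = x"
proof -
  have "even_part \<tau> x + odd_part \<tau> x = (1/2) *\<^sub>C (x + x)"
    by (simp only: even_part_def odd_part_def scaleC_right_distrib[symmetric]) simp
  then show ?thesis by (simp add: half_double)
qed

lemma clinear_even_part: "clinear \<tau> \<Longrightarrow> clinear (even_part \<tau>)"
  unfolding even_part_def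
  by (simp add: clinear_iff scaleC_right_distrib scaleC_scaleC mult.commute)

lemma clinear_odd_part: "clinear \<tau> \<Longrightarrow> clinear (odd_part \<tau>)"
  unfolding odd_part_def
  by (simp add: clinear_iff scaleC_right_distrib scaleC_scaleC mult.commute
      complex_vector.scale_right_diff_distrib)

context superalgebra
begin

lemma \<tau>_even_part: "\<tau> (even_part \<tau> x) = even_part \<tau> x"
  by (simp add: even_part_def clinear_simps[OF linear_\<tau>] \<tau>_\<tau> add.commute)

lemma \<tau>_odd_part: "\<tau> (odd_part \<tau> x) = - odd_part \<tau> x"
  by (simp add: odd_part_def clinear_simps[OF linear_\<tau>] \<tau>_\<tau>
      complex_vector.scale_minus_right[symmetric] del: complex_vector.scale_minus_right)

lemma parts_\<tau>:
  "even_part \<tau> (\<tau> x) = even_part \<tau> x" "odd_part \<tau> (\<tau> x) = - odd_part \<tau> x"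
  by (simp_all add: even_part_def odd_part_def \<tau>_\<tau> add.commute
      complex_vector.scale_minus_right[symmetric] del: complex_vector.scale_minus_right)

text \<open>Since \<open>\<tau>\<close> fixes the right factor, multiplying by it commutes with both
  projections. An odd right factor, treated next, interchanges them.\<close>

lemma parts_mult_even:
  "even_part \<tau> (mult x (even_part \<tau> y)) = mult (even_part \<tau> x) (even_part \<tau> y)"
  "odd_part \<tau> (mult x (even_part \<tau> y)) = mult (odd_part \<tau> x) (even_part \<tau> y)"
  by (simp_all add: even_part_def[of _ "mult _ _"] odd_part_def[of _ "mult _ _"]
      even_part_def[of _ x] odd_part_def[of _ x] \<tau>_mult \<tau>_even_part
      cbilinear_simps[OF cbilinear_mult])

lemma parts_mult_odd:
  "even_part \<tau> (mult x (odd_part \<tau> y)) = mult (odd_part \<tau> x) (odd_part \<tau> y)"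
  "odd_part \<tau> (mult x (odd_part \<tau> y)) = mult (even_part \<tau> x) (odd_part \<tau> y)"
  by (simp_all add: even_part_def[of _ "mult _ _"] odd_part_def[of _ "mult _ _"]
      even_part_def[of _ x] odd_part_def[of _ x] \<tau>_mult \<tau>_odd_part
      cbilinear_simps[OF cbilinear_mult])

lemma parts_parts:
  "even_part \<tau> (even_part \<tau> x) = even_part \<tau> x" "even_part \<tau> (odd_part \<tau> x) = 0"
  "odd_part \<tau> (even_part \<tau> x) = 0" "odd_part \<tau> (odd_part \<tau> x) = odd_part \<tau> x"
  by (simp_all add: even_part_eqI even_part_zeroI odd_part_eqI odd_part_zeroI
      \<tau>_even_part \<tau>_odd_part)

end

text \<open>\<open>(a \<otimes> b)(c \<otimes> d) = ac\<^sub>0 \<otimes> bd + ac\<^sub>1 \<otimes> \<tau>(b)d\<close>\<close>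

definition super_tensor_mult ::
  "('a::complex_vector \<Rightarrow> 'a \<Rightarrow> 'a) \<Rightarrow> ('a \<Rightarrow> 'a) \<Rightarrow> ('b::complex_vector \<Rightarrow> 'b \<Rightarrow> 'b) \<Rightarrow> ('b \<Rightarrow> 'b) \<Rightarrow>
    ('a, 'b) tensor \<Rightarrow> ('a, 'b) tensor \<Rightarrow> ('a, 'b) tensor"
  where "super_tensor_mult m \<tau> m' \<tau>' s t =
    tensor_act (\<lambda>a c. m a (even_part \<tau> c)) m' s t +
    tensor_act (\<lambda>a c. m a (odd_part \<tau> c)) (\<lambda>b d. m' (\<tau>' b) d) s t"

section \<open>The graded tensor product of two superalgebras\<close>

lemma cbilinear_compose_left: "cbilinear B \<Longrightarrow> clinear g \<Longrightarrow> cbilinear (\<lambda>x y. B (g x) y)"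
  by (simp add: cbilinear_iff clinear_iff)

lemma cbilinear_compose_right: "cbilinear B \<Longrightarrow> clinear g \<Longrightarrow> cbilinear (\<lambda>x y. B x (g y))"
  by (simp add: cbilinear_iff clinear_iff)

locale superalgebra_pair = A: superalgebra m one \<tau> + B: superalgebra m' one' \<tau>'
  for m :: "'a::complex_vector \<Rightarrow> 'a \<Rightarrow> 'a" and one \<tau>
    and m' :: "'b::complex_vector \<Rightarrow> 'b \<Rightarrow> 'b" and one' \<tau>'
begin

abbreviation tm where "tm \<equiv> super_tensor_mult m \<tau> m' \<tau>'"

lemma tensor_mult_aux:
  "cbilinear (\<lambda>a c. m a (even_part \<tau> c))" "cbilinear (\<lambda>a c. m a (odd_part \<tau> c))"
  "cbilinear (\<lambda>b d. m' (\<tau>' b) d)"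
  by (rule cbilinear_compose_right[OF A.cbilinear_mult] cbilinear_compose_left[OF B.cbilinear_mult],
      intro clinear_even_part clinear_odd_part A.linear_\<tau> B.linear_\<tau>)+

lemma tensor_mult_pure:
  "tm (a \<otimes> b) (c \<otimes> d) = m a (even_part \<tau> c) \<otimes> m' b d + m a (odd_part \<tau> c) \<otimes> m' (\<tau>' b) d"
  unfolding super_tensor_mult_def
  by (simp only: tensor_act_pure tensor_mult_aux B.cbilinear_mult)

lemma cbilinear_tensor_mult: "cbilinear tm"
proof -
  have "cbilinear (\<lambda>s t. B s t + B' s t)" if "cbilinear B" "cbilinear B'"
    for B B' :: "('a, 'b) tensor \<Rightarrow> ('a, 'b) tensor \<Rightarrow> ('a, 'b) tensor"
    by (simp add: cbilinear_iff cbilinear_simps[OF that(1)] cbilinear_simps[OF that(2)]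
        scaleC_right_distrib)
  then show ?thesis
    unfolding super_tensor_mult_def[abs_def]
    by (blast intro: cbilinear_tensor_act tensor_mult_aux B.cbilinear_mult)
qed

text \<open>With the next two rules this covers every product whose inner factors \<open>b\<close>
  and \<open>c\<close> are homogeneous, so products of generator images never have to be split into
  parts.\<close>

lemma tensor_mult_pure_even_left: "\<tau>' b = b \<Longrightarrow> tm (a \<otimes> b) (c \<otimes> d) = m a c \<otimes> m' b d"
  by (simp add: tensor_mult_pure tensor_pure_simps(1)[symmetric]
      cbilinear_simps(2)[OF A.cbilinear_mult, symmetric] even_plus_odd)

lemma tensor_mult_pure_even_right: "\<tau> c = c \<Longrightarrow> tm (a \<otimes> b) (c \<otimes> d) = m a c \<otimes> m' b d"
  by (simp add: tensor_mult_pure even_part_eqI odd_part_zeroI tensor_pure_simps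
      cbilinear_simps[OF A.cbilinear_mult])

lemma tensor_mult_pure_odd:
  "\<tau>' b = - b \<Longrightarrow> \<tau> c = - c \<Longrightarrow> tm (a \<otimes> b) (c \<otimes> d) = - (m a c \<otimes> m' b d)"
  by (simp add: tensor_mult_pure even_part_zeroI odd_part_eqI tensor_pure_simps
      cbilinear_simps[OF A.cbilinear_mult] cbilinear_simps[OF B.cbilinear_mult])

lemma tensor_mult_assoc: "tm (tm s t) u = tm s (tm t u)"
proof -
  note bil = cbilinear_simps[OF cbilinear_tensor_mult]
  \<comment> \<open>Both sides consist of four terms indexed by the parities of \<open>c\<close> and
    \<open>e\<close>. On the right the parts of a product are reduced to parts of \<open>c\<close>;
    on the left \<open>\<tau>'\<close> is distributed and cancels against itself when both are
    odd.\<close>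
  have pure: "tm (tm (a \<otimes> b) (c \<otimes> d)) (e \<otimes> f) = tm (a \<otimes> b) (tm (c \<otimes> d) (e \<otimes> f))"
    for a c e :: 'a and b d f :: 'b
    by (simp add: tensor_mult_pure bil B.\<tau>_mult B.\<tau>_\<tau> A.parts_mult_even A.parts_mult_odd
        A.mult_assoc B.mult_assoc add_ac)
  have "tm (tm (a \<otimes> b) (c \<otimes> d)) u = tm (a \<otimes> b) (tm (c \<otimes> d) u)" for a c :: 'a and b d :: 'b
    by (rule tensor_clinear_eqI[where s = u and g = "\<lambda>u. tm (tm (a \<otimes> b) (c \<otimes> d)) u"
          and h = "\<lambda>u. tm (a \<otimes> b) (tm (c \<otimes> d) u)"]) (simp_all only: pure clinear_iff bil simp_thms)
  then have "tm (tm s (c \<otimes> d)) u = tm s (tm (c \<otimes> d) u)" for c :: 'a and d :: 'b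
    by (intro tensor_clinear_eqI[where s = s and g = "\<lambda>s. tm (tm s (c \<otimes> d)) u"
          and h = "\<lambda>s. tm s (tm (c \<otimes> d) u)"]) (simp_all only: clinear_iff bil simp_thms)
  then show ?thesis
    by (intro tensor_clinear_eqI[where s = t and g = "\<lambda>t. tm (tm s t) u"
          and h = "\<lambda>t. tm s (tm t u)"]) (simp_all only: clinear_iff bil simp_thms)
qed

text \<open>Makes the graded tensor square an admissible target of the universal property, and
  allows the construction to be iterated for coassociativity.\<close>

lemma tensor_superalgebra: "superalgebra tm (one \<otimes> one') (tensor_map \<tau> \<tau>')"
proof (rule superalgebra.intro)
  note bil = cbilinear_simps[OF cbilinear_tensor_mult]
  note lin = clinear_simps[OF clinear_tensor_map[OF A.linear_\<tau> B.linear_\<tau>]]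
  note mp = tensor_map_pure[OF A.linear_\<tau> B.linear_\<tau>]
  show "cbilinear tm" by (rule cbilinear_tensor_mult)
  show "tm (tm x y) z = tm x (tm y z)" for x y z by (rule tensor_mult_assoc)
  show "tm (one \<otimes> one') x = x" for x
    by (rule tensor_clinear_eqI[where s = x and g = "tm (one \<otimes> one')" and h = "\<lambda>x. x"])
      (simp_all add: clinear_iff bil tensor_mult_pure_even_left B.\<tau>_one A.mult_one_left
        B.mult_one_left)
  show "tm x (one \<otimes> one') = x" for x
    by (rule tensor_clinear_eqI[where s = x and g = "\<lambda>x. tm x (one \<otimes> one')" and h = "\<lambda>x. x"])
      (simp_all add: clinear_iff bil tensor_mult_pure_even_right A.\<tau>_one A.mult_one_right
        B.mult_one_right)
  show "clinear (tensor_map \<tau> \<tau>')" by (rule clinear_tensor_map[OF A.linear_\<tau> B.linear_\<tau>])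
  show "tensor_map \<tau> \<tau>' (tensor_map \<tau> \<tau>' x) = x" for x
    by (rule tensor_clinear_eqI[where s = x and g = "\<lambda>x. tensor_map \<tau> \<tau>' (tensor_map \<tau> \<tau>' x)" and h = "\<lambda>x. x"])
      (simp_all add: clinear_iff lin mp A.\<tau>_\<tau> B.\<tau>_\<tau>)
  show "tensor_map \<tau> \<tau>' (tm x y) = tm (tensor_map \<tau> \<tau>' x) (tensor_map \<tau> \<tau>' y)" for x y
    by (rule cbilinear_tensor_eqI[where s = x and t = y and B = "\<lambda>x y. tensor_map \<tau> \<tau>' (tm x y)"
          and B' = "\<lambda>x y. tm (tensor_map \<tau> \<tau>' x) (tensor_map \<tau> \<tau>' y)"])
      (simp_all add: cbilinear_iff bil lin mp A.\<tau>_mult B.\<tau>_mult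
        tensor_mult_pure A.\<tau>_even_part A.\<tau>_odd_part A.parts_\<tau>)
qed

end

section \<open>Homomorphisms and the graded tensor product\<close>

definition algebra_hom ::
  "('a::complex_vector \<Rightarrow> 'a \<Rightarrow> 'a) \<Rightarrow> 'a \<Rightarrow> ('b::complex_vector \<Rightarrow> 'b \<Rightarrow> 'b) \<Rightarrow> 'b \<Rightarrow> ('a \<Rightarrow> 'b) \<Rightarrow> bool"
  where "algebra_hom m one m' one' h \<longleftrightarrow>
    clinear h \<and> h one = one' \<and> (\<forall>x y. h (m x y) = m' (h x) (h y))"

lemma algebra_hom_compose:
  "algebra_hom m one m' one' h \<Longrightarrow> algebra_hom m' one' m'' one'' g \<Longrightarrow>
    algebra_hom m one m'' one'' (\<lambda>x. g (h x))"
  by (simp add: algebra_hom_def clinear_compose)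

lemma algebra_hom_id: "algebra_hom m one m one id"
  by (simp add: algebra_hom_def clinear_id)

lemma (in superalgebra) algebra_hom_\<tau>: "algebra_hom mult one mult one \<tau>"
  by (simp add: algebra_hom_def linear_\<tau> \<tau>_one \<tau>_mult)

lemma even_hom_parts:
  assumes "clinear h" "\<And>x. h (\<tau> x) = \<rho> (h x)"
  shows "h (even_part \<tau> x) = even_part \<rho> (h x)" "h (odd_part \<tau> x) = odd_part \<rho> (h x)"
  by (simp_all add: even_part_def odd_part_def clinear_simps[OF assms(1)] assms(2))

text \<open>\<open>algebra_hom\<close> says nothing about parity, so it is assumed separately: in a
  product of \<open>a \<otimes> b\<close> and \<open>c \<otimes> d\<close>, \<open>g\<close> must
  carry the parts of \<open>c\<close> to parts, and \<open>h\<close> must carry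
  \<open>\<tau>B b\<close> to \<open>\<tau>B' (h b)\<close>.\<close>

lemma algebra_hom_tensor_map:
  assumes "superalgebra_pair mA oneA \<tau>A mB oneB \<tau>B" "superalgebra_pair mA' oneA' \<tau>A' mB' oneB' \<tau>B'"
    and g: "algebra_hom mA oneA mA' oneA' g" "\<And>x. g (\<tau>A x) = \<tau>A' (g x)"
    and h: "algebra_hom mB oneB mB' oneB' h" "\<And>x. h (\<tau>B x) = \<tau>B' (h x)"
  shows "algebra_hom (super_tensor_mult mA \<tau>A mB \<tau>B) (oneA \<otimes> oneB)
    (super_tensor_mult mA' \<tau>A' mB' \<tau>B') (oneA' \<otimes> oneB') (tensor_map g h)"
proof -
  interpret P: superalgebra_pair mA oneA \<tau>A mB oneB \<tau>B by fact
  interpret Q: superalgebra_pair mA' oneA' \<tau>A' mB' oneB' \<tau>B' by fact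
  have l: "clinear g" "clinear h" using g h by (auto simp: algebra_hom_def)
  note lin = clinear_simps[OF clinear_tensor_map[OF l]]
  have "tensor_map g h (P.tm x y) = Q.tm (tensor_map g h x) (tensor_map g h y)" for x y
    by (rule cbilinear_tensor_eqI[where s = x and t = y and B = "\<lambda>x y. tensor_map g h (P.tm x y)"
          and B' = "\<lambda>x y. Q.tm (tensor_map g h x) (tensor_map g h y)"])
      (use g h in \<open>simp_all add: cbilinear_iff cbilinear_simps[OF P.cbilinear_tensor_mult]
        cbilinear_simps[OF Q.cbilinear_tensor_mult] lin tensor_map_pure[OF l] P.tensor_mult_pure
        Q.tensor_mult_pure algebra_hom_def even_hom_parts[where h = g and \<tau> = \<tau>A and \<rho> = \<tau>A', OF l(1) g(2)]\<close>)
  then show ?thesis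
    using g h by (simp add: algebra_hom_def clinear_tensor_map tensor_map_pure l)
qed

lemma algebra_hom_tensor_assoc:
  assumes "superalgebra mA oneA \<tau>A" "superalgebra mB oneB \<tau>B" "superalgebra mC oneC \<tau>C"
  shows "algebra_hom
    (super_tensor_mult (super_tensor_mult mA \<tau>A mB \<tau>B) (tensor_map \<tau>A \<tau>B) mC \<tau>C)
    ((oneA \<otimes> oneB) \<otimes> oneC)
    (super_tensor_mult mA \<tau>A (super_tensor_mult mB \<tau>B mC \<tau>C) (tensor_map \<tau>B \<tau>C))
    (oneA \<otimes> (oneB \<otimes> oneC)) tensor_assoc"
proof -
  interpret A: superalgebra mA oneA \<tau>A by fact
  interpret B: superalgebra mB oneB \<tau>B by fact
  interpret C: superalgebra mC oneC \<tau>C by fact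
  interpret AB: superalgebra_pair mA oneA \<tau>A mB oneB \<tau>B ..
  interpret BC: superalgebra_pair mB oneB \<tau>B mC oneC \<tau>C ..
  interpret tAB: superalgebra AB.tm "oneA \<otimes> oneB" "tensor_map \<tau>A \<tau>B"
    by (rule AB.tensor_superalgebra)
  interpret tBC: superalgebra BC.tm "oneB \<otimes> oneC" "tensor_map \<tau>B \<tau>C"
    by (rule BC.tensor_superalgebra)
  interpret L: superalgebra_pair AB.tm "oneA \<otimes> oneB" "tensor_map \<tau>A \<tau>B" mC oneC \<tau>C ..
  interpret R: superalgebra_pair mA oneA \<tau>A BC.tm "oneB \<otimes> oneC" "tensor_map \<tau>B \<tau>C" ..
  note lin = clinear_simps[OF clinear_tensor_assoc]
    and bil = cbilinear_simps[OF L.cbilinear_tensor_mult] cbilinear_simps[OF R.cbilinear_tensor_mult]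
  \<comment> \<open>In the left bracketing the sign moves the third factor past a whole tensor
    \<open>a' \<otimes> b'\<close>; splitting that tensor into parts of its factors makes the sign
    comparable with the right bracketing.\<close>
  have parts: "even_part (tensor_map \<tau>A \<tau>B) (a \<otimes> b) =
      even_part \<tau>A a \<otimes> even_part \<tau>B b + odd_part \<tau>A a \<otimes> odd_part \<tau>B b"
    "odd_part (tensor_map \<tau>A \<tau>B) (a \<otimes> b) =
      even_part \<tau>A a \<otimes> odd_part \<tau>B b + odd_part \<tau>A a \<otimes> even_part \<tau>B b" for a b
  proof -
    let ?a0 = "even_part \<tau>A a" and ?a1 = "odd_part \<tau>A a"
    let ?b0 = "even_part \<tau>B b" and ?b1 = "odd_part \<tau>B b"
    have t: "\<tau>A ?a0 = ?a0" "\<tau>A ?a1 = - ?a1" "\<tau>B ?b0 = ?b0" "\<tau>B ?b1 = - ?b1"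
      by (rule A.\<tau>_even_part A.\<tau>_odd_part B.\<tau>_even_part B.\<tau>_odd_part)+
    have ab: "a \<otimes> b = (?a0 + ?a1) \<otimes> (?b0 + ?b1)"
      by (simp add: even_plus_odd)
    note l = clinear_simps[OF clinear_even_part[OF tAB.linear_\<tau>]]
      clinear_simps[OF clinear_odd_part[OF tAB.linear_\<tau>]]
    have tm: "tensor_map \<tau>A \<tau>B (u \<otimes> v) = \<tau>A u \<otimes> \<tau>B v" for u v
      by (rule tensor_map_pure[OF A.linear_\<tau> B.linear_\<tau>])
    have e: "even_part (tensor_map \<tau>A \<tau>B) (?a0 \<otimes> ?b0) = ?a0 \<otimes> ?b0"
      "even_part (tensor_map \<tau>A \<tau>B) (?a1 \<otimes> ?b1) = ?a1 \<otimes> ?b1"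
      "even_part (tensor_map \<tau>A \<tau>B) (?a0 \<otimes> ?b1) = 0"
      "even_part (tensor_map \<tau>A \<tau>B) (?a1 \<otimes> ?b0) = 0"
      "odd_part (tensor_map \<tau>A \<tau>B) (?a0 \<otimes> ?b0) = 0"
      "odd_part (tensor_map \<tau>A \<tau>B) (?a1 \<otimes> ?b1) = 0"
      "odd_part (tensor_map \<tau>A \<tau>B) (?a0 \<otimes> ?b1) = ?a0 \<otimes> ?b1"
      "odd_part (tensor_map \<tau>A \<tau>B) (?a1 \<otimes> ?b0) = ?a1 \<otimes> ?b0"
      by (rule even_part_eqI even_part_zeroI odd_part_eqI odd_part_zeroI,
          simp only: tm t tensor_pure_simps minus_minus)+
    show "even_part (tensor_map \<tau>A \<tau>B) (a \<otimes> b) = ?a0 \<otimes> ?b0 + ?a1 \<otimes> ?b1"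
      unfolding ab by (simp only: tensor_pure_simps l e) simp
    show "odd_part (tensor_map \<tau>A \<tau>B) (a \<otimes> b) = ?a0 \<otimes> ?b1 + ?a1 \<otimes> ?b0"
      unfolding ab by (simp only: tensor_pure_simps l e) simp
  qed
  have pure: "tensor_assoc (L.tm ((a \<otimes> b) \<otimes> c) ((a' \<otimes> b') \<otimes> c')) =
      R.tm (tensor_assoc ((a \<otimes> b) \<otimes> c)) (tensor_assoc ((a' \<otimes> b') \<otimes> c'))" for a a' b b' c c'
    by (simp add: L.tensor_mult_pure R.tensor_mult_pure AB.tensor_mult_pure BC.tensor_mult_pure
        parts cbilinear_simps[OF AB.cbilinear_tensor_mult] A.parts_parts
        tensor_assoc_pure lin tensor_pure_simps tensor_map_pure B.linear_\<tau> C.linear_\<tau> C.\<tau>_\<tau>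
        cbilinear_simps[OF A.cbilinear_mult] add_ac)
  have "tensor_assoc (L.tm ((a \<otimes> b) \<otimes> c) y) = R.tm (tensor_assoc ((a \<otimes> b) \<otimes> c)) (tensor_assoc y)"
    for a b c y
    by (rule tensor_clinear_eqI3_left[where s = y and g = "\<lambda>y. tensor_assoc (L.tm ((a \<otimes> b) \<otimes> c) y)"
          and h = "\<lambda>y. R.tm (tensor_assoc ((a \<otimes> b) \<otimes> c)) (tensor_assoc y)"])
      (simp_all only: clinear_iff lin bil pure simp_thms)
  then have "tensor_assoc (L.tm x y) = R.tm (tensor_assoc x) (tensor_assoc y)" for x y
    by (intro tensor_clinear_eqI3_left[where s = x and g = "\<lambda>x. tensor_assoc (L.tm x y)"
          and h = "\<lambda>x. R.tm (tensor_assoc x) (tensor_assoc y)"])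
      (simp_all only: clinear_iff lin bil simp_thms)
  then show ?thesis
    by (simp add: algebra_hom_def clinear_tensor_assoc tensor_assoc_pure)
qed

section \<open>Free algebras and presentations\<close>

text \<open>Scalars become constants of the free algebra, so bilinearity of its product reduces to
  associativity and to constants being central.\<close>

lemma scaleC_eq_single_mult: "c *\<^sub>C p = Poly_Mapping.single 0 c * (p :: 'g free_algebra)"
  unfolding mult_map_scale_conv_mult[symmetric]
  by (rule poly_mapping_eqI) (simp add: scaleC_poly_mapping.rep_eq scaleC_complex_def map.rep_eq when_def)

lemma single_scaleC: "c *\<^sub>C Poly_Mapping.single k 1 = Poly_Mapping.single k (c :: complex)"
  by (rule poly_mapping_eqI)
    (simp add: scaleC_poly_mapping.rep_eq lookup_single when_def scaleC_complex_def)

lemma single_zero_central: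
  "Poly_Mapping.single 0 c * p = p * Poly_Mapping.single 0 (c :: complex)"
  for p :: "'g free_algebra"
  by (subst (1 2) poly_mapping_decompose)
    (simp add: single_scaleC sum_distrib_left sum_distrib_right mult_single mult.commute)

lemma cbilinear_free_mult: "cbilinear ((*) :: 'g free_algebra \<Rightarrow> _)"
  unfolding cbilinear_iff
proof (intro conjI allI)
  fix c and p q :: "'g free_algebra"
  show "c *\<^sub>C p * q = c *\<^sub>C (p * q)"
    by (simp add: scaleC_eq_single_mult mult.assoc)
  show "p * c *\<^sub>C q = c *\<^sub>C (p * q)"
    unfolding scaleC_eq_single_mult single_zero_central[of c q] single_zero_central[of c "p * q"]
    by (simp add: mult.assoc)
qed (simp_all add: algebra_simps)

section \<open>Homogeneous elements of the free algebra\<close>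

lemma lookup_scaleC: "Poly_Mapping.lookup (c *\<^sub>C p) k = c * Poly_Mapping.lookup p k"
  by (simp add: scaleC_poly_mapping.rep_eq scaleC_complex_def)

text \<open>For the zero degree function this is \<open>free_on\<close>, so each closure property is
  proved once and serves both sets.\<close>

definition free_degree :: "'g set \<Rightarrow> ('g \<Rightarrow> bit) \<Rightarrow> bit \<Rightarrow> 'g free_algebra set"
  where "free_degree A deg p =
    {q \<in> free_on A. \<forall>w\<in>Poly_Mapping.keys q. sum_list (map deg (letters w)) = p}"

lemma free_degree_iff:
  "q \<in> free_degree A deg p \<longleftrightarrow>
    (\<forall>w\<in>Poly_Mapping.keys q. set (letters w) \<subseteq> A \<and> sum_list (map deg (letters w)) = p)"
  by (auto simp: free_degree_def free_on_def)

lemma presented_grading_eq: "presented_grading A deg \<iota> p = evaluate \<iota> ` free_degree A deg p"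
  by (simp add: presented_grading_def free_degree_def)

lemma free_degree_add: "q \<in> free_degree A deg p \<Longrightarrow> r \<in> free_degree A deg p \<Longrightarrow> q + r \<in> free_degree A deg p"
  using keys_add[of q r] by (auto simp: free_degree_iff)

lemma free_degree_diff: "q \<in> free_degree A deg p \<Longrightarrow> r \<in> free_degree A deg p \<Longrightarrow> q - r \<in> free_degree A deg p"
  using keys_diff[of q r] by (auto simp: free_degree_iff)

lemma free_degree_scaleC: "q \<in> free_degree A deg p \<Longrightarrow> c *\<^sub>C q \<in> free_degree A deg p"
  by (auto simp: free_degree_iff in_keys_iff lookup_scaleC)

lemma free_degree_sum: "(\<And>k. k \<in> K \<Longrightarrow> q k \<in> free_degree A deg p) \<Longrightarrow> sum q K \<in> free_degree A deg p"
  using keys_sum[of q K] by (auto simp: free_degree_iff) blast+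

lemma free_degree_mult:
  assumes "q \<in> free_degree A deg a" "r \<in> free_degree A deg b" "p = a + b"
  shows "q * r \<in> free_degree A deg p"
  unfolding free_degree_iff
proof
  fix w assume "w \<in> Poly_Mapping.keys (q * r)"
  then obtain u v where "u \<in> Poly_Mapping.keys q" "v \<in> Poly_Mapping.keys r" "w = u + v"
    using keys_mult[of q r] by blast
  then show "set (letters w) \<subseteq> A \<and> sum_list (map deg (letters w)) = p"
    using assms by (auto simp: free_degree_iff plus_fword_def)
qed

lemma free_degree_letter: "g \<in> A \<Longrightarrow> p = deg g \<Longrightarrow> letter g \<in> free_degree A deg p"
  by (simp add: free_degree_iff letter_def)

lemma free_degree_imp_free_on: "q \<in> free_degree A deg p \<Longrightarrow> q \<in> free_on A"
  by (simp add: free_degree_def)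

lemma free_on_eq_free_degree: "free_on A = free_degree A (\<lambda>_. 0) 0"
proof -
  have "sum_list (map (\<lambda>_. 0 :: bit) gs) = 0" for gs :: "'a list"
    by (induction gs) simp_all
  then show ?thesis by (auto simp: free_degree_def)
qed

lemmas free_on_add = free_degree_add[where deg = "\<lambda>_. 0" and p = 0, folded free_on_eq_free_degree]
  and free_on_diff = free_degree_diff[where deg = "\<lambda>_. 0" and p = 0, folded free_on_eq_free_degree]
  and free_on_scaleC = free_degree_scaleC[where deg = "\<lambda>_. 0" and p = 0, folded free_on_eq_free_degree]
  and free_on_letter = free_degree_letter[where deg = "\<lambda>_. 0" and p = 0, folded free_on_eq_free_degree]

lemma free_on_mult: "p \<in> free_on A \<Longrightarrow> q \<in> free_on A \<Longrightarrow> p * q \<in> free_on A"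
  unfolding free_on_eq_free_degree by (erule free_degree_mult) auto

lemma free_on_one: "1 \<in> free_on A"
  by (simp add: free_on_def zero_fword_def)

section \<open>Evaluation of words and the universal property of a presentation\<close>

lemma cbilinear_times: "cbilinear ((*) :: 'a::complex_algebra \<Rightarrow> _)"
  by (simp add: cbilinear_iff algebra_simps mult_scaleC_left mult_scaleC_right)

lemma superalgebra_trivial: "superalgebra ((*) :: 'a::complex_algebra \<Rightarrow> _) 1 id"
  by (rule superalgebra.intro) (simp_all add: cbilinear_times clinear_id mult.assoc)

text \<open>\<open>evaluate\<close> with the product as a parameter, as required for the graded
  tensor square. The fold ends in \<open>one\<close>, which is thus the value of the empty
  word.\<close>

definition word_eval :: "('d::complex_vector \<Rightarrow> 'd \<Rightarrow> 'd) \<Rightarrow> 'd \<Rightarrow> ('g \<Rightarrow> 'd) \<Rightarrow> 'g free_algebra \<Rightarrow> 'd"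
  where "word_eval mult one \<phi> = free_extension (\<lambda>w. foldr (\<lambda>g. mult (\<phi> g)) (letters w) one)"

lemma evaluate_eq_word_eval: "evaluate \<iota> = word_eval (*) 1 \<iota>"
proof -
  have "prod_list (map \<iota> gs) = foldr (\<lambda>g. (*) (\<iota> g)) gs 1" for gs
    by (induction gs) simp_all
  then show ?thesis by (simp add: evaluate_def word_eval_def)
qed

lemma clinear_word_eval: "clinear (word_eval mult one \<phi>)"
  unfolding word_eval_def by (rule clinear_free_extension)

lemma word_eval_single:
  "word_eval mult one \<phi> (Poly_Mapping.single w c) = c *\<^sub>C foldr (\<lambda>g. mult (\<phi> g)) (letters w) one"
  by (simp add: word_eval_def free_extension_single)

lemma word_eval_cong:
  assumes "p \<in> free_on A" "\<And>g. g \<in> A \<Longrightarrow> \<phi> g = \<psi> g"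
  shows "word_eval mult one \<phi> p = word_eval mult one \<psi> p"
proof (rule poly_mapping_clinear_eqI[OF clinear_word_eval clinear_word_eval])
  fix w assume "w \<in> Poly_Mapping.keys p"
  then have "set (letters w) \<subseteq> A" using assms(1) by (auto simp: free_on_def)
  then have "foldr (\<lambda>g. mult (\<phi> g)) (letters w) one = foldr (\<lambda>g. mult (\<psi> g)) (letters w) one"
    using assms(2) by (intro foldr_cong) auto
  then show "word_eval mult one \<phi> (Poly_Mapping.single w 1) =
      word_eval mult one \<psi> (Poly_Mapping.single w 1)"
    by (simp add: word_eval_single)
qed

lemma algebra_hom_evaluate:
  assumes h: "algebra_hom (*) 1 mult one h"
  shows "h (evaluate \<iota> p) = word_eval mult one (\<lambda>g. h (\<iota> g)) p"
  unfolding evaluate_eq_word_eval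
proof (rule poly_mapping_clinear_eqI[OF clinear_compose[OF _ clinear_word_eval] clinear_word_eval])
  show l: "clinear h" using h by (simp add: algebra_hom_def)
  fix w
  have "h (foldr (\<lambda>g. (*) (\<iota> g)) gs 1) = foldr (\<lambda>g. mult (h (\<iota> g))) gs one" for gs
    using h by (induction gs) (simp_all add: algebra_hom_def)
  then show "h (word_eval (*) 1 \<iota> (Poly_Mapping.single w 1)) =
      word_eval mult one (\<lambda>g. h (\<iota> g)) (Poly_Mapping.single w 1)"
    by (simp add: word_eval_single scaleC_one)
qed

context superalgebra
begin

lemma word_eval_letter: "word_eval mult one \<phi> (letter g) = \<phi> g"
  by (simp add: letter_def word_eval_single scaleC_one mult_one_right)

lemma word_eval_one: "word_eval mult one \<phi> 1 = one"
  by (simp add: single_one[symmetric] word_eval_single scaleC_one zero_fword_def del: single_one)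

lemma word_eval_mult:
  "word_eval mult one \<phi> (p * q) = mult (word_eval mult one \<phi> p) (word_eval mult one \<phi> q)"
proof -
  let ?e = "word_eval mult one \<phi>"
  note lin = clinear_simps[OF clinear_word_eval[of mult one \<phi>]]
    and bil = cbilinear_simps[OF cbilinear_mult] cbilinear_simps[OF cbilinear_free_mult]
  have app: "foldr (\<lambda>g. mult (\<phi> g)) (us @ vs) one =
      mult (foldr (\<lambda>g. mult (\<phi> g)) us one) (foldr (\<lambda>g. mult (\<phi> g)) vs one)" for us vs
    by (induction us) (simp_all add: mult_one_left mult_assoc)
  have single: "?e (Poly_Mapping.single u 1 * Poly_Mapping.single v 1) =
      mult (?e (Poly_Mapping.single u 1)) (?e (Poly_Mapping.single v 1))" for u v
    by (simp add: mult_single word_eval_single scaleC_one plus_fword_def app del: foldr_append)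
  have left: "?e (Poly_Mapping.single u 1 * q) = mult (?e (Poly_Mapping.single u 1)) (?e q)" for u
    by (rule poly_mapping_clinear_eqI[where g = "\<lambda>q. ?e (Poly_Mapping.single u 1 * q)"
          and h = "\<lambda>q. mult (?e (Poly_Mapping.single u 1)) (?e q)"])
      (simp_all only: single clinear_iff lin bil simp_thms)
  show ?thesis
    by (rule poly_mapping_clinear_eqI[where g = "\<lambda>p. ?e (p * q)" and h = "\<lambda>p. mult (?e p) (?e q)"])
      (simp_all only: left clinear_iff lin bil simp_thms)
qed

lemma word_eval_generated_ideal:
  assumes "\<And>r. r \<in> R \<Longrightarrow> word_eval mult one \<phi> r = 0" "p \<in> generated_ideal A R"
  shows "word_eval mult one \<phi> p = 0"
  using assms(2) unfolding generated_ideal_def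
proof (induction rule: complex_vector.span_induct_alt)
  case base
  show ?case by (rule clinear_simps(3)[OF clinear_word_eval])
next
  case (step c x y)
  then obtain p r q where "x = p * r * q" "r \<in> R" by blast
  then have "word_eval mult one \<phi> x = 0"
    using assms(1) by (simp add: word_eval_mult cbilinear_simps[OF cbilinear_mult])
  then show ?case
    using step.IH by (simp add: clinear_simps[OF clinear_word_eval])
qed

text \<open>Evaluation at \<open>\<iota>\<close> is surjective with kernel the generated ideal on
  \<open>free_on A\<close>, and \<open>word_eval\<close> at \<open>\<phi>\<close> vanishes on that
  ideal. Hence evaluating an arbitrarily chosen representative gives a well defined
  homomorphism.\<close>

lemma presented_universal:
  assumes presented: "presented_by A R \<iota>"
    and relations: "\<And>r. r \<in> R \<Longrightarrow> word_eval mult one \<phi> r = 0"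
  shows "\<exists>h. algebra_hom (*) 1 mult one h \<and> (\<forall>g\<in>A. h (\<iota> g) = \<phi> g)"
proof -
  interpret C: superalgebra "(*) :: 'c::complex_algebra \<Rightarrow> _" 1 id by (rule superalgebra_trivial)
  let ?e = "word_eval mult one \<phi>" and ?ev = "word_eval (*) 1 \<iota>"
  note lin = clinear_simps[OF clinear_word_eval[of mult one \<phi>]]
    clinear_simps[OF clinear_word_eval[of "(*)" 1 \<iota>]]
  define rep where "rep x = (SOME p. p \<in> free_on A \<and> ?ev p = x)" for x
  have rep: "rep x \<in> free_on A" "?ev (rep x) = x" for x
  proof -
    have "\<exists>p. p \<in> free_on A \<and> ?ev p = x"
      using presented unfolding presented_by_def evaluate_eq_word_eval by (metis UNIV_I imageE)
    then have "rep x \<in> free_on A \<and> ?ev (rep x) = x" unfolding rep_def by (rule someI_ex)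
    then show "rep x \<in> free_on A" "?ev (rep x) = x" by auto
  qed
  have well_defined: "?e p = ?e q" if "p \<in> free_on A" "q \<in> free_on A" "?ev p = ?ev q" for p q
  proof -
    have "p - q \<in> generated_ideal A R"
      using presented that free_on_diff[of p A q]
      by (auto simp: presented_by_def evaluate_eq_word_eval lin)
    then have "?e (p - q) = 0" by (rule word_eval_generated_ideal[rotated]) (rule relations)
    then show ?thesis by (simp add: lin)
  qed
  have h: "?e (rep (?ev p)) = ?e p" if "p \<in> free_on A" for p
    by (rule well_defined) (simp_all add: rep that)
  have "algebra_hom (*) 1 mult one (\<lambda>x. ?e (rep x))"
    unfolding algebra_hom_def clinear_iff
  proof (intro conjI allI)
    fix x y c
    show "?e (rep (x + y)) = ?e (rep x) + ?e (rep y)"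
      using h[OF free_on_add[OF rep(1)[of x] rep(1)[of y]]] by (simp add: lin rep)
    show "?e (rep (c *\<^sub>C x)) = c *\<^sub>C ?e (rep x)"
      using h[OF free_on_scaleC[OF rep(1)[of x]], of c] by (simp add: lin rep)
    show "?e (rep 1) = one"
      using h[OF free_on_one] by (simp add: C.word_eval_one word_eval_one)
    show "?e (rep (x * y)) = mult (?e (rep x)) (?e (rep y))"
      using h[OF free_on_mult[OF rep(1)[of x] rep(1)[of y]]]
      by (simp add: C.word_eval_mult word_eval_mult rep)
  qed
  moreover have "?e (rep (\<iota> g)) = \<phi> g" if "g \<in> A" for g
    using h[OF free_on_letter[OF that]] by (simp add: C.word_eval_letter word_eval_letter)
  ultimately show ?thesis by blast
qed

end

lemma presented_relation:
  assumes "presented_by A R \<iota>" "r \<in> R" "r \<in> free_on A"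
  shows "evaluate \<iota> r = 0"
proof -
  have "1 * r * 1 \<in> generated_ideal A R"
    unfolding generated_ideal_def by (rule complex_vector.span_base) (use assms(2) free_on_one in blast)
  then show ?thesis using assms by (simp add: presented_by_def)
qed

lemma presented_hom_eqI:
  assumes "presented_by A R \<iota>" "algebra_hom (*) 1 mult one h" "algebra_hom (*) 1 mult one h'"
    and "\<And>g. g \<in> A \<Longrightarrow> h (\<iota> g) = h' (\<iota> g)"
  shows "h = h'"
proof
  fix x
  obtain p where p: "p \<in> free_on A" "x = evaluate \<iota> p"
    using assms(1) unfolding presented_by_def by (metis UNIV_I imageE)
  then show "h x = h' x"
    using word_eval_cong[OF p(1) assms(4)] by (simp add: algebra_hom_evaluate[OF assms(2)]
        algebra_hom_evaluate[OF assms(3)])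
qed

section \<open>The parity involution\<close>

definition parity_sign :: "bit \<Rightarrow> complex"
  where "parity_sign p = (if p = 0 then 1 else -1)"

lemma parity_sign_simps: "parity_sign 0 = 1" "parity_sign 1 = -1"
  by (simp_all add: parity_sign_def)

lemma parity_sign_add: "parity_sign (p + q) = parity_sign p * parity_sign q"
  by (cases p; cases q) (simp_all add: parity_sign_def)

text \<open>The signs of the letters are scalars, so they collect in front of the word as the sign
  of the total degree.\<close>

lemma word_eval_parity:
  assumes "q \<in> free_degree A deg p"
  shows "word_eval (*) 1 (\<lambda>g. parity_sign (deg g) *\<^sub>C \<iota> g) q = parity_sign p *\<^sub>C evaluate \<iota> q"
  unfolding evaluate_eq_word_eval
proof (rule poly_mapping_clinear_eqI[OF clinear_word_eval clinear_scaleC[OF clinear_word_eval]])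
  fix w assume "w \<in> Poly_Mapping.keys q"
  then have p: "p = sum_list (map deg (letters w))" using assms by (auto simp: free_degree_iff)
  have "foldr (\<lambda>g. (*) (parity_sign (deg g) *\<^sub>C \<iota> g)) gs 1 =
      parity_sign (sum_list (map deg gs)) *\<^sub>C foldr (\<lambda>g. (*) (\<iota> g)) gs 1" for gs
    by (induction gs) (simp add: parity_sign_simps scaleC_one,
        simp only: list.map sum_list.Cons parity_sign_add,
        simp add: mult_scaleC_left mult_scaleC_right scaleC_scaleC mult.commute)
  then show "word_eval (*) 1 (\<lambda>g. parity_sign (deg g) *\<^sub>C \<iota> g) (Poly_Mapping.single w 1) =
      parity_sign p *\<^sub>C word_eval (*) 1 \<iota> (Poly_Mapping.single w 1)"
    by (simp add: word_eval_single scaleC_one p)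
qed

lemma free_on_split_degree:
  assumes "q \<in> free_on A"
  obtains q0 q1 where "q0 \<in> free_degree A deg 0" "q1 \<in> free_degree A deg 1" "q = q0 + q1"
proof -
  let ?d = "\<lambda>w. sum_list (map deg (letters w))"
  define part where "part p = (\<Sum>w\<in>{w \<in> Poly_Mapping.keys q. ?d w = p}.
    Poly_Mapping.single w (Poly_Mapping.lookup q w))" for p
  have part: "part p \<in> free_degree A deg p" for p
    unfolding part_def
    by (rule free_degree_sum) (use assms in \<open>auto simp: free_degree_iff free_on_def\<close>)
  have "Poly_Mapping.keys q =
      {w \<in> Poly_Mapping.keys q. ?d w = 0} \<union> {w \<in> Poly_Mapping.keys q. ?d w = 1}"
    by (auto simp: bit_not_zero_iff)
  moreover have "{w \<in> Poly_Mapping.keys q. ?d w = 0} \<inter> {w \<in> Poly_Mapping.keys q. ?d w = 1} = {}"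
    by auto
  ultimately have "part 0 + part 1 =
      (\<Sum>w\<in>Poly_Mapping.keys q. Poly_Mapping.single w (Poly_Mapping.lookup q w))"
    unfolding part_def by (subst sum.union_disjoint[symmetric]) auto
  also have "\<dots> = q"
    using poly_mapping_decompose[of q] by (simp add: single_scaleC)
  finally show ?thesis using that[OF part part] by simp
qed

text \<open>The pieces of the grading are eigenspaces of \<open>\<tau>\<close>, so homogeneity
  becomes an equation that simplification can use.\<close>

locale parity_grading = superalgebra "(*) :: 'c::complex_algebra \<Rightarrow> _" 1 \<tau>
  for \<tau> :: "'c::complex_algebra \<Rightarrow> 'c" +
  fixes G :: "bit \<Rightarrow> 'c set"
  assumes mem_G_iff: "x \<in> G p \<longleftrightarrow> \<tau> x = parity_sign p *\<^sub>C x"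

lemma minus_one_scaleC: "(-1) *\<^sub>C x = - (x :: 'a::complex_vector)"
  by (simp add: complex_vector.scale_minus_left scaleC_one)

lemma eq_minus_self_imp_zero: "x = - x \<Longrightarrow> x = (0 :: 'a::complex_vector)"
  using half_double[of x] by (metis complex_vector.scale_zero_right add.right_inverse)

text \<open>Attaching signs to the generators multiplies each homogeneous relation by a sign, so the
  relations persist and the universal property yields \<open>\<tau>\<close>. Independence of the two
  pieces then follows from their eigenvalues, with no basis of the algebra at hand.\<close>

lemma presented_parity_grading:
  assumes presented: "presented_by A R \<iota>"
    and homogeneous: "\<And>r. r \<in> R \<Longrightarrow> \<exists>p. r \<in> free_degree A deg p"
  shows "\<exists>\<tau>. parity_grading \<tau> (presented_grading A deg \<iota>) \<and>
    (\<forall>g\<in>A. \<tau> (\<iota> g) = parity_sign (deg g) *\<^sub>C \<iota> g)"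
proof -
  \<comment> \<open>No grading is available yet, so the universal property is applied with the
    identity as parity involution.\<close>
  interpret triv: superalgebra "(*) :: 'c::complex_algebra \<Rightarrow> _" 1 id by (rule superalgebra_trivial)
  let ?\<phi> = "\<lambda>g. parity_sign (deg g) *\<^sub>C \<iota> g"
  have "word_eval (*) 1 ?\<phi> r = 0" if r: "r \<in> R" for r
  proof -
    obtain p where p: "r \<in> free_degree A deg p" using homogeneous r by blast
    have "evaluate \<iota> r = 0"
      by (rule presented_relation[OF presented r free_degree_imp_free_on[OF p]])
    then show ?thesis by (simp add: word_eval_parity[OF p])
  qed
  from triv.presented_universal[OF presented this]
  obtain \<tau> where \<tau>: "algebra_hom (*) 1 (*) 1 \<tau>" and gens: "\<And>g. g \<in> A \<Longrightarrow> \<tau> (\<iota> g) = ?\<phi> g"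
    by blast
  have l: "clinear \<tau>" using \<tau> by (simp add: algebra_hom_def)
  have sq: "parity_sign p * parity_sign p = 1" for p by (simp add: parity_sign_def)
  have "(\<lambda>x. \<tau> (\<tau> x)) = id"
    by (rule presented_hom_eqI[OF presented algebra_hom_compose[OF \<tau> \<tau>] algebra_hom_id])
      (simp add: gens clinear_simps[OF l] scaleC_scaleC sq scaleC_one)
  then have inv: "\<tau> (\<tau> x) = x" for x by (metis id_apply)
  interpret superalgebra "(*)" 1 \<tau>
    by (rule superalgebra.intro)
      (use \<tau> in \<open>simp_all add: cbilinear_times mult.assoc algebra_hom_def inv\<close>)
  have \<tau>_evaluate: "\<tau> (evaluate \<iota> q) = parity_sign p *\<^sub>C evaluate \<iota> q" if q: "q \<in> free_degree A deg p" for q p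
    using word_eval_cong[OF free_degree_imp_free_on[OF q] gens]
    by (simp add: algebra_hom_evaluate[OF \<tau>] word_eval_parity[OF q])
  have "x \<in> presented_grading A deg \<iota> p \<longleftrightarrow> \<tau> x = parity_sign p *\<^sub>C x" for x p
  proof
    assume "x \<in> presented_grading A deg \<iota> p"
    then show "\<tau> x = parity_sign p *\<^sub>C x"
      by (auto simp: presented_grading_eq \<tau>_evaluate)
  next
    assume x: "\<tau> x = parity_sign p *\<^sub>C x"
    obtain q where "q \<in> free_on A" "x = evaluate \<iota> q"
      using presented unfolding presented_by_def by (metis UNIV_I imageE)
    then obtain q0 q1 where q: "q0 \<in> free_degree A deg 0" "q1 \<in> free_degree A deg 1"
      and xq: "x = evaluate \<iota> q0 + evaluate \<iota> q1"
      by (metis free_on_split_degree clinear_simps(1)[OF clinear_word_eval] evaluate_eq_word_eval)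
    let ?x0 = "evaluate \<iota> q0" and ?x1 = "evaluate \<iota> q1"
    \<comment> \<open>Compared with \<open>x = ?x0 + ?x1\<close>, the eigenvalue equation makes the
      component of the wrong degree equal to its own negative.\<close>
    have \<tau>x: "\<tau> x = ?x0 - ?x1"
      by (simp add: xq clinear_simps[OF l] \<tau>_evaluate[OF q(1)] \<tau>_evaluate[OF q(2)]
          parity_sign_simps scaleC_one minus_one_scaleC)
    show "x \<in> presented_grading A deg \<iota> p"
    proof (cases "p = 0")
      case True
      then have "?x1 = - ?x1" using x \<tau>x xq by (simp add: parity_sign_simps scaleC_one)
      then have "?x1 = 0" by (rule eq_minus_self_imp_zero)
      with q xq True show ?thesis by (auto simp: presented_grading_eq)
    next
      case False
      then have p: "p = 1" by (simp add: bit_not_zero_iff)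
      then have "?x0 = - ?x0" using x \<tau>x xq by (simp add: parity_sign_simps minus_one_scaleC)
      then have "?x0 = 0" by (rule eq_minus_self_imp_zero)
      with q xq p show ?thesis by (auto simp: presented_grading_eq)
    qed
  qed
  then have "parity_grading \<tau> (presented_grading A deg \<iota>)"
    by unfold_locales blast
  then show ?thesis using gens by blast
qed

context parity_grading
begin

lemma mem_G_simps: "x \<in> G 0 \<longleftrightarrow> \<tau> x = x" "x \<in> G 1 \<longleftrightarrow> \<tau> x = - x"
  by (simp_all add: mem_G_iff parity_sign_simps scaleC_one minus_one_scaleC)

lemma decompose_unique:
  assumes "\<tau> y = y" "\<tau> z = - z"
  shows "even_part \<tau> (y + z) = y" "odd_part \<tau> (y + z) = z"
  by (simp_all add: clinear_simps[OF clinear_even_part[OF linear_\<tau>]]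
      clinear_simps[OF clinear_odd_part[OF linear_\<tau>]] even_part_eqI even_part_zeroI odd_part_eqI
      odd_part_zeroI assms)

text \<open>Uniqueness of the eigenspace decomposition resolves the definite description in
  \<open>component\<close>.\<close>

lemma component_eq: "component G 0 x = even_part \<tau> x" "component G 1 x = odd_part \<tau> x"
proof -
  have x: "x - even_part \<tau> x = odd_part \<tau> x" "x - odd_part \<tau> x = even_part \<tau> x"
    using even_plus_odd[of \<tau> x] by (simp_all add: algebra_simps)
  have "even_part \<tau> x = y" if "\<tau> y = y" "\<tau> (x - y) = - (x - y)" for y
    using decompose_unique(1)[OF that] by simp
  then show "component G 0 x = even_part \<tau> x"
    unfolding component_def
    by (intro the_equality) (auto simp: mem_G_simps x \<tau>_even_part \<tau>_odd_part)
  have "odd_part \<tau> x = y" if "\<tau> y = - y" "\<tau> (x - y) = x - y" for y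
    using decompose_unique(2)[OF that(2,1)] by simp
  then show "component G 1 x = odd_part \<tau> x"
    unfolding component_def
    by (intro the_equality) (auto simp: mem_G_simps x \<tau>_even_part \<tau>_odd_part)
qed

lemma graded_algebra_G: "graded_algebra G"
  unfolding graded_algebra_def
proof (intro conjI allI ballI)
  show "complex_vector.subspace (G p)" for p
    by (auto simp: complex_vector.subspace_def mem_G_iff clinear_simps[OF linear_\<tau>]
        scaleC_right_distrib scaleC_scaleC mult.commute)
  show "1 \<in> G 0" by (simp add: mem_G_simps \<tau>_one)
  show "x * y \<in> G (p + q)" if "x \<in> G p" "y \<in> G q" for p q x y
    using that unfolding mem_G_iff parity_sign_add
    by (simp add: \<tau>_mult mult_scaleC_left mult_scaleC_right scaleC_scaleC mult.commute)
  show "\<exists>!(y, z). y \<in> G 0 \<and> z \<in> G 1 \<and> x = y + z" for x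
  proof (rule ex1I[of _ "(even_part \<tau> x, odd_part \<tau> x)"])
    show "case (even_part \<tau> x, odd_part \<tau> x) of (y, z) \<Rightarrow> y \<in> G 0 \<and> z \<in> G 1 \<and> x = y + z"
      by (simp add: mem_G_simps \<tau>_even_part \<tau>_odd_part even_plus_odd)
  qed (auto simp: mem_G_simps decompose_unique)
qed

section \<open>Comparison with the graded tensor square defined by components\<close>

sublocale pair: superalgebra_pair "(*)" 1 \<tau> "(*)" 1 \<tau> ..

sublocale tensor: superalgebra pair.tm "1 \<otimes> 1" "tensor_map \<tau> \<tau>"
  by (rule pair.tensor_superalgebra)

text \<open>Summing over the parity of the inner left factor \<open>b\<close> collapses four terms
  to two: against the even part of \<open>c\<close> the parts of \<open>b\<close> add up to
  \<open>b\<close>, against the odd part they carry opposite signs and give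
  \<open>\<tau> b\<close>.\<close>

lemma graded_tensor_mult_eq: "graded_tensor_mult G = pair.tm"
proof (intro ext)
  fix s t :: "('c, 'c) tensor"
  have b: "cbilinear (\<lambda>a c. a * even_part \<tau> c)" "cbilinear (\<lambda>a c. a * odd_part \<tau> c)"
    "cbilinear (\<lambda>b d. even_part \<tau> b * d)" "cbilinear (\<lambda>b d. odd_part \<tau> b * d)"
    by (rule cbilinear_compose_right[OF cbilinear_mult] cbilinear_compose_left[OF cbilinear_mult],
        intro clinear_even_part clinear_odd_part linear_\<tau>)+
  note act = cbilinear_simps[OF cbilinear_tensor_act[OF b(1) b(3)]]
    cbilinear_simps[OF cbilinear_tensor_act[OF b(1) b(4)]]
    cbilinear_simps[OF cbilinear_tensor_act[OF b(2) b(3)]]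
    cbilinear_simps[OF cbilinear_tensor_act[OF b(2) b(4)]]
  have expand: "graded_tensor_mult G s t =
      tensor_act (\<lambda>a c. a * even_part \<tau> c) (\<lambda>b d. even_part \<tau> b * d) s t +
      tensor_act (\<lambda>a c. a * odd_part \<tau> c) (\<lambda>b d. even_part \<tau> b * d) s t +
      (tensor_act (\<lambda>a c. a * even_part \<tau> c) (\<lambda>b d. odd_part \<tau> b * d) s t -
      tensor_act (\<lambda>a c. a * odd_part \<tau> c) (\<lambda>b d. odd_part \<tau> b * d) s t)" for s t
    by (simp add: graded_tensor_mult_def component_eq scaleC_one minus_one_scaleC)
  have \<tau>_parts: "\<tau> b = even_part \<tau> b - odd_part \<tau> b" for b
    by (metis clinear_simps(1)[OF linear_\<tau>] even_plus_odd \<tau>_even_part \<tau>_odd_part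
        add.inverse_inverse diff_conv_add_uminus)
  have pure: "graded_tensor_mult G (a \<otimes> b) (c \<otimes> d) = pair.tm (a \<otimes> b) (c \<otimes> d)" for a b c d
  proof -
    have e: "b * d = even_part \<tau> b * d + odd_part \<tau> b * d"
      "\<tau> b * d = even_part \<tau> b * d - odd_part \<tau> b * d"
      by (simp_all add: distrib_right[symmetric] even_plus_odd left_diff_distrib[symmetric] \<tau>_parts[symmetric])
    show ?thesis
      unfolding expand pair.tensor_mult_pure tensor_act_pure[OF b(1) b(3)]
        tensor_act_pure[OF b(1) b(4)] tensor_act_pure[OF b(2) b(3)] tensor_act_pure[OF b(2) b(4)]
      by (simp only: e tensor_pure_simps) (simp add: algebra_simps)
  qed
  have "cbilinear (graded_tensor_mult G)"
    by (simp add: cbilinear_iff expand act scaleC_right_distrib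
        complex_vector.scale_right_diff_distrib algebra_simps)
  then show "graded_tensor_mult G s t = pair.tm s t"
    using pure by (rule cbilinear_tensor_eqI[OF _ pair.cbilinear_tensor_mult])
qed

text \<open>For the inclusion from right to left, apply \<open>id\<close> plus the sign times
  \<open>\<tau> \<otimes> \<tau>\<close> to any tensor. On a pure tensor the terms of the wrong
  total parity cancel, so the result lies in the graded piece.\<close>

lemma tensor_grading_eq: "tensor_grading G r = {s. tensor_map \<tau> \<tau> s = parity_sign r *\<^sub>C s}"
proof (intro equalityI subsetI CollectI)
  note lin = clinear_simps[OF tensor.linear_\<tau>]
  note mp = tensor_map_pure[OF linear_\<tau> linear_\<tau>]
  fix s
  assume "s \<in> tensor_grading G r"
  then show "tensor_map \<tau> \<tau> s = parity_sign r *\<^sub>C s"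
    unfolding tensor_grading_def
  proof (induction rule: complex_vector.span_induct_alt)
    case base
    show ?case by (simp add: lin)
  next
    case (step c x y)
    then show ?case
      by (auto simp: lin mp mem_G_iff tensor_pure_simps parity_sign_add scaleC_right_distrib
          scaleC_scaleC mult_ac parity_sign_simps scaleC_one)
  qed
next
  note lin = clinear_simps[OF tensor.linear_\<tau>]
  note mp = tensor_map_pure[OF linear_\<tau> linear_\<tau>]
  fix s
  assume "s \<in> {s. tensor_map \<tau> \<tau> s = parity_sign r *\<^sub>C s}"
  then have s: "tensor_map \<tau> \<tau> s = parity_sign r *\<^sub>C s" by simp
  let ?V = "tensor_grading G r"
  have sub: "complex_vector.subspace ?V"
    unfolding tensor_grading_def by (rule complex_vector.subspace_span)
  have base: "x \<otimes> y \<in> ?V" if "x \<in> G p" "y \<in> G q" "p + q = r" for x y p q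
    unfolding tensor_grading_def by (rule complex_vector.span_base) (use that in blast)
  have pure: "a \<otimes> b + parity_sign r *\<^sub>C (\<tau> a \<otimes> \<tau> b) \<in> ?V" for a b
  proof -
    let ?a0 = "even_part \<tau> a" and ?a1 = "odd_part \<tau> a"
    let ?b0 = "even_part \<tau> b" and ?b1 = "odd_part \<tau> b"
    have m: "?a0 \<in> G 0" "?a1 \<in> G 1" "?b0 \<in> G 0" "?b1 \<in> G 1"
      by (simp_all add: mem_G_simps \<tau>_even_part \<tau>_odd_part)
    have e: "a \<otimes> b = (?a0 + ?a1) \<otimes> (?b0 + ?b1)" "\<tau> a \<otimes> \<tau> b = (?a0 - ?a1) \<otimes> (?b0 - ?b1)"
      using clinear_simps(1)[OF linear_\<tau>, of ?a0 ?a1] clinear_simps(1)[OF linear_\<tau>, of ?b0 ?b1]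
      by (simp_all add: even_plus_odd \<tau>_even_part \<tau>_odd_part)
    show ?thesis
    proof (cases "r = 0")
      case True
      then have "a \<otimes> b + parity_sign r *\<^sub>C (\<tau> a \<otimes> \<tau> b) =
          (?a0 \<otimes> ?b0 + ?a0 \<otimes> ?b0) + (?a1 \<otimes> ?b1 + ?a1 \<otimes> ?b1)"
        unfolding e by (simp add: tensor_pure_simps parity_sign_simps scaleC_one)
      moreover have "?a0 \<otimes> ?b0 \<in> ?V" "?a1 \<otimes> ?b1 \<in> ?V"
        using True m base[of ?a0 0 ?b0 0] base[of ?a1 1 ?b1 1] by simp_all
      ultimately show ?thesis
        by (simp only: complex_vector.subspace_add[OF sub])
    next
      case False
      then have r: "r = 1" by (simp add: bit_not_zero_iff)
      then have "a \<otimes> b + parity_sign r *\<^sub>C (\<tau> a \<otimes> \<tau> b) =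
          (?a0 \<otimes> ?b1 + ?a0 \<otimes> ?b1) + (?a1 \<otimes> ?b0 + ?a1 \<otimes> ?b0)"
        unfolding e by (simp add: tensor_pure_simps parity_sign_simps minus_one_scaleC)
      moreover have "?a0 \<otimes> ?b1 \<in> ?V" "?a1 \<otimes> ?b0 \<in> ?V"
        using r m base[of ?a0 0 ?b1 1] base[of ?a1 1 ?b0 0] by simp_all
      ultimately show ?thesis
        by (simp only: complex_vector.subspace_add[OF sub])
    qed
  qed
  have "u + parity_sign r *\<^sub>C tensor_map \<tau> \<tau> u \<in> ?V" for u :: "('c, 'c) tensor"
  proof -
    have "u \<in> complex_vector.span (range (\<lambda>(a, b). a \<otimes> b))"
      by (rule tensor_in_span_pure)
    then show ?thesis
    proof (induction rule: complex_vector.span_induct_alt)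
      case base
      show ?case using complex_vector.subspace_0[OF sub] by (simp add: lin)
    next
      case (step c x y)
      then have "x + parity_sign r *\<^sub>C tensor_map \<tau> \<tau> x \<in> ?V" using pure by (auto simp: mp)
      then have "c *\<^sub>C (x + parity_sign r *\<^sub>C tensor_map \<tau> \<tau> x) +
          (y + parity_sign r *\<^sub>C tensor_map \<tau> \<tau> y) \<in> ?V"
        by (rule complex_vector.subspace_add[OF sub complex_vector.subspace_scale[OF sub] step.IH])
      then show ?case
        by (simp add: lin scaleC_right_distrib scaleC_scaleC mult.commute add_ac)
    qed
  qed
  \<comment> \<open>On an eigenvector the two summands coincide, since the sign squares to
    1.\<close>
  from this[of s] have "s + s \<in> ?V"
    by (simp add: s scaleC_scaleC parity_sign_def scaleC_one split: if_splits)
  then show "s \<in> ?V"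
    using complex_vector.subspace_scale[OF sub, of "s + s" "1/2"] by (simp only: half_double)
qed

end

section \<open>The Cartan relations under the comultiplication\<close>

text \<open>The defining relations for an arbitrary product. They are used in three algebras: the
  Cartan algebra itself, its graded tensor square for the coproduct, and the complex numbers for the
  counit.\<close>

locale cartan_family =
  fixes N :: nat
    and \<sigma> :: "nat \<Rightarrow> nat \<Rightarrow> nat \<Rightarrow> nat \<Rightarrow> complex"
    and C :: "nat \<Rightarrow> nat \<Rightarrow> nat \<Rightarrow> complex"
    and t :: "nat \<Rightarrow> nat \<Rightarrow> nat \<Rightarrow> nat \<Rightarrow> complex"
    and m :: "'d::complex_vector \<Rightarrow> 'd \<Rightarrow> 'd"
    and X :: "nat \<Rightarrow> 'd" and f :: "nat \<Rightarrow> nat \<Rightarrow> 'd" and \<xi> :: "nat \<Rightarrow> 'd" and \<delta> :: 'd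
  assumes XX: "\<And>i j. i \<in> {1..N} \<Longrightarrow> j \<in> {1..N} \<Longrightarrow> m (X i) (X j) =
      (\<Sum>k\<in>{1..N}. \<Sum>l\<in>{1..N}. \<sigma> i j k l *\<^sub>C m (X k) (X l)) + (\<Sum>k\<in>{1..N}. C i j k *\<^sub>C X k)"
    and ff: "\<And>a b p q. a \<in> {1..N} \<Longrightarrow> b \<in> {1..N} \<Longrightarrow> p \<in> {1..N} \<Longrightarrow> q \<in> {1..N} \<Longrightarrow>
      (\<Sum>i\<in>{1..N}. \<Sum>j\<in>{1..N}. \<sigma> i j a b *\<^sub>C m (f i p) (f j q)) =
      (\<Sum>i\<in>{1..N}. \<Sum>j\<in>{1..N}. \<sigma> p q i j *\<^sub>C m (f a i) (f b j))"
    and Cff: "\<And>i j k. i \<in> {1..N} \<Longrightarrow> j \<in> {1..N} \<Longrightarrow> k \<in> {1..N} \<Longrightarrow>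
      (\<Sum>a\<in>{1..N}. \<Sum>b\<in>{1..N}. C a b i *\<^sub>C m (f a j) (f b k)) + m (f i j) (X k) =
      (\<Sum>p\<in>{1..N}. \<Sum>q\<in>{1..N}. \<sigma> j k p q *\<^sub>C m (X p) (f i q)) + (\<Sum>l\<in>{1..N}. C j k l *\<^sub>C f i l)"
    and Xf: "\<And>k n l. k \<in> {1..N} \<Longrightarrow> n \<in> {1..N} \<Longrightarrow> l \<in> {1..N} \<Longrightarrow>
      m (X k) (f n l) = (\<Sum>i\<in>{1..N}. \<Sum>j\<in>{1..N}. \<sigma> k l i j *\<^sub>C m (f n i) (X j))"
    and \<xi>\<xi>: "\<And>i j. i \<in> {1..N} \<Longrightarrow> j \<in> {1..N} \<Longrightarrow>
      m (\<xi> i) (\<xi> j) + (\<Sum>k\<in>{1..N}. \<Sum>l\<in>{1..N}. t i j k l *\<^sub>C m (\<xi> k) (\<xi> l)) = 0"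
    and \<xi>\<delta>: "\<And>i. i \<in> {1..N} \<Longrightarrow> m (\<xi> i) \<delta> + m \<delta> (\<xi> i) = X i"
    and \<delta>\<delta>: "m \<delta> \<delta> = 0"
    and \<xi>f: "\<And>k l n. k \<in> {1..N} \<Longrightarrow> l \<in> {1..N} \<Longrightarrow> n \<in> {1..N} \<Longrightarrow>
      m (\<xi> k) (f n l) = (\<Sum>i\<in>{1..N}. \<Sum>j\<in>{1..N}. \<sigma> k l i j *\<^sub>C m (f n i) (\<xi> j))"
    and \<xi>X: "\<And>i j. i \<in> {1..N} \<Longrightarrow> j \<in> {1..N} \<Longrightarrow> m (\<xi> i) (X j) =
      (\<Sum>k\<in>{1..N}. \<Sum>l\<in>{1..N}. \<sigma> i j k l *\<^sub>C m (X k) (\<xi> l)) + (\<Sum>k\<in>{1..N}. C i j k *\<^sub>C \<xi> k)"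
    and f\<delta>: "\<And>i j. i \<in> {1..N} \<Longrightarrow> j \<in> {1..N} \<Longrightarrow> m (f i j) \<delta> = m \<delta> (f i j)"
    and X\<delta>: "\<And>i. i \<in> {1..N} \<Longrightarrow> m (X i) \<delta> = m \<delta> (X i)"

lemma ball_setcompr:
  "(\<forall>r\<in>{e}. Q r) \<longleftrightarrow> Q e"
  "(\<forall>r\<in>{e1 i | i. P1 i}. Q r) \<longleftrightarrow> (\<forall>i. P1 i \<longrightarrow> Q (e1 i))"
  "(\<forall>r\<in>{e2 i j | i j. P2 i j}. Q r) \<longleftrightarrow> (\<forall>i j. P2 i j \<longrightarrow> Q (e2 i j))"
  "(\<forall>r\<in>{e3 i j k | i j k. P3 i j k}. Q r) \<longleftrightarrow> (\<forall>i j k. P3 i j k \<longrightarrow> Q (e3 i j k))"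
  "(\<forall>r\<in>{e4 i j k l | i j k l. P4 i j k l}. Q r) \<longleftrightarrow> (\<forall>i j k l. P4 i j k l \<longrightarrow> Q (e4 i j k l))"
  by blast+

lemma (in superalgebra) cartan_family_iff:
  "(\<forall>r\<in>cartan_relations N \<sigma> C t. word_eval mult one \<phi> r = 0) \<longleftrightarrow>
    cartan_family N \<sigma> C t mult (\<lambda>i. \<phi> (GX i)) (\<lambda>i j. \<phi> (Gf i j)) (\<lambda>i. \<phi> (G\<xi> i)) (\<phi> G\<delta>)"
  unfolding cartan_relations_def Let_def ball_Un ball_setcompr cartan_family_def
  by (simp only: clinear_simps[OF clinear_word_eval] word_eval_mult word_eval_letter
      diff_diff_eq right_minus_eq imp_conjL conj_assoc ball_simps simp_thms)

lemma cartan_relations_homogeneous: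
  assumes "r \<in> cartan_relations N \<sigma> C t"
  shows "\<exists>p. r \<in> free_degree (cartan_gens N) cartan_parity p"
proof -
  have gens: "i \<in> {1..N} \<Longrightarrow> GX i \<in> cartan_gens N" "i \<in> {1..N} \<Longrightarrow> G\<xi> i \<in> cartan_gens N"
    "i \<in> {1..N} \<Longrightarrow> j \<in> {1..N} \<Longrightarrow> Gf i j \<in> cartan_gens N" "G\<delta> \<in> cartan_gens N" for i j
    by (auto simp: cartan_gens_def)
  define D where "D = free_degree (cartan_gens N) cartan_parity"
  have X: "i \<in> {1..N} \<Longrightarrow> letter (GX i) \<in> D 0" and \<xi>: "i \<in> {1..N} \<Longrightarrow> letter (G\<xi> i) \<in> D 1"
    and f: "i \<in> {1..N} \<Longrightarrow> j \<in> {1..N} \<Longrightarrow> letter (Gf i j) \<in> D 0" and \<delta>: "letter G\<delta> \<in> D 1" for i j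
    unfolding D_def by (rule free_degree_letter; simp add: gens)+
  have mult: "q \<in> D 0 \<Longrightarrow> r \<in> D 0 \<Longrightarrow> q * r \<in> D 0" "q \<in> D 0 \<Longrightarrow> r \<in> D 1 \<Longrightarrow> q * r \<in> D 1"
    "q \<in> D 1 \<Longrightarrow> r \<in> D 0 \<Longrightarrow> q * r \<in> D 1" "q \<in> D 1 \<Longrightarrow> r \<in> D 1 \<Longrightarrow> q * r \<in> D 0" for q r
    unfolding D_def by (erule (1) free_degree_mult, simp)+
  note products = mult(1)[OF X X] mult(1)[OF X f] mult(1)[OF f X] mult(1)[OF f f]
    mult(2)[OF X \<xi>] mult(2)[OF X \<delta>] mult(2)[OF f \<xi>] mult(2)[OF f \<delta>]
    mult(3)[OF \<xi> X] mult(3)[OF \<delta> X] mult(3)[OF \<xi> f] mult(3)[OF \<delta> f]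
    mult(4)[OF \<xi> \<xi>] mult(4)[OF \<xi> \<delta>] mult(4)[OF \<delta> \<xi>] mult(4)[OF \<delta> \<delta>]
  note closed = free_degree_add[of _ "cartan_gens N" cartan_parity, folded D_def]
    free_degree_diff[of _ "cartan_gens N" cartan_parity, folded D_def]
    free_degree_scaleC[of _ "cartan_gens N" cartan_parity, folded D_def]
    free_degree_sum[of _ _ "cartan_gens N" cartan_parity, folded D_def]
  have "\<forall>r\<in>cartan_relations N \<sigma> C t. r \<in> D 0 \<or> r \<in> D 1"
    unfolding cartan_relations_def Let_def ball_Un ball_setcompr
  proof (intro conjI allI impI; (elim conjE)?)
  qed (rule disjI1, (intro closed products X \<xi> f \<delta>; assumption) |
      rule disjI2, (intro closed products X \<xi> f \<delta>; assumption))+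
  then show ?thesis using assms unfolding D_def by blast
qed

section \<open>Moving coefficients in and across tensor factors\<close>

lemma sum3_swap:
  "(\<Sum>a\<in>A. \<Sum>b\<in>B. \<Sum>k\<in>K. h a b k) = (\<Sum>k\<in>K. \<Sum>a\<in>A. \<Sum>b\<in>B. h a b k)"
proof -
  have "(\<Sum>a\<in>A. \<Sum>b\<in>B. \<Sum>k\<in>K. h a b k) = (\<Sum>a\<in>A. \<Sum>k\<in>K. \<Sum>b\<in>B. h a b k)"
    by (intro sum.cong refl sum.swap)
  also have "\<dots> = (\<Sum>k\<in>K. \<Sum>a\<in>A. \<Sum>b\<in>B. h a b k)" by (rule sum.swap)
  finally show ?thesis .
qed

lemma sum4_swap:
  "(\<Sum>a\<in>A. \<Sum>b\<in>B. \<Sum>k\<in>K. \<Sum>l\<in>L. h a b k l) = (\<Sum>k\<in>K. \<Sum>l\<in>L. \<Sum>a\<in>A. \<Sum>b\<in>B. h a b k l)"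
  by (subst sum3_swap) (intro sum.cong refl sum3_swap)

lemma sum_scaleC_tensor:
  "(\<Sum>k\<in>K. s k *\<^sub>C (\<Sum>a\<in>A. U a \<otimes> Y a k)) = (\<Sum>a\<in>A. U a \<otimes> (\<Sum>k\<in>K. s k *\<^sub>C Y a k))"
  by (simp add: tensor_pure_simps complex_vector.scale_sum_right) (rule sum.swap)

lemma sum2_scaleC_tensor:
  "(\<Sum>k\<in>K. \<Sum>l\<in>L. s k l *\<^sub>C (\<Sum>a\<in>A. U a \<otimes> Y a k l)) =
    (\<Sum>a\<in>A. U a \<otimes> (\<Sum>k\<in>K. \<Sum>l\<in>L. s k l *\<^sub>C Y a k l))"
  by (simp add: tensor_pure_simps complex_vector.scale_sum_right) (rule sum3_swap)

lemma sum2_scaleC_tensor2: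
  "(\<Sum>k\<in>K. \<Sum>l\<in>L. s k l *\<^sub>C (\<Sum>a\<in>A. \<Sum>b\<in>B. Z a b \<otimes> Y a b k l)) =
    (\<Sum>a\<in>A. \<Sum>b\<in>B. Z a b \<otimes> (\<Sum>k\<in>K. \<Sum>l\<in>L. s k l *\<^sub>C Y a b k l))"
  by (simp add: tensor_pure_simps complex_vector.scale_sum_right) (rule sum4_swap)

lemma sum2_scaleC_tensor2_left:
  "(\<Sum>k\<in>K. \<Sum>l\<in>L. s k l *\<^sub>C (\<Sum>a\<in>A. \<Sum>b\<in>B. Z a b k l \<otimes> Y a b)) =
    (\<Sum>a\<in>A. \<Sum>b\<in>B. (\<Sum>k\<in>K. \<Sum>l\<in>L. s k l *\<^sub>C Z a b k l) \<otimes> Y a b)"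
  by (simp add: tensor_pure_simps complex_vector.scale_sum_right) (rule sum4_swap)

text \<open>A coefficient matrix acting on the left factors acts transposed on the right ones. This
  is how \<open>\<sigma>\<close> crosses the tensor sign.\<close>

lemma sum2_tensor_move2:
  "(\<Sum>a\<in>A. \<Sum>b\<in>B. (\<Sum>k\<in>K. \<Sum>l\<in>L. s a b k l *\<^sub>C Z k l) \<otimes> Y a b) =
    (\<Sum>k\<in>K. \<Sum>l\<in>L. Z k l \<otimes> (\<Sum>a\<in>A. \<Sum>b\<in>B. s a b k l *\<^sub>C Y a b))"
  by (simp add: tensor_pure_simps) (rule sum4_swap)

lemma sum2_tensor_move1:
  "(\<Sum>a\<in>A. \<Sum>b\<in>B. (\<Sum>k\<in>K. s a b k *\<^sub>C Z k) \<otimes> Y a b) =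
    (\<Sum>k\<in>K. Z k \<otimes> (\<Sum>a\<in>A. \<Sum>b\<in>B. s a b k *\<^sub>C Y a b))"
  by (simp add: tensor_pure_simps) (rule sum3_swap)

text \<open>Keeps facts of the form \<open>i \<in> {1..N}\<close> literal, so that the simplifier
  can discharge the index conditions of the relations with them.\<close>

declare One_nat_def [simp del] atLeastAtMost_iff [simp del]

text \<open>The last two assumptions encode that the tensors \<open>X\<^sub>i \<otimes> X\<^sub>j + t\<^sup>i\<^sup>j\<^sub>k\<^sub>l X\<^sub>k \<otimes> X\<^sub>l\<close> lie in the
  kernel of \<open>id - \<sigma>\<^sup>t\<close>, and that a linear map that vanishes on all of them (and hence on the kernel)
  factors through \<open>id - \<sigma>\<^sup>t\<close>; a linear map is given by its values \<open>z\<^sub>i\<^sub>j\<close> on \<open>X\<^sub>i \<otimes> X\<^sub>j\<close>.\<close>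

locale cartan_comult =
  parity_grading \<tau> G + cartan_family N \<sigma> C t "(*)" X f \<xi> \<delta>
  for \<tau> :: "'c::complex_algebra \<Rightarrow> 'c" and G N \<sigma> C t
    and X :: "nat \<Rightarrow> 'c" and f :: "nat \<Rightarrow> nat \<Rightarrow> 'c" and \<xi> :: "nat \<Rightarrow> 'c" and \<delta> :: 'c +
  assumes \<tau>_X: "\<And>i. i \<in> {1..N} \<Longrightarrow> \<tau> (X i) = X i"
    and \<tau>_f: "\<And>i j. i \<in> {1..N} \<Longrightarrow> j \<in> {1..N} \<Longrightarrow> \<tau> (f i j) = f i j"
    and \<tau>_\<xi>: "\<And>i. i \<in> {1..N} \<Longrightarrow> \<tau> (\<xi> i) = - \<xi> i"
    and \<tau>_\<delta>: "\<tau> \<delta> = - \<delta>"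
    and t_in_kernel: "\<And>(z :: nat \<Rightarrow> nat \<Rightarrow> 'c) i j. i \<in> {1..N} \<Longrightarrow> j \<in> {1..N} \<Longrightarrow>
      z i j + (\<Sum>k\<in>{1..N}. \<Sum>l\<in>{1..N}. t i j k l *\<^sub>C z k l) =
      (\<Sum>a\<in>{1..N}. \<Sum>b\<in>{1..N}. \<sigma> i j a b *\<^sub>C z a b) +
      (\<Sum>k\<in>{1..N}. \<Sum>l\<in>{1..N}. t i j k l *\<^sub>C (\<Sum>a\<in>{1..N}. \<Sum>b\<in>{1..N}. \<sigma> k l a b *\<^sub>C z a b))"
    and kernel_factor: "\<And>z :: nat \<Rightarrow> nat \<Rightarrow> 'c.
      (\<And>i j. i \<in> {1..N} \<Longrightarrow> j \<in> {1..N} \<Longrightarrow>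
        z i j + (\<Sum>k\<in>{1..N}. \<Sum>l\<in>{1..N}. t i j k l *\<^sub>C z k l) = 0) \<Longrightarrow>
      \<exists>y. \<forall>i\<in>{1..N}. \<forall>j\<in>{1..N}.
        z i j = y i j - (\<Sum>k\<in>{1..N}. \<Sum>l\<in>{1..N}. \<sigma> i j k l *\<^sub>C y k l)"
begin

text \<open>The images of \<open>X\<close> and \<open>\<xi>\<close> have the same shape, so their
  products are computed once for a generic family \<open>U\<close>.\<close>

abbreviation comult_vec :: "(nat \<Rightarrow> 'c) \<Rightarrow> nat \<Rightarrow> ('c, 'c) tensor"
  where "comult_vec U i \<equiv> 1 \<otimes> U i + (\<Sum>a\<in>{1..N}. U a \<otimes> f a i)"

abbreviation comult_f :: "nat \<Rightarrow> nat \<Rightarrow> ('c, 'c) tensor"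
  where "comult_f i j \<equiv> \<Sum>k\<in>{1..N}. f i k \<otimes> f k j"

abbreviation comult_\<delta> :: "('c, 'c) tensor"
  where "comult_\<delta> \<equiv> 1 \<otimes> \<delta> + \<delta> \<otimes> 1"

section \<open>Products of the images of the generators\<close>

lemmas tm_simps = cbilinear_simps[OF pair.cbilinear_tensor_mult]
lemmas tm_even = pair.tensor_mult_pure_even_left pair.tensor_mult_pure_even_right

text \<open>The only sign could arise from moving \<open>U i\<close> past \<open>V b\<close>, and
  \<open>V b\<close> is even. The reversed order of the factors follows as a separate lemma.\<close>

lemma tm_vec_even:
  assumes "\<And>i. i \<in> {1..N} \<Longrightarrow> \<tau> (V i) = V i" "i \<in> {1..N}" "j \<in> {1..N}"
  shows "pair.tm (comult_vec U i) (comult_vec V j) =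
    1 \<otimes> (U i * V j) + (\<Sum>b\<in>{1..N}. V b \<otimes> (U i * f b j)) + (\<Sum>a\<in>{1..N}. U a \<otimes> (f a i * V j)) +
    (\<Sum>a\<in>{1..N}. \<Sum>b\<in>{1..N}. (U a * V b) \<otimes> (f a i * f b j))"
  by (simp add: tm_simps tm_even \<tau>_one assms sum.distrib add_ac cong: sum.cong_simp) (rule sum.swap)

lemma tm_even_vec:
  assumes "\<And>i. i \<in> {1..N} \<Longrightarrow> \<tau> (V i) = V i" "i \<in> {1..N}" "j \<in> {1..N}"
  shows "pair.tm (comult_vec V i) (comult_vec U j) =
    1 \<otimes> (V i * U j) + (\<Sum>a\<in>{1..N}. U a \<otimes> (V i * f a j)) + (\<Sum>b\<in>{1..N}. V b \<otimes> (f b i * U j)) +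
    (\<Sum>b\<in>{1..N}. \<Sum>a\<in>{1..N}. (V b * U a) \<otimes> (f b i * f a j))"
  by (simp add: tm_simps tm_even \<tau>_one \<tau>_f assms sum.distrib add_ac cong: sum.cong_simp) (rule sum.swap)

lemma tm_vec_f:
  assumes "k \<in> {1..N}" "n \<in> {1..N}" "l \<in> {1..N}"
  shows "pair.tm (comult_vec U k) (comult_f n l) =
    (\<Sum>a\<in>{1..N}. f n a \<otimes> (U k * f a l)) +
    (\<Sum>b\<in>{1..N}. \<Sum>a\<in>{1..N}. (U b * f n a) \<otimes> (f b k * f a l))"
  by (simp add: tm_simps tm_even \<tau>_f assms sum.distrib cong: sum.cong_simp) (rule sum.swap)

lemma tm_f_vec:
  assumes "j \<in> {1..N}" "n \<in> {1..N}" "i \<in> {1..N}"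
  shows "pair.tm (comult_f n i) (comult_vec U j) =
    (\<Sum>a\<in>{1..N}. f n a \<otimes> (f a i * U j)) +
    (\<Sum>a\<in>{1..N}. \<Sum>b\<in>{1..N}. (f n a * U b) \<otimes> (f a i * f b j))"
  by (simp add: tm_simps tm_even \<tau>_f \<tau>_one assms sum.distrib cong: sum.cong_simp) (rule sum.swap)

lemma tm_f_f:
  assumes "i \<in> {1..N}" "p \<in> {1..N}" "j \<in> {1..N}" "q \<in> {1..N}"
  shows "pair.tm (comult_f i p) (comult_f j q) =
    (\<Sum>a\<in>{1..N}. \<Sum>b\<in>{1..N}. (f i a * f j b) \<otimes> (f a p * f b q))"
  by (simp add: tm_simps tm_even \<tau>_f assms cong: sum.cong_simp) (rule sum.swap)

text \<open>The minus sign comes from moving \<open>\<xi> i\<close> in the right factor past the odd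
  \<open>\<xi> a\<close>.\<close>

lemma tm_\<xi>_\<xi>:
  assumes "i \<in> {1..N}" "j \<in> {1..N}"
  shows "pair.tm (comult_vec \<xi> i) (comult_vec \<xi> j) =
    1 \<otimes> (\<xi> i * \<xi> j) + (\<Sum>a\<in>{1..N}. \<xi> a \<otimes> (f a i * \<xi> j - \<xi> i * f a j)) +
    (\<Sum>a\<in>{1..N}. \<Sum>b\<in>{1..N}. (\<xi> a * \<xi> b) \<otimes> (f a i * f b j))"
  by (simp add: tm_simps tm_even pair.tensor_mult_pure_odd \<tau>_f \<tau>_one \<tau>_\<xi> assms sum.distrib
      tensor_pure_simps sum_subtractf sum_negf cong: sum.cong_simp) (rule sum.swap)

text \<open>Complements \<open>sum2_tensor_move2\<close>: once \<open>\<sigma>\<close> has reached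
  the right factor, the relation \<open>ff\<close> shifts it from the first to the second indices of
  \<open>f\<close>.\<close>

lemma ff_right:
  assumes "k \<in> {1..N}" "l \<in> {1..N}" "i \<in> {1..N}" "j \<in> {1..N}"
  shows "(\<Sum>k\<in>{1..N}. \<Sum>l\<in>{1..N}. Z k l \<otimes> (\<Sum>a\<in>{1..N}. \<Sum>b\<in>{1..N}. \<sigma> a b k l *\<^sub>C (f a i * f b j))) =
    (\<Sum>k\<in>{1..N}. \<Sum>l\<in>{1..N}. Z k l \<otimes> (\<Sum>a\<in>{1..N}. \<Sum>b\<in>{1..N}. \<sigma> i j a b *\<^sub>C (f k a * f l b)))"
  by (intro sum.cong refl arg_cong[where f = "\<lambda>y. _ \<otimes> y"] ff assms)

text \<open>Both \<open>X\<^sub>i X\<^sub>j - \<sigma>\<^sup>i\<^sup>j\<^sub>k\<^sub>l X\<^sub>k X\<^sub>l = C\<^sub>i\<^sub>j\<^sup>k X\<^sub>k\<close> and \<open>\<xi>\<^sub>i X\<^sub>j - \<sigma>\<^sup>i\<^sup>j\<^sub>k\<^sub>l X\<^sub>k \<xi>\<^sub>l = C\<^sub>i\<^sub>j\<^sup>k \<xi>\<^sub>k\<close> are instances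
  of the hypothesis \<open>UX\<close>; similarly for \<open>Uf\<close>.\<close>

lemma comult_UX:
  assumes UX: "\<And>i j. i \<in> {1..N} \<Longrightarrow> j \<in> {1..N} \<Longrightarrow> U i * X j =
      (\<Sum>k\<in>{1..N}. \<Sum>l\<in>{1..N}. \<sigma> i j k l *\<^sub>C (X k * U l)) + (\<Sum>k\<in>{1..N}. C i j k *\<^sub>C U k)"
    and Uf: "\<And>k l n. k \<in> {1..N} \<Longrightarrow> l \<in> {1..N} \<Longrightarrow> n \<in> {1..N} \<Longrightarrow>
      U k * f n l = (\<Sum>i\<in>{1..N}. \<Sum>j\<in>{1..N}. \<sigma> k l i j *\<^sub>C (f n i * U j))"
    and ij: "i \<in> {1..N}" "j \<in> {1..N}"
  shows "pair.tm (comult_vec U i) (comult_vec X j) =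
    (\<Sum>k\<in>{1..N}. \<Sum>l\<in>{1..N}. \<sigma> i j k l *\<^sub>C pair.tm (comult_vec X k) (comult_vec U l)) +
    (\<Sum>k\<in>{1..N}. C i j k *\<^sub>C comult_vec U k)"
proof -
  \<comment> \<open>\<open>?R\<close> is the term to be cancelled. It occurs with a minus sign when
    \<open>Cff\<close> rewrites \<open>f a i * X j\<close> in the right factors, and with a plus
    sign as the linear part of \<open>UX\<close> applied to \<open>U a * X b\<close> in the left
    factors.\<close>
  let ?Cff = "\<lambda>k. \<Sum>a\<in>{1..N}. \<Sum>b\<in>{1..N}. C a b k *\<^sub>C (f a i * f b j)"
  let ?B1 = "1 \<otimes> (\<Sum>k\<in>{1..N}. \<Sum>l\<in>{1..N}. \<sigma> i j k l *\<^sub>C (X k * U l))"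
    and ?B2 = "\<Sum>a\<in>{1..N}. U a \<otimes> (\<Sum>k\<in>{1..N}. \<Sum>l\<in>{1..N}. \<sigma> i j k l *\<^sub>C (X k * f a l))"
    and ?B3 = "\<Sum>b\<in>{1..N}. X b \<otimes> (\<Sum>k\<in>{1..N}. \<Sum>l\<in>{1..N}. \<sigma> i j k l *\<^sub>C (f b k * U l))"
    and ?B4 = "\<Sum>b\<in>{1..N}. \<Sum>a\<in>{1..N}. (X b * U a) \<otimes>
      (\<Sum>k\<in>{1..N}. \<Sum>l\<in>{1..N}. \<sigma> i j k l *\<^sub>C (f b k * f a l))"
    and ?E1 = "1 \<otimes> (\<Sum>k\<in>{1..N}. C i j k *\<^sub>C U k)"
    and ?E2 = "\<Sum>a\<in>{1..N}. U a \<otimes> (\<Sum>k\<in>{1..N}. C i j k *\<^sub>C f a k)"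
    and ?R = "\<Sum>a\<in>{1..N}. U a \<otimes> ?Cff a"
  have B: "(\<Sum>k\<in>{1..N}. \<Sum>l\<in>{1..N}. \<sigma> i j k l *\<^sub>C pair.tm (comult_vec X k) (comult_vec U l)) =
      ?B1 + ?B2 + ?B3 + ?B4"
    unfolding sum2_scaleC_tensor2[symmetric] unfolding sum2_scaleC_tensor[symmetric]
    by (simp add: tm_even_vec \<tau>_X scaleC_right_distrib sum.distrib tensor_pure_simps
        cong: sum.cong_simp)
  have E: "(\<Sum>k\<in>{1..N}. C i j k *\<^sub>C comult_vec U k) = ?E1 + ?E2"
    unfolding sum_scaleC_tensor[symmetric]
    by (simp add: scaleC_right_distrib sum.distrib tensor_pure_simps)
  have A1: "1 \<otimes> (U i * X j) = ?B1 + ?E1"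
    by (simp only: UX[OF ij] tensor_pure_simps)
  have A2: "(\<Sum>b\<in>{1..N}. X b \<otimes> (U i * f b j)) = ?B3"
    by (intro sum.cong refl arg_cong[where f = "\<lambda>y. _ \<otimes> y"] Uf ij)
  have "U a \<otimes> (f a i * X j) = U a \<otimes> (\<Sum>k\<in>{1..N}. \<Sum>l\<in>{1..N}. \<sigma> i j k l *\<^sub>C (X k * f a l)) +
      U a \<otimes> (\<Sum>k\<in>{1..N}. C i j k *\<^sub>C f a k) - U a \<otimes> ?Cff a" if a: "a \<in> {1..N}" for a
  proof -
    have "f a i * X j = (\<Sum>k\<in>{1..N}. \<Sum>l\<in>{1..N}. \<sigma> i j k l *\<^sub>C (X k * f a l)) +
        (\<Sum>k\<in>{1..N}. C i j k *\<^sub>C f a k) - ?Cff a"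
      using Cff[OF a ij] by (simp add: algebra_simps)
    then show ?thesis by (simp only: tensor_pure_simps(2,8))
  qed
  then have A3: "(\<Sum>a\<in>{1..N}. U a \<otimes> (f a i * X j)) = ?B2 + ?E2 - ?R"
    by (simp add: sum.distrib sum_subtractf cong: sum.cong_simp)
  have "(\<Sum>a\<in>{1..N}. \<Sum>b\<in>{1..N}. (U a * X b) \<otimes> (f a i * f b j)) =
      (\<Sum>a\<in>{1..N}. \<Sum>b\<in>{1..N}. ((\<Sum>k\<in>{1..N}. \<Sum>l\<in>{1..N}. \<sigma> a b k l *\<^sub>C (X k * U l)) +
        (\<Sum>k\<in>{1..N}. C a b k *\<^sub>C U k)) \<otimes> (f a i * f b j))"
    by (intro sum.cong refl arg_cong[where f = "\<lambda>y. y \<otimes> _"] UX)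
  also have "\<dots> =
      (\<Sum>a\<in>{1..N}. \<Sum>b\<in>{1..N}. (\<Sum>k\<in>{1..N}. \<Sum>l\<in>{1..N}. \<sigma> a b k l *\<^sub>C (X k * U l)) \<otimes> (f a i * f b j)) +
      (\<Sum>a\<in>{1..N}. \<Sum>b\<in>{1..N}. (\<Sum>k\<in>{1..N}. C a b k *\<^sub>C U k) \<otimes> (f a i * f b j))"
    by (simp only: tensor_pure_simps(1) sum.distrib)
  also have "\<dots> = ?B4 + ?R"
    unfolding sum2_tensor_move2 sum2_tensor_move1 ff_right[OF ij ij] ..
  finally have A4: "(\<Sum>a\<in>{1..N}. \<Sum>b\<in>{1..N}. (U a * X b) \<otimes> (f a i * f b j)) = ?B4 + ?R" .
  show ?thesis
    unfolding tm_vec_even[where U = U and V = X, OF \<tau>_X ij, simplified] B E A1 A2 A3 A4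
    by (simp add: algebra_simps)
qed

text \<open>Terms with \<open>U\<close> on the right need \<open>Uf\<close> there. Terms with
  \<open>U\<close> on the left use \<open>Uf\<close> in the left factor, after which
  \<open>\<sigma>\<close> crosses the tensor sign and \<open>ff\<close> applies.\<close>

lemma comult_Uf:
  assumes Uf: "\<And>k l n. k \<in> {1..N} \<Longrightarrow> l \<in> {1..N} \<Longrightarrow> n \<in> {1..N} \<Longrightarrow>
      U k * f n l = (\<Sum>i\<in>{1..N}. \<Sum>j\<in>{1..N}. \<sigma> k l i j *\<^sub>C (f n i * U j))"
    and kln: "k \<in> {1..N}" "l \<in> {1..N}" "n \<in> {1..N}"
  shows "pair.tm (comult_vec U k) (comult_f n l) =
    (\<Sum>i\<in>{1..N}. \<Sum>j\<in>{1..N}. \<sigma> k l i j *\<^sub>C pair.tm (comult_f n i) (comult_vec U j))"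
proof -
  have "(\<Sum>i\<in>{1..N}. \<Sum>j\<in>{1..N}. \<sigma> k l i j *\<^sub>C pair.tm (comult_f n i) (comult_vec U j)) =
      (\<Sum>a\<in>{1..N}. f n a \<otimes> (\<Sum>i\<in>{1..N}. \<Sum>j\<in>{1..N}. \<sigma> k l i j *\<^sub>C (f a i * U j))) +
      (\<Sum>a\<in>{1..N}. \<Sum>b\<in>{1..N}. (f n a * U b) \<otimes>
        (\<Sum>i\<in>{1..N}. \<Sum>j\<in>{1..N}. \<sigma> k l i j *\<^sub>C (f a i * f b j)))"
    unfolding sum2_scaleC_tensor2[symmetric] unfolding sum2_scaleC_tensor[symmetric]
    by (simp add: tm_f_vec kln scaleC_right_distrib sum.distrib cong: sum.cong_simp)
  moreover have "(\<Sum>a\<in>{1..N}. f n a \<otimes> (U k * f a l)) =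
      (\<Sum>a\<in>{1..N}. f n a \<otimes> (\<Sum>i\<in>{1..N}. \<Sum>j\<in>{1..N}. \<sigma> k l i j *\<^sub>C (f a i * U j)))"
    by (intro sum.cong refl arg_cong[where f = "\<lambda>y. _ \<otimes> y"] Uf kln)
  moreover have "(\<Sum>b\<in>{1..N}. \<Sum>a\<in>{1..N}. (U b * f n a) \<otimes> (f b k * f a l)) =
      (\<Sum>b\<in>{1..N}. \<Sum>a\<in>{1..N}. (\<Sum>i\<in>{1..N}. \<Sum>j\<in>{1..N}. \<sigma> b a i j *\<^sub>C (f n i * U j)) \<otimes> (f b k * f a l))"
    by (intro sum.cong refl arg_cong[where f = "\<lambda>y. y \<otimes> _"] Uf kln)
  ultimately show ?thesis
    unfolding tm_vec_f[OF kln(1,3,2)] sum2_tensor_move2 ff_right[OF kln(1,2,1,2)] by simp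
qed

text \<open>\<open>\<sigma>\<close> travels through the expression: \<open>ff\<close> in the left
  factor, passage across the tensor sign, \<open>ff\<close> in the right factor.\<close>

lemma comult_ff:
  assumes "a \<in> {1..N}" "b \<in> {1..N}" "p \<in> {1..N}" "q \<in> {1..N}"
  shows "(\<Sum>i\<in>{1..N}. \<Sum>j\<in>{1..N}. \<sigma> i j a b *\<^sub>C pair.tm (comult_f i p) (comult_f j q)) =
    (\<Sum>i\<in>{1..N}. \<Sum>j\<in>{1..N}. \<sigma> p q i j *\<^sub>C pair.tm (comult_f a i) (comult_f b j))"
proof -
  have "(\<Sum>i\<in>{1..N}. \<Sum>j\<in>{1..N}. \<sigma> i j a b *\<^sub>C pair.tm (comult_f i p) (comult_f j q)) =
      (\<Sum>c\<in>{1..N}. \<Sum>d\<in>{1..N}. (\<Sum>i\<in>{1..N}. \<Sum>j\<in>{1..N}. \<sigma> i j a b *\<^sub>C (f i c * f j d)) \<otimes>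
        (f c p * f d q))"
    unfolding sum2_scaleC_tensor2_left[symmetric]
    by (simp add: tm_f_f assms cong: sum.cong_simp)
  also have "\<dots> = (\<Sum>c\<in>{1..N}. \<Sum>d\<in>{1..N}. (\<Sum>i\<in>{1..N}. \<Sum>j\<in>{1..N}. \<sigma> c d i j *\<^sub>C (f a i * f b j)) \<otimes>
        (f c p * f d q))"
    by (intro sum.cong refl arg_cong[where f = "\<lambda>y. y \<otimes> _"] ff assms)
  also have "\<dots> = (\<Sum>c\<in>{1..N}. \<Sum>d\<in>{1..N}. (f a c * f b d) \<otimes>
      (\<Sum>i\<in>{1..N}. \<Sum>j\<in>{1..N}. \<sigma> p q i j *\<^sub>C (f c i * f d j)))"
    unfolding sum2_tensor_move2 by (rule ff_right[OF assms(1,2,3,4)])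
  also have "\<dots> = (\<Sum>i\<in>{1..N}. \<Sum>j\<in>{1..N}. \<sigma> p q i j *\<^sub>C pair.tm (comult_f a i) (comult_f b j))"
    unfolding sum2_scaleC_tensor2[symmetric]
    by (simp add: tm_f_f assms cong: sum.cong_simp)
  finally show ?thesis .
qed

text \<open>The relation is used twice. In the left factors it turns \<open>?L1 + ?L3\<close> into
  \<open>?R2\<close> and a remainder \<open>?Q\<close>; together with \<open>?L2\<close>, this
  remainder is the left-hand side of the same relation in the right factors.\<close>

lemma comult_Cff:
  assumes "i \<in> {1..N}" and jk: "j \<in> {1..N}" "k \<in> {1..N}"
  shows "(\<Sum>a\<in>{1..N}. \<Sum>b\<in>{1..N}. C a b i *\<^sub>C pair.tm (comult_f a j) (comult_f b k)) +
      pair.tm (comult_f i j) (comult_vec X k) =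
    (\<Sum>p\<in>{1..N}. \<Sum>q\<in>{1..N}. \<sigma> j k p q *\<^sub>C pair.tm (comult_vec X p) (comult_f i q)) +
      (\<Sum>l\<in>{1..N}. C j k l *\<^sub>C comult_f i l)"
proof -
  let ?Cff = "\<lambda>a. \<Sum>m\<in>{1..N}. \<Sum>n\<in>{1..N}. C m n a *\<^sub>C (f m j * f n k)"
  let ?L1 = "\<Sum>a\<in>{1..N}. \<Sum>b\<in>{1..N}. (\<Sum>m\<in>{1..N}. \<Sum>n\<in>{1..N}. C m n i *\<^sub>C (f m a * f n b)) \<otimes> (f a j * f b k)"
    and ?L2 = "\<Sum>a\<in>{1..N}. f i a \<otimes> (f a j * X k)"
    and ?L3 = "\<Sum>a\<in>{1..N}. \<Sum>b\<in>{1..N}. (f i a * X b) \<otimes> (f a j * f b k)"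
    and ?R1 = "\<Sum>a\<in>{1..N}. f i a \<otimes> (\<Sum>p\<in>{1..N}. \<Sum>q\<in>{1..N}. \<sigma> j k p q *\<^sub>C (X p * f a q))"
    and ?R2 = "\<Sum>b\<in>{1..N}. \<Sum>a\<in>{1..N}. (X b * f i a) \<otimes>
      (\<Sum>p\<in>{1..N}. \<Sum>q\<in>{1..N}. \<sigma> j k p q *\<^sub>C (f b p * f a q))"
    and ?R3 = "\<Sum>a\<in>{1..N}. f i a \<otimes> (\<Sum>l\<in>{1..N}. C j k l *\<^sub>C f a l)"
    and ?Q = "\<Sum>a\<in>{1..N}. f i a \<otimes> ?Cff a"
  have 1: "(\<Sum>a\<in>{1..N}. \<Sum>b\<in>{1..N}. C a b i *\<^sub>C pair.tm (comult_f a j) (comult_f b k)) = ?L1"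
    unfolding sum2_scaleC_tensor2_left[symmetric]
    by (simp add: tm_f_f assms cong: sum.cong_simp)
  have 2: "(\<Sum>p\<in>{1..N}. \<Sum>q\<in>{1..N}. \<sigma> j k p q *\<^sub>C pair.tm (comult_vec X p) (comult_f i q)) = ?R1 + ?R2"
    unfolding sum2_scaleC_tensor2[symmetric] unfolding sum2_scaleC_tensor[symmetric]
    by (simp add: tm_vec_f assms scaleC_right_distrib sum.distrib cong: sum.cong_simp)
  have 3: "(\<Sum>l\<in>{1..N}. C j k l *\<^sub>C comult_f i l) = ?R3"
    by (rule sum_scaleC_tensor)
  have "?L1 + ?L3 = (\<Sum>a\<in>{1..N}. \<Sum>b\<in>{1..N}.
      ((\<Sum>m\<in>{1..N}. \<Sum>n\<in>{1..N}. C m n i *\<^sub>C (f m a * f n b)) + f i a * X b) \<otimes> (f a j * f b k))"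
    by (simp only: tensor_pure_simps(1) sum.distrib)
  also have "\<dots> = (\<Sum>a\<in>{1..N}. \<Sum>b\<in>{1..N}. ((\<Sum>p\<in>{1..N}. \<Sum>q\<in>{1..N}. \<sigma> a b p q *\<^sub>C (X p * f i q)) +
      (\<Sum>l\<in>{1..N}. C a b l *\<^sub>C f i l)) \<otimes> (f a j * f b k))"
    by (intro sum.cong refl arg_cong[where f = "\<lambda>y. y \<otimes> _"] Cff assms)
  also have "\<dots> =
      (\<Sum>a\<in>{1..N}. \<Sum>b\<in>{1..N}. (\<Sum>p\<in>{1..N}. \<Sum>q\<in>{1..N}. \<sigma> a b p q *\<^sub>C (X p * f i q)) \<otimes> (f a j * f b k)) +
      (\<Sum>a\<in>{1..N}. \<Sum>b\<in>{1..N}. (\<Sum>l\<in>{1..N}. C a b l *\<^sub>C f i l) \<otimes> (f a j * f b k))"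
    by (simp only: tensor_pure_simps(1) sum.distrib)
  also have "\<dots> = ?R2 + ?Q"
    unfolding sum2_tensor_move2 sum2_tensor_move1 ff_right[OF jk jk] ..
  finally have 4: "?L1 + ?L3 = ?R2 + ?Q" .
  have "?Q + ?L2 = (\<Sum>a\<in>{1..N}. f i a \<otimes> (?Cff a + f a j * X k))"
    by (simp only: tensor_pure_simps(2) sum.distrib)
  also have "\<dots> = (\<Sum>a\<in>{1..N}. f i a \<otimes> ((\<Sum>p\<in>{1..N}. \<Sum>q\<in>{1..N}. \<sigma> j k p q *\<^sub>C (X p * f a q)) +
      (\<Sum>l\<in>{1..N}. C j k l *\<^sub>C f a l)))"
    by (intro sum.cong refl arg_cong[where f = "\<lambda>y. _ \<otimes> y"] Cff assms)
  also have "\<dots> = ?R1 + ?R3"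
    by (simp only: tensor_pure_simps(2) sum.distrib)
  finally have 5: "?Q + ?L2 = ?R1 + ?R3" .
  have "?L1 + (?L2 + ?L3) = ?R2 + (?Q + ?L2)"
    using 4 by (simp add: add_ac)
  then show ?thesis
    unfolding 1 2 3 tm_f_vec[OF jk(2) assms(1) jk(1)] 5 by (simp add: add_ac)
qed

lemma comult_\<xi>\<xi>:
  assumes ij: "i \<in> {1..N}" "j \<in> {1..N}"
  shows "pair.tm (comult_vec \<xi> i) (comult_vec \<xi> j) +
    (\<Sum>k\<in>{1..N}. \<Sum>l\<in>{1..N}. t i j k l *\<^sub>C pair.tm (comult_vec \<xi> k) (comult_vec \<xi> l)) = 0"
proof -
  let ?H = "\<lambda>a i j. f a i * \<xi> j - \<xi> i * f a j"
  let ?V = "\<lambda>a b. f a i * f b j + (\<Sum>k\<in>{1..N}. \<Sum>l\<in>{1..N}. t i j k l *\<^sub>C (f a k * f b l))"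
  have H: "?H a i j + (\<Sum>k\<in>{1..N}. \<Sum>l\<in>{1..N}. t i j k l *\<^sub>C ?H a k l) = 0" if a: "a \<in> {1..N}" for a
  proof -
    \<comment> \<open>Reordering \<open>\<xi> k * f a l\<close> shows that \<open>?H a\<close> is
      \<open>id - \<sigma>\<close> applied to the family \<open>f a n * \<xi> m\<close>, so
      \<open>t_in_kernel\<close> applies.\<close>
    have eq: "?H a k l = f a k * \<xi> l - (\<Sum>n\<in>{1..N}. \<Sum>m\<in>{1..N}. \<sigma> k l n m *\<^sub>C (f a n * \<xi> m))"
      if "k \<in> {1..N}" "l \<in> {1..N}" for k l
      by (simp only: \<xi>f[OF that a])
    have "?H a i j + (\<Sum>k\<in>{1..N}. \<Sum>l\<in>{1..N}. t i j k l *\<^sub>C ?H a k l) =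
        (f a i * \<xi> j + (\<Sum>k\<in>{1..N}. \<Sum>l\<in>{1..N}. t i j k l *\<^sub>C (f a k * \<xi> l))) -
        ((\<Sum>n\<in>{1..N}. \<Sum>m\<in>{1..N}. \<sigma> i j n m *\<^sub>C (f a n * \<xi> m)) +
        (\<Sum>k\<in>{1..N}. \<Sum>l\<in>{1..N}. t i j k l *\<^sub>C
          (\<Sum>n\<in>{1..N}. \<Sum>m\<in>{1..N}. \<sigma> k l n m *\<^sub>C (f a n * \<xi> m))))"
      by (simp add: eq ij complex_vector.scale_right_diff_distrib sum_subtractf cong: sum.cong_simp)
    also have "\<dots> = 0"
      using t_in_kernel[OF ij, of "\<lambda>k l. f a k * \<xi> l"] by simp
    finally show ?thesis .
  qed
  \<comment> \<open>By \<open>ff\<close>, letting \<open>\<sigma>\<close> act on the first indices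
    of the products \<open>f f\<close> amounts to letting it act on the second ones, where
    \<open>t_in_kernel\<close> absorbs it.\<close>
  have V: "(\<Sum>a\<in>{1..N}. \<Sum>b\<in>{1..N}. \<sigma> a b p q *\<^sub>C ?V a b) = ?V p q"
    if pq: "p \<in> {1..N}" "q \<in> {1..N}" for p q
  proof -
    have "(\<Sum>a\<in>{1..N}. \<Sum>b\<in>{1..N}. \<sigma> a b p q *\<^sub>C
          (\<Sum>k\<in>{1..N}. \<Sum>l\<in>{1..N}. t i j k l *\<^sub>C (f a k * f b l))) =
        (\<Sum>k\<in>{1..N}. \<Sum>l\<in>{1..N}. t i j k l *\<^sub>C
          (\<Sum>a\<in>{1..N}. \<Sum>b\<in>{1..N}. \<sigma> a b p q *\<^sub>C (f a k * f b l)))"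
      by (simp only: complex_vector.scale_sum_right complex_vector.scale_left_commute)
        (rule sum4_swap)
    also have "\<dots> = (\<Sum>k\<in>{1..N}. \<Sum>l\<in>{1..N}. t i j k l *\<^sub>C
          (\<Sum>a\<in>{1..N}. \<Sum>b\<in>{1..N}. \<sigma> k l a b *\<^sub>C (f p a * f q b)))"
      by (intro sum.cong refl arg_cong[where f = "\<lambda>y. _ *\<^sub>C y"] ff pq)
    finally have "(\<Sum>a\<in>{1..N}. \<Sum>b\<in>{1..N}. \<sigma> a b p q *\<^sub>C ?V a b) =
        (\<Sum>a\<in>{1..N}. \<Sum>b\<in>{1..N}. \<sigma> i j a b *\<^sub>C (f p a * f q b)) +
        (\<Sum>k\<in>{1..N}. \<Sum>l\<in>{1..N}. t i j k l *\<^sub>C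
          (\<Sum>a\<in>{1..N}. \<Sum>b\<in>{1..N}. \<sigma> k l a b *\<^sub>C (f p a * f q b)))"
      by (simp only: scaleC_right_distrib sum.distrib ff[OF pq ij])
    then show ?thesis
      using t_in_kernel[OF ij, of "\<lambda>k l. f p k * f q l"] by simp
  qed
  \<comment> \<open>The relation \<open>\<xi>\<xi>\<close> says precisely that the family of
    products \<open>\<xi> a * \<xi> b\<close> satisfies the premise of
    \<open>kernel_factor\<close>.\<close>
  obtain y where y: "\<forall>a\<in>{1..N}. \<forall>b\<in>{1..N}.
      \<xi> a * \<xi> b = y a b - (\<Sum>k\<in>{1..N}. \<Sum>l\<in>{1..N}. \<sigma> a b k l *\<^sub>C y k l)"
    using kernel_factor[of "\<lambda>a b. \<xi> a * \<xi> b"] \<xi>\<xi> by blast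
  have "(\<Sum>a\<in>{1..N}. \<Sum>b\<in>{1..N}. (\<xi> a * \<xi> b) \<otimes> ?V a b) =
      (\<Sum>a\<in>{1..N}. \<Sum>b\<in>{1..N}. y a b \<otimes> ?V a b) -
      (\<Sum>a\<in>{1..N}. \<Sum>b\<in>{1..N}. (\<Sum>k\<in>{1..N}. \<Sum>l\<in>{1..N}. \<sigma> a b k l *\<^sub>C y k l) \<otimes> ?V a b)"
    unfolding sum_subtractf[symmetric] tensor_pure_simps(7)[symmetric]
    by (intro sum.cong refl arg_cong[where f = "\<lambda>y. y \<otimes> _"]) (use y in blast)
  \<comment> \<open>Moved across the tensor sign, \<open>\<sigma>\<close> acts on \<open>?V\<close>
    and is absorbed by \<open>V\<close>, so the two sums are equal.\<close>
  also have "\<dots> = 0"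
    unfolding sum2_tensor_move2 by (simp add: V del: sum.distrib cong: sum.cong_simp)
  finally have 0: "(\<Sum>a\<in>{1..N}. \<Sum>b\<in>{1..N}. (\<xi> a * \<xi> b) \<otimes> ?V a b) = 0" .
  have "pair.tm (comult_vec \<xi> i) (comult_vec \<xi> j) +
      (\<Sum>k\<in>{1..N}. \<Sum>l\<in>{1..N}. t i j k l *\<^sub>C pair.tm (comult_vec \<xi> k) (comult_vec \<xi> l)) =
    1 \<otimes> (\<xi> i * \<xi> j + (\<Sum>k\<in>{1..N}. \<Sum>l\<in>{1..N}. t i j k l *\<^sub>C (\<xi> k * \<xi> l))) +
    (\<Sum>a\<in>{1..N}. \<xi> a \<otimes> (?H a i j + (\<Sum>k\<in>{1..N}. \<Sum>l\<in>{1..N}. t i j k l *\<^sub>C ?H a k l))) +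
    (\<Sum>a\<in>{1..N}. \<Sum>b\<in>{1..N}. (\<xi> a * \<xi> b) \<otimes> ?V a b)"
  proof -
    have "(\<Sum>k\<in>{1..N}. \<Sum>l\<in>{1..N}. t i j k l *\<^sub>C pair.tm (comult_vec \<xi> k) (comult_vec \<xi> l)) =
      1 \<otimes> (\<Sum>k\<in>{1..N}. \<Sum>l\<in>{1..N}. t i j k l *\<^sub>C (\<xi> k * \<xi> l)) +
      (\<Sum>a\<in>{1..N}. \<xi> a \<otimes> (\<Sum>k\<in>{1..N}. \<Sum>l\<in>{1..N}. t i j k l *\<^sub>C ?H a k l)) +
      (\<Sum>a\<in>{1..N}. \<Sum>b\<in>{1..N}. (\<xi> a * \<xi> b) \<otimes> (\<Sum>k\<in>{1..N}. \<Sum>l\<in>{1..N}. t i j k l *\<^sub>C (f a k * f b l)))"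
      unfolding sum2_scaleC_tensor2[symmetric] unfolding sum2_scaleC_tensor[symmetric]
      by (simp add: tm_\<xi>_\<xi> scaleC_right_distrib sum.distrib tensor_pure_simps(4,12)
          cong: sum.cong_simp)
    then show ?thesis
      unfolding tm_\<xi>_\<xi>[OF ij] tensor_pure_simps(2) sum.distrib by (simp only: add_ac)
  qed
  also have "\<dots> = 0"
    unfolding 0 \<xi>\<xi>[OF ij] by (simp add: H tensor_pure_simps cong: sum.cong_simp)
  finally show ?thesis .
qed

text \<open>The mixed terms cancel in pairs by the sign rule: those with \<open>\<delta>\<close> on
  the left directly, those with \<open>\<xi> a\<close> on the left because \<open>\<delta>\<close>
  commutes with \<open>f\<close>.\<close>

lemma comult_\<xi>\<delta>:
  assumes "i \<in> {1..N}"
  shows "pair.tm (comult_vec \<xi> i) comult_\<delta> + pair.tm comult_\<delta> (comult_vec \<xi> i) = comult_vec X i"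
proof -
  have "comult_vec X i = 1 \<otimes> (\<xi> i * \<delta> + \<delta> * \<xi> i) + (\<Sum>a\<in>{1..N}. (\<xi> a * \<delta> + \<delta> * \<xi> a) \<otimes> f a i)"
    by (simp add: \<xi>\<delta> assms cong: sum.cong_simp)
  then show ?thesis
    by (simp add: tm_simps tm_even pair.tensor_mult_pure_odd \<tau>_f \<tau>_one \<tau>_\<xi> \<tau>_\<delta> f\<delta> assms sum.distrib
        tensor_pure_simps sum_negf sum_subtractf cong: sum.cong_simp)
qed

lemma comult_\<delta>\<delta>: "pair.tm comult_\<delta> comult_\<delta> = 0"
  by (simp add: tm_simps tm_even pair.tensor_mult_pure_odd \<tau>_one \<tau>_\<delta> \<delta>\<delta> tensor_pure_simps)

lemma comult_f\<delta>:
  assumes "i \<in> {1..N}" "j \<in> {1..N}"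
  shows "pair.tm (comult_f i j) comult_\<delta> = pair.tm comult_\<delta> (comult_f i j)"
  by (simp add: tm_simps tm_even \<tau>_f \<tau>_one f\<delta> assms sum.distrib cong: sum.cong_simp)

lemma comult_X\<delta>:
  assumes "i \<in> {1..N}"
  shows "pair.tm (comult_vec X i) comult_\<delta> = pair.tm comult_\<delta> (comult_vec X i)"
  by (simp add: tm_simps tm_even \<tau>_f \<tau>_X \<tau>_one f\<delta> X\<delta> assms sum.distrib add_ac cong: sum.cong_simp)

lemma cartan_family_comult:
  "cartan_family N \<sigma> C t pair.tm (comult_vec X) comult_f (comult_vec \<xi>) comult_\<delta>"
  by unfold_locales
    (rule comult_UX[OF XX Xf] comult_ff comult_Cff comult_Uf[OF Xf] comult_\<xi>\<xi> comult_\<xi>\<delta> comult_\<delta>\<delta>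
      comult_Uf[OF \<xi>f] comult_UX[OF \<xi>X \<xi>f] comult_f\<delta> comult_X\<delta>; assumption)+

end

section \<open>The kernel of the transposed braiding\<close>

text \<open>Linear independence provides functionals \<open>\<phi> i\<close> dual to the
  \<open>X i\<close> on the whole space; products of two of them read off the coefficient of
  \<open>X i \<otimes> X j\<close>. This also shows that these tensors are independent.\<close>

lemma tensor_functional_exists:
  fixes X :: "nat \<Rightarrow> 'v::complex_vector" and z :: "nat \<Rightarrow> nat \<Rightarrow> 'w::complex_vector"
  assumes inj: "inj_on X {1..N}" and indep: "\<not> complex_vector.dependent (X ` {1..N})"
  shows "\<exists>\<Phi>. clinear \<Phi> \<and> (\<forall>i\<in>{1..N}. \<forall>j\<in>{1..N}. \<Phi> (X i \<otimes> X j) = z i j)"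
proof -
  interpret P: vector_space_pair "scaleC :: complex \<Rightarrow> 'v \<Rightarrow> 'v" "scaleC :: complex \<Rightarrow> complex \<Rightarrow> complex"
    by (simp add: vector_space_pair_def complex_vector.vector_space_axioms)
  have "\<exists>\<phi>. clinear \<phi> \<and> (\<forall>v\<in>X ` {1..N}. \<phi> v = (if v = X i then 1 else (0 :: complex)))" for i
    by (rule P.linear_independent_extend[OF indep])
  then obtain \<phi> where lin: "\<And>i. clinear (\<phi> i)"
    and \<phi>: "\<And>i v. v \<in> X ` {1..N} \<Longrightarrow> \<phi> i v = (if v = X i then 1 else (0 :: complex))"
    by metis
  have dual: "\<phi> i (X j) = (if j = i then 1 else 0)" if "i \<in> {1..N}" "j \<in> {1..N}" for i j
    using \<phi>[of "X j" i] that inj by (auto simp: inj_on_eq_iff)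
  let ?B = "\<lambda>u v. \<Sum>i\<in>{1..N}. \<Sum>j\<in>{1..N}. (\<phi> i u * \<phi> j v) *\<^sub>C z i j"
  have B: "cbilinear ?B"
    by (simp add: cbilinear_iff clinear_simps(1,2)[OF lin] scaleC_complex_def algebra_simps
        scaleC_left_distrib scaleC_scaleC sum.distrib complex_vector.scale_sum_right)
  have "tensor_lift ?B (X i \<otimes> X j) = z i j" if "i \<in> {1..N}" "j \<in> {1..N}" for i j
  proof -
    have "tensor_lift ?B (X i \<otimes> X j) =
        (\<Sum>k\<in>{1..N}. \<Sum>l\<in>{1..N}. if i = k then if j = l then z k l else 0 else 0)"
      unfolding tensor_lift_pure[OF B]
      by (intro sum.cong refl) (simp add: dual that scaleC_one)
    also have "\<dots> = (\<Sum>k\<in>{1..N}. if i = k then \<Sum>l\<in>{1..N}. if j = l then z k l else 0 else 0)"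
      by (intro sum.cong refl) simp
    also have "\<dots> = z i j"
      using that by simp
    finally show ?thesis .
  qed
  then show ?thesis using clinear_tensor_lift[OF B] by blast
qed

lemma tensor_subspace_span:
  "tensor_subspace (complex_vector.span A) (complex_vector.span B) =
    complex_vector.span {a \<otimes> b | a b. a \<in> A \<and> b \<in> B}"
proof -
  let ?S = "complex_vector.span {a \<otimes> b | a b. a \<in> A \<and> b \<in> B}"
  have left: "x \<otimes> b \<in> ?S" if "x \<in> complex_vector.span A" "b \<in> B" for x b
    using that(1)
  proof (induction rule: complex_vector.span_induct_alt)
    case (step c x y)
    have "x \<otimes> b \<in> ?S" using step that(2) by (intro complex_vector.span_base) blast
    then show ?case
      unfolding tensor_pure_simps
      by (rule complex_vector.span_add[OF complex_vector.span_scale step.IH])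
  qed (simp add: tensor_pure_simps complex_vector.span_zero)
  have "x \<otimes> y \<in> ?S" if x: "x \<in> complex_vector.span A" and y: "y \<in> complex_vector.span B" for x y
    using y
  proof (induction rule: complex_vector.span_induct_alt)
    case (step c u v)
    show ?case
      unfolding tensor_pure_simps
      by (rule complex_vector.span_add[OF complex_vector.span_scale[OF left[OF x step(1)]] step.IH])
  qed (simp add: tensor_pure_simps complex_vector.span_zero)
  then have "tensor_subspace (complex_vector.span A) (complex_vector.span B) \<subseteq> ?S"
    unfolding tensor_subspace_def
    by (intro complex_vector.span_minimal complex_vector.subspace_span) blast
  moreover have "?S \<subseteq> tensor_subspace (complex_vector.span A) (complex_vector.span B)"
    unfolding tensor_subspace_def
    by (intro complex_vector.span_mono) (blast intro: complex_vector.span_base)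
  ultimately show ?thesis by blast
qed

section \<open>Transport of the kernel of the transposed braiding to families of vectors\<close>

context
  fixes N :: nat and X :: "nat \<Rightarrow> 'v::complex_vector" and V :: "'v set"
    and \<sigma> t :: "nat \<Rightarrow> nat \<Rightarrow> nat \<Rightarrow> nat \<Rightarrow> complex"
    and \<sigma>t :: "('v, 'v) tensor \<Rightarrow> ('v, 'v) tensor"
  assumes basis: "basis_family N X V"
    and \<sigma>t_linear: "clinear_on (tensor_subspace V V) \<sigma>t"
    and \<sigma>t_basis: "\<And>i j. i \<in> {1..N} \<Longrightarrow> j \<in> {1..N} \<Longrightarrow>
      \<sigma>t (X i \<otimes> X j) = (\<Sum>k\<in>{1..N}. \<Sum>l\<in>{1..N}. \<sigma> i j k l *\<^sub>C (X k \<otimes> X l))"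
    and t_kernel: "{u \<in> tensor_subspace V V. u - \<sigma>t u = 0} =
      complex_vector.span {X i \<otimes> X j + (\<Sum>k\<in>{1..N}. \<Sum>l\<in>{1..N}. t i j k l *\<^sub>C (X k \<otimes> X l))
        | i j. i \<in> {1..N} \<and> j \<in> {1..N}}"
begin

lemma tensor_basis_span:
  "tensor_subspace V V = complex_vector.span {X i \<otimes> X j | i j. i \<in> {1..N} \<and> j \<in> {1..N}}"
proof -
  have "V = complex_vector.span (X ` {1..N})" using basis by (simp add: basis_family_def)
  moreover have "{a \<otimes> b | a b. a \<in> X ` {1..N} \<and> b \<in> X ` {1..N}} =
      {X i \<otimes> X j | i j. i \<in> {1..N} \<and> j \<in> {1..N}}" by blast
  ultimately show ?thesis by (simp only: tensor_subspace_span)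
qed

text \<open>\<open>\<sigma>t\<close> is only known to be linear on a subspace; a globally linear
  extension makes right inverses and composition with functionals available.\<close>

lemma id_minus_\<sigma>t_extends:
  "\<exists>T. clinear T \<and> (\<forall>u\<in>tensor_subspace V V. T u = u - \<sigma>t u)"
proof -
  obtain T where T: "clinear T" and T_basis: "\<forall>i\<in>{1..N}. \<forall>j\<in>{1..N}.
      T (X i \<otimes> X j) = X i \<otimes> X j - (\<Sum>k\<in>{1..N}. \<Sum>l\<in>{1..N}. \<sigma> i j k l *\<^sub>C (X k \<otimes> X l))"
    using tensor_functional_exists[of X N "\<lambda>i j. X i \<otimes> X j -
      (\<Sum>k\<in>{1..N}. \<Sum>l\<in>{1..N}. \<sigma> i j k l *\<^sub>C (X k \<otimes> X l))"] basis
    by (auto simp: basis_family_def)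
  note lin = clinear_simps[OF T]
  have sub: "complex_vector.subspace (tensor_subspace V V)"
    unfolding tensor_subspace_def by (rule complex_vector.subspace_span)
  have add: "\<sigma>t (u + v) = \<sigma>t u + \<sigma>t v" and scale: "\<sigma>t (c *\<^sub>C u) = c *\<^sub>C \<sigma>t u"
    if "u \<in> tensor_subspace V V" "v \<in> tensor_subspace V V" for u v c
    using \<sigma>t_linear that by (auto simp: clinear_on_def)
  \<comment> \<open>Membership is carried through the induction because additivity of
    \<open>\<sigma>t\<close> holds only inside the subspace.\<close>
  have "u \<in> tensor_subspace V V \<and> T u = u - \<sigma>t u" if "u \<in> tensor_subspace V V" for u
    using that unfolding tensor_basis_span
  proof (induction rule: complex_vector.span_induct_alt)
    case base
    have "\<sigma>t 0 = 0"
      using scale[OF complex_vector.subspace_0[OF sub] complex_vector.subspace_0[OF sub], of 0] by simp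
    then show ?case by (simp add: lin complex_vector.span_zero)
  next
    case (step c x y)
    have x: "x \<in> tensor_subspace V V"
      unfolding tensor_basis_span by (rule complex_vector.span_base) (rule step(1))
    have y: "y \<in> tensor_subspace V V" using step.IH by (simp add: tensor_basis_span)
    have "T x = x - \<sigma>t x" using step(1) T_basis \<sigma>t_basis by auto
    then show ?case
      using step.IH complex_vector.subspace_scale[OF sub x, of c]
        complex_vector.subspace_add[OF sub complex_vector.subspace_scale[OF sub x] y, of c]
      by (simp add: lin add[OF _ y] scale[OF x x] tensor_basis_span[symmetric]
          complex_vector.scale_right_diff_distrib)
  qed
  then show ?thesis using T by blast
qed

text \<open>Apply to the spanning kernel tensor first \<open>id - \<sigma>t\<close>, which gives 0,
  and then the linear map sending each \<open>X k \<otimes> X l\<close> to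
  \<open>z k l\<close>.\<close>

lemma kernel_equation:
  fixes z :: "nat \<Rightarrow> nat \<Rightarrow> 'w::complex_vector"
  assumes ij: "i \<in> {1..N}" "j \<in> {1..N}"
  shows "z i j + (\<Sum>k\<in>{1..N}. \<Sum>l\<in>{1..N}. t i j k l *\<^sub>C z k l) =
    (\<Sum>a\<in>{1..N}. \<Sum>b\<in>{1..N}. \<sigma> i j a b *\<^sub>C z a b) +
    (\<Sum>k\<in>{1..N}. \<Sum>l\<in>{1..N}. t i j k l *\<^sub>C (\<Sum>a\<in>{1..N}. \<Sum>b\<in>{1..N}. \<sigma> k l a b *\<^sub>C z a b))"
proof -
  obtain \<Phi> where \<Phi>: "clinear \<Phi>" and \<Phi>_basis: "\<forall>i\<in>{1..N}. \<forall>j\<in>{1..N}. \<Phi> (X i \<otimes> X j) = z i j"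
    using tensor_functional_exists[of X N z] basis by (auto simp: basis_family_def)
  obtain T where T: "clinear T" and T_eq: "\<And>u. u \<in> tensor_subspace V V \<Longrightarrow> T u = u - \<sigma>t u"
    using id_minus_\<sigma>t_extends by blast
  have XX: "X k \<otimes> X l \<in> tensor_subspace V V" if "k \<in> {1..N}" "l \<in> {1..N}" for k l
    unfolding tensor_basis_span by (rule complex_vector.span_base) (use that in blast)
  let ?u = "X i \<otimes> X j + (\<Sum>k\<in>{1..N}. \<Sum>l\<in>{1..N}. t i j k l *\<^sub>C (X k \<otimes> X l))"
  have "?u \<in> {u \<in> tensor_subspace V V. u - \<sigma>t u = 0}"
    unfolding t_kernel by (rule complex_vector.span_base) (use ij in blast)
  then have "T ?u = 0" using T_eq by simp
  then have "\<Phi> (T ?u) = 0" by (simp add: clinear_simps[OF \<Phi>])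
  then have "z i j - (\<Sum>a\<in>{1..N}. \<Sum>b\<in>{1..N}. \<sigma> i j a b *\<^sub>C z a b) +
      (\<Sum>k\<in>{1..N}. \<Sum>l\<in>{1..N}. t i j k l *\<^sub>C (z k l - (\<Sum>a\<in>{1..N}. \<Sum>b\<in>{1..N}. \<sigma> k l a b *\<^sub>C z a b))) = 0"
    by (simp add: clinear_simps[OF T] clinear_simps[OF \<Phi>] T_eq XX ij \<sigma>t_basis \<Phi>_basis
        cong: sum.cong_simp)
  then show ?thesis
    by (simp add: complex_vector.scale_right_diff_distrib sum_subtractf algebra_simps)
qed

text \<open>The map \<open>\<Phi>\<close> defined by \<open>z\<close> vanishes on the kernel of
  \<open>T\<close>, where \<open>T\<close> extends \<open>id - \<sigma>t\<close>. A right inverse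
  \<open>g\<close> of \<open>T\<close> on the image of the subspace moves any \<open>u\<close> to
  \<open>g (T u)\<close>, which differs from \<open>u\<close> by a kernel element, so
  \<open>\<Phi>\<close> takes the same value on both.\<close>

lemma kernel_factorization:
  fixes z :: "nat \<Rightarrow> nat \<Rightarrow> 'w::complex_vector"
  assumes z: "\<And>i j. i \<in> {1..N} \<Longrightarrow> j \<in> {1..N} \<Longrightarrow>
    z i j + (\<Sum>k\<in>{1..N}. \<Sum>l\<in>{1..N}. t i j k l *\<^sub>C z k l) = 0"
  shows "\<exists>y. \<forall>i\<in>{1..N}. \<forall>j\<in>{1..N}.
    z i j = y i j - (\<Sum>k\<in>{1..N}. \<Sum>l\<in>{1..N}. \<sigma> i j k l *\<^sub>C y k l)"
proof -
  obtain \<Phi> where \<Phi>: "clinear \<Phi>" and \<Phi>_basis: "\<forall>i\<in>{1..N}. \<forall>j\<in>{1..N}. \<Phi> (X i \<otimes> X j) = z i j"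
    using tensor_functional_exists[of X N z] basis by (auto simp: basis_family_def)
  obtain T where T: "clinear T" and T_eq: "\<And>u. u \<in> tensor_subspace V V \<Longrightarrow> T u = u - \<sigma>t u"
    using id_minus_\<sigma>t_extends by blast
  note lin = clinear_simps[OF T] clinear_simps[OF \<Phi>]
  have XX: "X k \<otimes> X l \<in> tensor_subspace V V" if "k \<in> {1..N}" "l \<in> {1..N}" for k l
    unfolding tensor_basis_span by (rule complex_vector.span_base) (use that in blast)
  have sub: "complex_vector.subspace (tensor_subspace V V)"
    unfolding tensor_subspace_def by (rule complex_vector.subspace_span)
  interpret P: vector_space_pair "scaleC :: complex \<Rightarrow> ('v, 'v) tensor \<Rightarrow> _"
    "scaleC :: complex \<Rightarrow> ('v, 'v) tensor \<Rightarrow> _"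
    by (simp add: vector_space_pair_def complex_vector.vector_space_axioms)
  obtain g where g_range: "range g \<subseteq> tensor_subspace V V" and g: "clinear g"
    and g_inverse: "\<forall>v\<in>T ` tensor_subspace V V. T (g v) = v"
    using P.linear_exists_right_inverse_on[OF T sub] by blast
  have \<Phi>_kernel: "\<Phi> u = 0" if u: "u \<in> tensor_subspace V V" "T u = 0" for u
  proof -
    have "u \<in> complex_vector.span {X i \<otimes> X j + (\<Sum>k\<in>{1..N}. \<Sum>l\<in>{1..N}. t i j k l *\<^sub>C (X k \<otimes> X l))
        | i j. i \<in> {1..N} \<and> j \<in> {1..N}}"
      using u T_eq[OF u(1)] unfolding t_kernel[symmetric] by simp
    then show ?thesis
    proof (induction rule: complex_vector.span_induct_alt)
      case (step c x y)
      then obtain i j where ij: "i \<in> {1..N}" "j \<in> {1..N}"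
        and x: "x = X i \<otimes> X j + (\<Sum>k\<in>{1..N}. \<Sum>l\<in>{1..N}. t i j k l *\<^sub>C (X k \<otimes> X l))" by blast
      have "\<Phi> x = z i j + (\<Sum>k\<in>{1..N}. \<Sum>l\<in>{1..N}. t i j k l *\<^sub>C z k l)"
        by (simp add: x lin ij \<Phi>_basis cong: sum.cong_simp)
      then show ?case using z[OF ij] step.IH by (simp add: lin)
    qed (simp add: lin)
  qed
  have factor: "\<Phi> u = \<Phi> (g (T u))" if u: "u \<in> tensor_subspace V V" for u
  proof -
    have "g (T u) \<in> tensor_subspace V V" using g_range by blast
    then have "u - g (T u) \<in> tensor_subspace V V"
      by (rule complex_vector.subspace_diff[OF sub u])
    moreover have "T (u - g (T u)) = 0" using g_inverse u by (simp add: lin)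
    ultimately have "\<Phi> (u - g (T u)) = 0" by (rule \<Phi>_kernel)
    then show ?thesis by (simp add: lin)
  qed
  \<comment> \<open>The witness consists of the values of \<open>\<Phi>\<close> after
    \<open>g\<close> on the basis tensors.\<close>
  have "z i j = \<Phi> (g (X i \<otimes> X j)) - (\<Sum>k\<in>{1..N}. \<Sum>l\<in>{1..N}. \<sigma> i j k l *\<^sub>C \<Phi> (g (X k \<otimes> X l)))"
    if "i \<in> {1..N}" "j \<in> {1..N}" for i j
    using factor[OF XX[OF that]] \<Phi>_basis that
    by (simp add: T_eq XX \<sigma>t_basis clinear_simps[OF g] lin)
  then show ?thesis by (intro exI[of _ "\<lambda>k l. \<Phi> (g (X k \<otimes> X l))"]) blast
qed

end

section \<open>The bialgebra structure\<close>

lemma ball_cartan_gens: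
  "(\<forall>g\<in>cartan_gens N. P g) \<longleftrightarrow> (\<forall>i\<in>{1..N}. P (GX i)) \<and> (\<forall>i\<in>{1..N}. \<forall>j\<in>{1..N}. P (Gf i j)) \<and>
    (\<forall>i\<in>{1..N}. P (G\<xi> i)) \<and> P G\<delta>"
  unfolding cartan_gens_def by blast

locale cartan_algebra =
  cartan_comult \<tau> G N \<sigma> C t "\<lambda>i. \<iota> (GX i)" "\<lambda>i j. \<iota> (Gf i j)" "\<lambda>i. \<iota> (G\<xi> i)" "\<iota> G\<delta>"
  for \<tau> G N \<sigma> C t and \<iota> :: "cartan_gen \<Rightarrow> 'c::complex_algebra" +
  assumes presented: "presented_by (cartan_gens N) (cartan_relations N \<sigma> C t) \<iota>"
begin

abbreviation "comult_hom \<equiv> algebra_hom (*) (1 :: 'c) pair.tm (1 \<otimes> 1)"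
abbreviation "counit_hom \<equiv> algebra_hom (*) (1 :: 'c) (*) (1 :: complex)"

lemma hom_eqI:
  assumes "algebra_hom (*) 1 mult one h" "algebra_hom (*) 1 mult one h'"
    and "\<And>i. i \<in> {1..N} \<Longrightarrow> h (\<iota> (GX i)) = h' (\<iota> (GX i))"
    and "\<And>i j. i \<in> {1..N} \<Longrightarrow> j \<in> {1..N} \<Longrightarrow> h (\<iota> (Gf i j)) = h' (\<iota> (Gf i j))"
    and "\<And>i. i \<in> {1..N} \<Longrightarrow> h (\<iota> (G\<xi> i)) = h' (\<iota> (G\<xi> i))"
    and "h (\<iota> G\<delta>) = h' (\<iota> G\<delta>)"
  shows "h x = h' x"
proof -
  have "\<forall>g\<in>cartan_gens N. h (\<iota> g) = h' (\<iota> g)"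
    unfolding ball_cartan_gens using assms(3-6) by blast
  then have "h = h'" using presented_hom_eqI[OF presented assms(1,2)] by blast
  then show ?thesis by simp
qed

section \<open>Existence, parity and coalgebra laws of the structure maps\<close>

lemma comult_exists: "\<exists>D. comult_hom D \<and> cartan_comult_on_gens N \<iota> D"
proof -
  let ?\<phi> = "\<lambda>g. case g of GX i \<Rightarrow> comult_vec (\<lambda>i. \<iota> (GX i)) i | Gf i j \<Rightarrow> comult_f i j
    | G\<xi> i \<Rightarrow> comult_vec (\<lambda>i. \<iota> (G\<xi> i)) i | G\<delta> \<Rightarrow> comult_\<delta>"
  have "\<forall>r\<in>cartan_relations N \<sigma> C t. word_eval pair.tm (1 \<otimes> 1) ?\<phi> r = 0"
    unfolding tensor.cartan_family_iff using cartan_family_comult by simp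
  then have "\<exists>D. comult_hom D \<and> (\<forall>g\<in>cartan_gens N. D (\<iota> g) = ?\<phi> g)"
    by (intro tensor.presented_universal[OF presented]) blast
  then show ?thesis
    by (simp add: ball_cartan_gens cartan_comult_on_gens_def)
qed

lemma counit_exists: "\<exists>e. counit_hom e \<and> cartan_counit_on_gens N \<iota> e"
proof -
  interpret scalars: superalgebra "(*) :: complex \<Rightarrow> _" 1 id by (rule superalgebra_trivial)
  let ?\<phi> = "\<lambda>g. case g of GX i \<Rightarrow> (0 :: complex) | Gf i j \<Rightarrow> (if i = j then 1 else 0)
    | G\<xi> i \<Rightarrow> 0 | G\<delta> \<Rightarrow> 0"
  have 1: "(\<Sum>i\<in>{1..N}. \<Sum>j\<in>{1..N}. s i j *\<^sub>C ((if i = p then 1 else 0) * (if j = q then 1 else 0))) = (s p q :: complex)"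
    "(\<Sum>i\<in>{1..N}. \<Sum>j\<in>{1..N}. s i j *\<^sub>C ((if p = i then 1 else 0) * (if q = j then 1 else 0))) = (s p q :: complex)"
    if "p \<in> {1..N}" "q \<in> {1..N}" for s p q
  proof -
    have "(\<Sum>j\<in>{1..N}. s i j *\<^sub>C ((if i = p then 1 else 0) * (if j = q then 1 else 0))) =
        (if i = p then s i q else 0)" for i
    proof -
      have "(\<Sum>j\<in>{1..N}. s i j *\<^sub>C ((if i = p then 1 else 0) * (if j = q then 1 else 0))) =
          (\<Sum>j\<in>{1..N}. if j = q then if i = p then s i j else 0 else 0)"
        by (intro sum.cong refl) (simp add: scaleC_complex_def)
      then show ?thesis using that by simp
    qed
    then show "(\<Sum>i\<in>{1..N}. \<Sum>j\<in>{1..N}. s i j *\<^sub>C ((if i = p then 1 else 0) * (if j = q then 1 else 0))) = s p q"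
      using that by simp
    then show "(\<Sum>i\<in>{1..N}. \<Sum>j\<in>{1..N}. s i j *\<^sub>C ((if p = i then 1 else 0) * (if q = j then 1 else 0))) = s p q"
      by (simp only: eq_commute)
  qed
  have 2: "(\<Sum>l\<in>{1..N}. s l *\<^sub>C (if i = l then 1 else 0)) = (s i :: complex)" if "i \<in> {1..N}" for s i
    using that by (simp add: scaleC_complex_def if_distrib[of "\<lambda>x. _ * x"] cong: if_cong)
  \<comment> \<open>Only two relations do not reduce to \<open>0 = 0\<close>: the Kronecker symbols
    turn both sides of \<open>ff\<close> into \<open>\<sigma> p q a b\<close> and both sides of
    \<open>Cff\<close> into \<open>C j k i\<close>.\<close>
  have "cartan_family N \<sigma> C t (*) (\<lambda>i. 0) (\<lambda>i j. if i = j then 1 else 0) (\<lambda>i. 0) (0 :: complex)"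
    by unfold_locales (simp_all add: 1 2)
  then have "\<forall>r\<in>cartan_relations N \<sigma> C t. word_eval (*) 1 ?\<phi> r = 0"
    unfolding scalars.cartan_family_iff by simp
  then have "\<exists>e. counit_hom e \<and> (\<forall>g\<in>cartan_gens N. e (\<iota> g) = ?\<phi> g)"
    by (intro scalars.presented_universal[OF presented]) blast
  then obtain e where "counit_hom e" and "\<forall>g\<in>cartan_gens N. e (\<iota> g) = ?\<phi> g" by blast
  then have "counit_hom e \<and> cartan_counit_on_gens N \<iota> e"
    unfolding ball_cartan_gens cartan_counit_on_gens_def by simp
  then show ?thesis by blast
qed

text \<open>Both sides are homomorphisms, so comparison on generators suffices. This evenness makes
  \<open>D\<close> a map of graded algebras and allows \<open>tensor_map D id\<close> and
  \<open>tensor_map id D\<close> to be multiplicative.\<close>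

lemma comult_even:
  assumes D: "comult_hom D" "cartan_comult_on_gens N \<iota> D"
  shows "D (\<tau> x) = tensor_map \<tau> \<tau> (D x)"
proof (rule hom_eqI[OF algebra_hom_compose[OF algebra_hom_\<tau> D(1)]
      algebra_hom_compose[OF D(1) tensor.algebra_hom_\<tau>]])
  have l: "clinear D" using D(1) by (simp add: algebra_hom_def)
  note simps = \<tau>_X \<tau>_f \<tau>_\<xi> \<tau>_\<delta> \<tau>_one clinear_simps[OF l] clinear_simps[OF tensor.linear_\<tau>]
    tensor_map_pure[OF linear_\<tau> linear_\<tau>] tensor_pure_simps sum_negf
  show "D (\<tau> (\<iota> (GX i))) = tensor_map \<tau> \<tau> (D (\<iota> (GX i)))" if "i \<in> {1..N}" for i
    using D(2) that by (simp add: cartan_comult_on_gens_def simps cong: sum.cong_simp)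
  show "D (\<tau> (\<iota> (Gf i j))) = tensor_map \<tau> \<tau> (D (\<iota> (Gf i j)))" if "i \<in> {1..N}" "j \<in> {1..N}" for i j
    using D(2) that by (simp add: cartan_comult_on_gens_def simps cong: sum.cong_simp)
  show "D (\<tau> (\<iota> (G\<xi> i))) = tensor_map \<tau> \<tau> (D (\<iota> (G\<xi> i)))" if "i \<in> {1..N}" for i
    using D(2) that by (simp add: cartan_comult_on_gens_def simps cong: sum.cong_simp)
  show "D (\<tau> (\<iota> G\<delta>)) = tensor_map \<tau> \<tau> (D (\<iota> G\<delta>))"
    using D(2) by (simp add: cartan_comult_on_gens_def simps)
qed

lemma counit_even:
  assumes e: "counit_hom e" "cartan_counit_on_gens N \<iota> e"
  shows "e (\<tau> x) = e x"
proof (rule hom_eqI[OF algebra_hom_compose[OF algebra_hom_\<tau> e(1)] e(1)])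
qed (use e(2) in \<open>simp_all add: cartan_counit_on_gens_def \<tau>_X \<tau>_f \<tau>_\<xi> \<tau>_\<delta>
    clinear_simps[OF e(1)[unfolded algebra_hom_def, THEN conjunct1]]\<close>)

text \<open>With the values on generators prescribed, preservation of degree is automatic, so
  existence and uniqueness can be argued for plain algebra homomorphisms.\<close>

lemma graded_comult_hom_iff:
  "graded_comult_hom G D \<and> cartan_comult_on_gens N \<iota> D \<longleftrightarrow>
    comult_hom D \<and> cartan_comult_on_gens N \<iota> D"
proof -
  have "D ` G p \<subseteq> tensor_grading G p" if D: "comult_hom D" "cartan_comult_on_gens N \<iota> D" for p
  proof
    fix s assume "s \<in> D ` G p"
    then obtain x where "s = D x" "\<tau> x = parity_sign p *\<^sub>C x" by (auto simp: mem_G_iff)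
    then show "s \<in> tensor_grading G p"
      using D(1) comult_even[OF D, of x]
      by (simp add: tensor_grading_eq clinear_simps algebra_hom_def)
  qed
  then show ?thesis
    by (auto simp: graded_hom_def algebra_hom_def graded_tensor_mult_eq)
qed

lemma graded_counit_hom_iff:
  "graded_counit_hom G e \<and> cartan_counit_on_gens N \<iota> e \<longleftrightarrow>
    counit_hom e \<and> cartan_counit_on_gens N \<iota> e"
proof -
  have "e ` G p \<subseteq> trivial_grading p" if e: "counit_hom e" "cartan_counit_on_gens N \<iota> e" for p
  proof (cases "p = 0")
    case False
    then have p: "p = 1" by (simp add: bit_not_zero_iff)
    have "e x = 0" if "x \<in> G 1" for x
    proof (rule eq_minus_self_imp_zero)
      have "\<tau> x = - x" using that by (simp add: mem_G_simps)
      then show "e x = - e x"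
        using counit_even[OF e, of x] e(1) by (simp add: clinear_simps algebra_hom_def)
    qed
    then show ?thesis by (auto simp: p trivial_grading_def)
  qed (simp add: trivial_grading_def)
  then show ?thesis
    by (auto simp: graded_hom_def algebra_hom_def)
qed

lemma comult_coassoc:
  assumes D: "comult_hom D" "cartan_comult_on_gens N \<iota> D"
  shows "tensor_assoc (tensor_map D id (D x)) = tensor_map id D (D x)"
proof -
  have l: "clinear D" and D1: "D 1 = 1 \<otimes> 1" using D(1) by (simp_all add: algebra_hom_def)
  have left: "superalgebra_pair pair.tm (1 \<otimes> 1) (tensor_map \<tau> \<tau>) ((*) :: 'c \<Rightarrow> _) 1 \<tau>"
    and right: "superalgebra_pair ((*) :: 'c \<Rightarrow> _) 1 \<tau> pair.tm (1 \<otimes> 1) (tensor_map \<tau> \<tau>)" ..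
  note even = comult_even[OF D]
  have h: "algebra_hom (*) 1 (super_tensor_mult (*) \<tau> pair.tm (tensor_map \<tau> \<tau>)) (1 \<otimes> (1 \<otimes> 1))
      (\<lambda>x. tensor_assoc (tensor_map D id (D x)))"
    by (rule algebra_hom_compose[OF algebra_hom_compose[OF D(1)
          algebra_hom_tensor_map[OF pair.superalgebra_pair_axioms left D(1) even algebra_hom_id]]
        algebra_hom_tensor_assoc[OF superalgebra_axioms superalgebra_axioms superalgebra_axioms]]) simp
  have h': "algebra_hom (*) 1 (super_tensor_mult (*) \<tau> pair.tm (tensor_map \<tau> \<tau>)) (1 \<otimes> (1 \<otimes> 1))
      (\<lambda>x. tensor_map id D (D x))"
    by (rule algebra_hom_compose[OF D(1)
          algebra_hom_tensor_map[OF pair.superalgebra_pair_axioms right algebra_hom_id _ D(1) even]]) simp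
  note simps = clinear_simps[OF clinear_tensor_assoc] clinear_simps[OF clinear_tensor_map[OF l clinear_id(1)]]
    clinear_simps[OF clinear_tensor_map[OF clinear_id(1) l]] tensor_map_pure[OF l clinear_id(1)]
    tensor_map_pure[OF clinear_id(1) l] tensor_assoc_pure D1 tensor_pure_simps sum.distrib
    clinear_simps[OF l] add.assoc
  show ?thesis
  proof (rule hom_eqI[OF h h'])
    show "tensor_assoc (tensor_map D id (D (\<iota> (GX i)))) = tensor_map id D (D (\<iota> (GX i)))"
      if "i \<in> {1..N}" for i
      using D(2) that by (simp add: cartan_comult_on_gens_def simps cong: sum.cong_simp) (rule sum.swap)
    show "tensor_assoc (tensor_map D id (D (\<iota> (Gf i j)))) = tensor_map id D (D (\<iota> (Gf i j)))"
      if "i \<in> {1..N}" "j \<in> {1..N}" for i j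
      using D(2) that by (simp add: cartan_comult_on_gens_def simps cong: sum.cong_simp) (rule sum.swap)
    show "tensor_assoc (tensor_map D id (D (\<iota> (G\<xi> i)))) = tensor_map id D (D (\<iota> (G\<xi> i)))"
      if "i \<in> {1..N}" for i
      using D(2) that by (simp add: cartan_comult_on_gens_def simps cong: sum.cong_simp) (rule sum.swap)
    show "tensor_assoc (tensor_map D id (D (\<iota> G\<delta>))) = tensor_map id D (D (\<iota> G\<delta>))"
      using D(2) by (simp add: cartan_comult_on_gens_def simps)
  qed
qed

lemma comult_counit:
  assumes D: "comult_hom D" "cartan_comult_on_gens N \<iota> D"
    and e: "counit_hom e" "cartan_counit_on_gens N \<iota> e"
  shows "tensor_lift (\<lambda>a b. e a *\<^sub>C b) (D x) = x" "tensor_lift (\<lambda>a b. e b *\<^sub>C a) (D x) = x"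
proof -
  have l: "clinear e" and e_mult: "e (x * y) = e x * e y" and e1: "e 1 = 1" for x y
    using e(1) by (simp_all add: algebra_hom_def)
  \<comment> \<open>The counit kills odd parts. Hence applying it to the left factor removes the
    sign-carrying summand of a graded product.\<close>
  have parts: "e (even_part \<tau> x) = e x" "e (odd_part \<tau> x) = 0" for x
    by (simp_all add: even_part_def odd_part_def clinear_simps[OF l] counit_even[OF e] scaleC_complex_def)
  have b: "cbilinear (\<lambda>a (b :: 'c). e a *\<^sub>C b)" "cbilinear (\<lambda>(a :: 'c) b. e b *\<^sub>C a)"
    by (simp_all add: cbilinear_iff clinear_simps(1,2)[OF l] scaleC_left_distrib scaleC_right_distrib
        scaleC_scaleC scaleC_complex_def mult.commute)
  let ?L = "tensor_lift (\<lambda>a b. e a *\<^sub>C b)" and ?R = "tensor_lift (\<lambda>a b. e b *\<^sub>C a)"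
  note linL = clinear_simps[OF clinear_tensor_lift[OF b(1)]] tensor_lift_pure[OF b(1)]
  note linR = clinear_simps[OF clinear_tensor_lift[OF b(2)]] tensor_lift_pure[OF b(2)]
  note times = cbilinear_simps(1-4)[OF cbilinear_times]
  have "?L (pair.tm s u) = ?L s * ?L u" for s u
    by (rule cbilinear_tensor_eqI[where s = s and t = u and B = "\<lambda>s u. ?L (pair.tm s u)"
          and B' = "\<lambda>s u. ?L s * ?L u"])
      (simp_all add: cbilinear_iff linL tm_simps times pair.tensor_mult_pure e_mult parts scaleC_scaleC)
  then have L: "algebra_hom pair.tm (1 \<otimes> 1) (*) 1 ?L"
    by (simp add: algebra_hom_def clinear_tensor_lift b linL e1 scaleC_one)
  have "?R (pair.tm s u) = ?R s * ?R u" for s u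
  proof (rule cbilinear_tensor_eqI[where s = s and t = u and B = "\<lambda>s u. ?R (pair.tm s u)"
        and B' = "\<lambda>s u. ?R s * ?R u"])
    \<comment> \<open>On the right factor the sign appears as \<open>\<tau> b\<close>, which the
      counit does not distinguish from \<open>b\<close>; the two parts of \<open>c\<close> therefore
      recombine.\<close>
    show "?R (pair.tm (a \<otimes> b) (c \<otimes> d)) = ?R (a \<otimes> b) * ?R (c \<otimes> d)" for a b c d
    proof -
      have "?R (pair.tm (a \<otimes> b) (c \<otimes> d)) = (e b * e d) *\<^sub>C (a * (even_part \<tau> c + odd_part \<tau> c))"
        by (simp add: linR pair.tensor_mult_pure e_mult counit_even[OF e] distrib_left
            scaleC_right_distrib)
      then show ?thesis
        by (simp add: even_plus_odd linR times scaleC_scaleC mult.commute)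
    qed
  qed (simp_all add: cbilinear_iff linR tm_simps times)
  then have R: "algebra_hom pair.tm (1 \<otimes> 1) (*) 1 ?R"
    by (simp add: algebra_hom_def clinear_tensor_lift b linR e1 scaleC_one)
  have delta: "(\<Sum>k\<in>{1..N}. (if i = k then 1 else 0) *\<^sub>C u k) = u i"
    "(\<Sum>k\<in>{1..N}. (if k = i then 1 else 0) *\<^sub>C u k) = u i" if "i \<in> {1..N}" for i and u :: "nat \<Rightarrow> 'c"
    using that by (simp_all add: if_distrib[of "\<lambda>c. c *\<^sub>C _"] scaleC_one cong: if_cong)
  have id: "algebra_hom (*) 1 (*) 1 (\<lambda>x :: 'c. x)"
    by (simp add: algebra_hom_def clinear_id)
  show "?L (D x) = x"
    by (rule hom_eqI[OF algebra_hom_compose[OF D(1) L] id])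
      (use D(2) e(2) in \<open>simp_all add: cartan_comult_on_gens_def cartan_counit_on_gens_def linL e1
        scaleC_one delta cong: sum.cong_simp\<close>)
  show "?R (D x) = x"
    by (rule hom_eqI[OF algebra_hom_compose[OF D(1) R] id])
      (use D(2) e(2) in \<open>simp_all add: cartan_comult_on_gens_def cartan_counit_on_gens_def linR e1
        scaleC_one delta cong: sum.cong_simp\<close>)
qed

theorem cartan_bialgebra:
  "(\<exists>!D. graded_comult_hom G D \<and> cartan_comult_on_gens N \<iota> D) \<and>
    (\<exists>!e. graded_counit_hom G e \<and> cartan_counit_on_gens N \<iota> e) \<and>
    (\<forall>D e. graded_comult_hom G D \<and> cartan_comult_on_gens N \<iota> D \<and>
      graded_counit_hom G e \<and> cartan_counit_on_gens N \<iota> e \<longrightarrow> graded_bialgebra G D e)"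
proof (intro conjI allI impI)
  have "D = D'" if "comult_hom D" "cartan_comult_on_gens N \<iota> D" "comult_hom D'"
    "cartan_comult_on_gens N \<iota> D'" for D D'
    by (rule ext, rule hom_eqI[OF that(1,3)]) (use that(2,4) in \<open>simp_all add: cartan_comult_on_gens_def\<close>)
  then show "\<exists>!D. graded_comult_hom G D \<and> cartan_comult_on_gens N \<iota> D"
    unfolding graded_comult_hom_iff using comult_exists by blast
  have "e = e'" if "counit_hom e" "cartan_counit_on_gens N \<iota> e" "counit_hom e'"
    "cartan_counit_on_gens N \<iota> e'" for e e'
    by (rule ext, rule hom_eqI[OF that(1,3)]) (use that(2,4) in \<open>simp_all add: cartan_counit_on_gens_def\<close>)
  then show "\<exists>!e. graded_counit_hom G e \<and> cartan_counit_on_gens N \<iota> e"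
    unfolding graded_counit_hom_iff using counit_exists by blast
  fix D e
  assume *: "graded_comult_hom G D \<and> cartan_comult_on_gens N \<iota> D \<and>
    graded_counit_hom G e \<and> cartan_counit_on_gens N \<iota> e"
  then have D: "comult_hom D" "cartan_comult_on_gens N \<iota> D"
    and e: "counit_hom e" "cartan_counit_on_gens N \<iota> e"
    using graded_comult_hom_iff graded_counit_hom_iff by blast+
  have "coalgebra D e"
  proof (rule coalgebra.intro)
    show "clinear D" "clinear e" using D e by (simp_all add: algebra_hom_def)
  qed (rule comult_coassoc[OF D] comult_counit[OF D e])+
  then show "graded_bialgebra G D e"
    using * by (simp add: graded_bialgebra_def graded_algebra_G)
qed

end

theorem proposition2p3:
  fixes \<Delta> :: "'a::complex_algebra \<Rightarrow> ('a, 'a) tensor"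
    and \<epsilon> :: "'a \<Rightarrow> complex"
    and S :: "'a \<Rightarrow> 'a"
    and lact :: "'a \<Rightarrow> 'g::complex_vector \<Rightarrow> 'g"
    and ract :: "'g \<Rightarrow> 'a \<Rightarrow> 'g"
    and d :: "'a \<Rightarrow> 'g"
    and \<Delta>L :: "'g \<Rightarrow> ('a, 'g) tensor"
    and \<Delta>R :: "'g \<Rightarrow> ('g, 'a) tensor"
    and N :: nat
    and \<omega> :: "nat \<Rightarrow> 'g"
    and f :: "nat \<Rightarrow> nat \<Rightarrow> 'a \<Rightarrow> complex"
    and J :: "nat \<Rightarrow> nat \<Rightarrow> 'a"
    and X :: "nat \<Rightarrow> 'a \<Rightarrow> complex"
    and \<sigma> t :: "nat \<Rightarrow> nat \<Rightarrow> nat \<Rightarrow> nat \<Rightarrow> complex"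
    and C :: "nat \<Rightarrow> nat \<Rightarrow> nat \<Rightarrow> complex"
    and \<T> :: "('a \<Rightarrow> complex) set"
    and \<sigma>t :: "('a \<Rightarrow> complex, 'a \<Rightarrow> complex) tensor \<Rightarrow> ('a \<Rightarrow> complex, 'a \<Rightarrow> complex) tensor"
    and \<iota> :: "cartan_gen \<Rightarrow> 'c::complex_algebra"
    and G :: "bit \<Rightarrow> 'c set"
  defines "\<T> \<equiv> quantum_tangent_space \<Delta> \<epsilon> S lact d"
    and "\<sigma> \<equiv> braiding f J"
    and "C \<equiv> structure_const X J"
    and "G \<equiv> cartan_grading N \<iota>"
  assumes calculus: "bicovariant_calculus \<Delta> \<epsilon> S lact ract d \<Delta>L \<Delta>R"
    and antipode_invertible: "bij S"
    and \<omega>_basis: "basis_family N \<omega> (left_invariant \<Delta>L)"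
    and f_dual: "\<And>i j. i \<in> {1..N} \<Longrightarrow> j \<in> {1..N} \<Longrightarrow> f i j \<in> finite_dual"
    and f_comm: "\<And>i x. i \<in> {1..N} \<Longrightarrow>
      ract (\<omega> i) x = (\<Sum>j\<in>{1..N}. lact (dual_action \<Delta> (f i j) x) (\<omega> j))"
    and J_coaction: "\<And>i. i \<in> {1..N} \<Longrightarrow> \<Delta>R (\<omega> i) = (\<Sum>j\<in>{1..N}. \<omega> j \<otimes> J j i)"
    and X_basis: "basis_family N X \<T>"
    and X_dual: "\<And>i j. i \<in> {1..N} \<Longrightarrow> j \<in> {1..N} \<Longrightarrow>
      tangent_pairing \<epsilon> lact d (X i) (\<omega> j) = (if i = j then 1 else 0)"
    and \<sigma>t_linear: "clinear_on (tensor_subspace \<T> \<T>) \<sigma>t"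
    and \<sigma>t_basis: "\<And>i j. i \<in> {1..N} \<Longrightarrow> j \<in> {1..N} \<Longrightarrow>
      \<sigma>t (X i \<otimes> X j) = (\<Sum>k\<in>{1..N}. \<Sum>l\<in>{1..N}. \<sigma> i j k l *\<^sub>C (X k \<otimes> X l))"
    and t_diag: "\<And>i j. i \<in> {1..N} \<Longrightarrow> j \<in> {1..N} \<Longrightarrow> t i j i j = 0"
    and t_kernel: "{u \<in> tensor_subspace \<T> \<T>. u - \<sigma>t u = 0} =
      complex_vector.span {X i \<otimes> X j + (\<Sum>k\<in>{1..N}. \<Sum>l\<in>{1..N}. t i j k l *\<^sub>C (X k \<otimes> X l))
        | i j. i \<in> {1..N} \<and> j \<in> {1..N}}"
    and cartan: "quantum_cartan_algebra N \<sigma> C t \<iota>"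
  shows "(\<exists>!D. graded_comult_hom G D \<and> cartan_comult_on_gens N \<iota> D) \<and>
    (\<exists>!e. graded_counit_hom G e \<and> cartan_counit_on_gens N \<iota> e) \<and>
    (\<forall>D e. graded_comult_hom G D \<and> cartan_comult_on_gens N \<iota> D \<and>
      graded_counit_hom G e \<and> cartan_counit_on_gens N \<iota> e \<longrightarrow> graded_bialgebra G D e)"
proof -
  have presented: "presented_by (cartan_gens N) (cartan_relations N \<sigma> C t) \<iota>"
    using cartan by (simp add: quantum_cartan_algebra_def)
  have "\<exists>\<tau>. parity_grading \<tau> G \<and>
      (\<forall>g\<in>cartan_gens N. \<tau> (\<iota> g) = parity_sign (cartan_parity g) *\<^sub>C \<iota> g)"
    unfolding G_def cartan_grading_def
    by (rule presented_parity_grading[OF presented]) (rule cartan_relations_homogeneous)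
  then obtain \<tau> where grading: "parity_grading \<tau> G"
    and parities: "\<forall>g\<in>cartan_gens N. \<tau> (\<iota> g) = parity_sign (cartan_parity g) *\<^sub>C \<iota> g"
    by blast
  interpret parity_grading \<tau> G by (rule grading)
  have "word_eval (*) 1 \<iota> r = 0" if "r \<in> cartan_relations N \<sigma> C t" for r
    using presented_relation[OF presented that] cartan_relations_homogeneous[OF that]
    by (auto simp: evaluate_eq_word_eval dest: free_degree_imp_free_on)
  then have family: "cartan_family N \<sigma> C t (*) (\<lambda>i. \<iota> (GX i)) (\<lambda>i j. \<iota> (Gf i j)) (\<lambda>i. \<iota> (G\<xi> i)) (\<iota> G\<delta>)"
    using cartan_family_iff by blast
  interpret cartan_algebra \<tau> G N \<sigma> C t \<iota>
  proof (intro cartan_algebra.intro cartan_comult.intro cartan_comult_axioms.intro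
      cartan_algebra_axioms.intro grading family presented)
    show "\<tau> (\<iota> (GX i)) = \<iota> (GX i)" "\<tau> (\<iota> (G\<xi> i)) = - \<iota> (G\<xi> i)" if "i \<in> {1..N}" for i
      using parities that unfolding ball_cartan_gens
      by (simp_all add: parity_sign_simps scaleC_one minus_one_scaleC)
    show "\<tau> (\<iota> (Gf i j)) = \<iota> (Gf i j)" if "i \<in> {1..N}" "j \<in> {1..N}" for i j
      using parities that unfolding ball_cartan_gens by (simp add: parity_sign_simps scaleC_one)
    show "\<tau> (\<iota> G\<delta>) = - \<iota> G\<delta>"
      using parities unfolding ball_cartan_gens by (simp add: parity_sign_simps minus_one_scaleC)
    \<comment> \<open>The kernel is given inside tensors over \<open>\<T>\<close>; the algebra needs
      its consequences for arbitrary families in \<open>'c\<close>.\<close>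
    fix z :: "nat \<Rightarrow> nat \<Rightarrow> 'c"
    show "z i j + (\<Sum>k\<in>{1..N}. \<Sum>l\<in>{1..N}. t i j k l *\<^sub>C z k l) =
      (\<Sum>a\<in>{1..N}. \<Sum>b\<in>{1..N}. \<sigma> i j a b *\<^sub>C z a b) +
      (\<Sum>k\<in>{1..N}. \<Sum>l\<in>{1..N}. t i j k l *\<^sub>C (\<Sum>a\<in>{1..N}. \<Sum>b\<in>{1..N}. \<sigma> k l a b *\<^sub>C z a b))"
      if "i \<in> {1..N}" "j \<in> {1..N}" for i j
      by (rule kernel_equation[OF X_basis \<sigma>t_linear \<sigma>t_basis t_kernel that])
    assume "\<And>i j. i \<in> {1..N} \<Longrightarrow> j \<in> {1..N} \<Longrightarrow>
      z i j + (\<Sum>k\<in>{1..N}. \<Sum>l\<in>{1..N}. t i j k l *\<^sub>C z k l) = 0"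
    then show "\<exists>y. \<forall>i\<in>{1..N}. \<forall>j\<in>{1..N}.
        z i j = y i j - (\<Sum>k\<in>{1..N}. \<Sum>l\<in>{1..N}. \<sigma> i j k l *\<^sub>C y k l)"
      by (intro kernel_factorization[OF X_basis \<sigma>t_linear \<sigma>t_basis t_kernel])
  qed
  show ?thesis by (rule cartan_bialgebra)
qed

end
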